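(* Let $r,k\ge1$, $s_1,\dots,s_k\ge0$ be integers, $\Gamma$ the complete bipartite supernova quiver with these parameters, and $\boldsymbol\mu=(\mu^1,\dots,\mu^k)$ a $k$-tuple of nonzero partitions, $\mu^i=(\mu^i_1\ge\cdots\ge\mu^i_{s_i+1}\ge0)$, with $n_i:=|\mu^i|$ satisfying $r\geq n_i+\mu^i_1$ for all $i$. Then $$A_{\Gamma,\mathbf{v}_{\boldsymbol\mu}}(q)=\sum_{\mathbf{w}\in S_{\tilde{\boldsymbol\mu}}}R_{\mathbf{w}}(q).$$
   Context: $\Gamma$ has vertices $(l)$, $l=1,\dots,r$, and $(i;j)$, $i=1,\dots,k$, $j=0,\dots,s_i$; arrows: one arrow $(l)\to(i;0)$ for every $l,i$ and one arrow $(i;j)\to(i;j-1)$ for $1\le j\le s_i$. The dimension vector $\mathbf{v}_{\boldsymbol\mu}$ is $v_{(l)}=1$, $v_{(i;0)}=n_i$, $v_{(i;j)}=n_i-\sum_{f=1}^j\mu^i_f$. $A_{\Gamma,\mathbf{v}}(q)$ is the Kac polynomial: the number of isomorphism classes of absolutely indecomposable representations of $\Gamma$ of dimension vector $\mathbf{v}$ over $\mathbb{F}_q$. Set $\mu^i_0:=r-n_i$ and $\tilde\mu^i:=(\mu^i_0,\mu^i_1,\dots,\mu^i_{s_i+1})$. For a sequence $\mathbf{s}=(s'_1,\dots,s'_d)$ of nonnegative integers summing to $r$, partition $\{1,\dots,r\}$ into consecutive intervals (blocks) of sizes $s'_d,s'_{d-1},\dots,s'_1$ in this order from $1$ upward,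 and let $S_{r,\mathbf{s}}$ be the set of permutations $w\in S_r$ with $w^{-1}(a)<w^{-1}(b)$ whenever $a<b$ lie in the same block. Let $S_{\tilde{\boldsymbol\mu}}:=S_{r,\tilde\mu^1}\times\cdots\times S_{r,\tilde\mu^k}$. For $\mathbf{w}=(w_1,\dots,w_k)\in(S_r)^k$, the inversion graph $K_{\mathbf{w}}$ is the multigraph on vertices $1,\dots,r$ having, for each pair $j<i$ and each $t\in\{1,\dots,k\}$ with $w_t(i)<w_t(j)$, one edge joining $i$ and $j$ (of colour $t$). Define $R_{\mathbf{w}}(q):=\sum_{K}(q-1)^{e(K)-r+1}$, the sum over all connected spanning subgraphs $K$ of $K_{\mathbf{w}}$ (all $r$ vertices, a subset of the edges), where $e(K)$ is the number of edges of $K$; $R_{\mathbf{w}}(q)=0$ if $K_{\mathbf{w}}$ is disconnected. *)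

theory Defs
  imports "HOL-Algebra.Algebraic_Closure_Type" "HOL-Combinatorics.Permutations"
begin

section \<open>Representations of a (simple) quiver over a field, concretely by matrices\<close>

text \<open>Vectors of k^n are functions nat => k vanishing from index n on;
  an m x n matrix is a function nat => nat => k vanishing outside the box.\<close>

definition vec :: "nat \<Rightarrow> (nat \<Rightarrow> 'k::zero) set" where
  "vec n = {x. \<forall>i\<ge>n. x i = 0}"

definition mat_box :: "nat \<Rightarrow> nat \<Rightarrow> (nat \<Rightarrow> nat \<Rightarrow> 'k::zero) set" where
  "mat_box m n = {M. \<forall>i j. (m \<le> i \<or> n \<le> j) \<longrightarrow> M i j = 0}"

definition mat_vec :: "nat \<Rightarrow> (nat \<Rightarrow> nat \<Rightarrow> 'k::comm_ring_1) \<Rightarrow> (nat \<Rightarrow> 'k) \<Rightarrow> (nat \<Rightarrow> 'k)" where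
  "mat_vec n M x = (\<lambda>i. \<Sum>j<n. M i j * x j)"

definition mat_mult :: "nat \<Rightarrow> (nat \<Rightarrow> nat \<Rightarrow> 'k::comm_ring_1) \<Rightarrow> (nat \<Rightarrow> nat \<Rightarrow> 'k) \<Rightarrow> (nat \<Rightarrow> nat \<Rightarrow> 'k)" where
  "mat_mult n A B = (\<lambda>i j. \<Sum>l<n. A i l * B l j)"

definition id_mat :: "nat \<Rightarrow> (nat \<Rightarrow> nat \<Rightarrow> 'k::comm_ring_1)" where
  "id_mat n = (\<lambda>i j. if i = j \<and> i < n then 1 else 0)"

definition GL :: "nat \<Rightarrow> (nat \<Rightarrow> nat \<Rightarrow> 'k::comm_ring_1) set" where
  "GL n = {g \<in> mat_box n n. \<exists>h \<in> mat_box n n. mat_mult n g h = id_mat n \<and> mat_mult n h g = id_mat n}"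

text \<open>A quiver is given by a vertex set V and an arrow set A \<subseteq> V \<times> V (at most one arrow
  between an ordered pair of vertices, which suffices for the quiver of the paper);
  the arrow (x,y) goes from x to y.  A representation of dimension vector d assigns
  to each arrow (x,y) a (d y) x (d x) matrix.\<close>

definition reps :: "('v \<times> 'v) set \<Rightarrow> ('v \<Rightarrow> nat) \<Rightarrow> ('v \<times> 'v \<Rightarrow> nat \<Rightarrow> nat \<Rightarrow> 'k::zero) set" where
  "reps A d = {M. (\<forall>a. a \<notin> A \<longrightarrow> M a = (\<lambda>_ _. 0)) \<and>
                  (\<forall>x y. (x, y) \<in> A \<longrightarrow> M (x, y) \<in> mat_box (d y) (d x))}"

definition iso_rep :: "'v set \<Rightarrow> ('v \<times> 'v) set \<Rightarrow> ('v \<Rightarrow> nat)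
    \<Rightarrow> ('v \<times> 'v \<Rightarrow> nat \<Rightarrow> nat \<Rightarrow> 'k::comm_ring_1) \<Rightarrow> ('v \<times> 'v \<Rightarrow> nat \<Rightarrow> nat \<Rightarrow> 'k) \<Rightarrow> bool" where
  "iso_rep V A d M N \<longleftrightarrow> (\<exists>g. (\<forall>x\<in>V. g x \<in> GL (d x)) \<and>
     (\<forall>x y. (x, y) \<in> A \<longrightarrow> mat_mult (d y) (g y) (M (x, y)) = mat_mult (d x) (N (x, y)) (g x)))"

definition subsp :: "nat \<Rightarrow> (nat \<Rightarrow> 'k::field) set \<Rightarrow> bool" where
  "subsp n U \<longleftrightarrow> U \<subseteq> vec n \<and> (\<lambda>_. 0) \<in> U \<and> (\<forall>u\<in>U. \<forall>w\<in>U. (\<lambda>i. u i + w i) \<in> U) \<and>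
                 (\<forall>c. \<forall>u\<in>U. (\<lambda>i. c * u i) \<in> U)"

text \<open>Decomposable: internal direct sum of two nonzero subrepresentations.\<close>
definition decomposable :: "'v set \<Rightarrow> ('v \<times> 'v) set \<Rightarrow> ('v \<Rightarrow> nat)
    \<Rightarrow> ('v \<times> 'v \<Rightarrow> nat \<Rightarrow> nat \<Rightarrow> 'k::field) \<Rightarrow> bool" where
  "decomposable V A d M \<longleftrightarrow> (\<exists>U W.
     (\<forall>x\<in>V. subsp (d x) (U x) \<and> subsp (d x) (W x) \<and> U x \<inter> W x = {\<lambda>_. 0} \<and>
             {(\<lambda>i. u i + w i) | u w. u \<in> U x \<and> w \<in> W x} = vec (d x)) \<and>
     (\<forall>x y. (x, y) \<in> A \<longrightarrow> (\<forall>u\<in>U x. mat_vec (d x) (M (x, y)) u \<in> U y) \<and>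
                              (\<forall>w\<in>W x. mat_vec (d x) (M (x, y)) w \<in> W y)) \<and>
     (\<exists>x\<in>V. U x \<noteq> {\<lambda>_. 0}) \<and> (\<exists>x\<in>V. W x \<noteq> {\<lambda>_. 0}))"

definition indecomposable :: "'v set \<Rightarrow> ('v \<times> 'v) set \<Rightarrow> ('v \<Rightarrow> nat)
    \<Rightarrow> ('v \<times> 'v \<Rightarrow> nat \<Rightarrow> nat \<Rightarrow> 'k::field) \<Rightarrow> bool" where
  "indecomposable V A d M \<longleftrightarrow> (\<exists>x\<in>V. d x \<noteq> 0) \<and> \<not> decomposable V A d M"

text \<open>Absolutely indecomposable: indecomposable after extension of scalars to an algebraic closure.\<close>
definition abs_indecomposable :: "'v set \<Rightarrow> ('v \<times> 'v) set \<Rightarrow> ('v \<Rightarrow> nat)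
    \<Rightarrow> ('v \<times> 'v \<Rightarrow> nat \<Rightarrow> nat \<Rightarrow> 'k::field) \<Rightarrow> bool" where
  "abs_indecomposable V A d M \<longleftrightarrow> indecomposable V A d (\<lambda>a i j. to_ac (M a i j))"

text \<open>Number of isomorphism classes of absolutely indecomposable representations of
  dimension vector d over the (finite) field 'k; i.e. the value A_{Q,d}(q) of the Kac
  polynomial at q = CARD('k).\<close>
definition kac_count :: "'v set \<Rightarrow> ('v \<times> 'v) set \<Rightarrow> ('v \<Rightarrow> nat) \<Rightarrow> 'k::field itself \<Rightarrow> nat" where
  "kac_count V A d _ = card
     ({M :: 'v \<times> 'v \<Rightarrow> nat \<Rightarrow> nat \<Rightarrow> 'k. M \<in> reps A d \<and> abs_indecomposable V A d M}
      // {(M, N). M \<in> reps A d \<and> N \<in> reps A d \<and> iso_rep V A d M N})"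

section \<open>The complete bipartite supernova quiver\<close>

datatype gvert = Lv nat | Pv nat nat   \<comment> \<open>(l) and (i;j)\<close>

definition gamma_V :: "nat \<Rightarrow> nat \<Rightarrow> (nat \<Rightarrow> nat) \<Rightarrow> gvert set" where
  "gamma_V r k s = {Lv l | l. l \<in> {1..r}} \<union> {Pv i j | i j. i \<in> {1..k} \<and> j \<le> s i}"

definition gamma_A :: "nat \<Rightarrow> nat \<Rightarrow> (nat \<Rightarrow> nat) \<Rightarrow> (gvert \<times> gvert) set" where
  "gamma_A r k s = {(Lv l, Pv i 0) | l i. l \<in> {1..r} \<and> i \<in> {1..k}} \<union>
                   {(Pv i j, Pv i (j - 1)) | i j. i \<in> {1..k} \<and> 1 \<le> j \<and> j \<le> s i}"

text \<open>mu i f = \<mu>^i_f for f = 1..s_i+1; n_i = |\<mu>^i|.\<close>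
definition psize :: "(nat \<Rightarrow> nat) \<Rightarrow> (nat \<Rightarrow> nat \<Rightarrow> nat) \<Rightarrow> nat \<Rightarrow> nat" where
  "psize s mu i = (\<Sum>f = 1..s i + 1. mu i f)"

definition dimvec :: "(nat \<Rightarrow> nat) \<Rightarrow> (nat \<Rightarrow> nat \<Rightarrow> nat) \<Rightarrow> gvert \<Rightarrow> nat" where
  "dimvec s mu v = (case v of Lv l \<Rightarrow> 1 | Pv i j \<Rightarrow> psize s mu i - (\<Sum>f = 1..j. mu i f))"

section \<open>The permutation sets S_{r,s} and the inversion-graph polynomials R_w\<close>

text \<open>For ss = [s'_1,...,s'_d], blocks of sizes s'_d, ..., s'_1 are laid out from 1 upward.\<close>
definition same_block :: "nat list \<Rightarrow> nat \<Rightarrow> nat \<Rightarrow> bool" where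
  "same_block ss a b \<longleftrightarrow> (let bs = rev ss in \<exists>t < length bs.
      sum_list (take t bs) < a \<and> a \<le> sum_list (take (Suc t) bs) \<and>
      sum_list (take t bs) < b \<and> b \<le> sum_list (take (Suc t) bs))"

definition S_perm :: "nat \<Rightarrow> nat list \<Rightarrow> (nat \<Rightarrow> nat) set" where
  "S_perm r ss = {w. w permutes {1..r} \<and>
      (\<forall>a b. a < b \<and> same_block ss a b \<longrightarrow> Hilbert_Choice.inv w a < Hilbert_Choice.inv w b)}"

text \<open>tilde mu^i = (mu^i_0, mu^i_1, ..., mu^i_{s_i+1}) with mu^i_0 = r - n_i.\<close>
definition mu_tilde :: "nat \<Rightarrow> (nat \<Rightarrow> nat) \<Rightarrow> (nat \<Rightarrow> nat \<Rightarrow> nat) \<Rightarrow> nat \<Rightarrow> nat list" where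
  "mu_tilde r s mu i = (r - psize s mu i) # map (mu i) [1..<s i + 2]"

text \<open>Edges of the inversion multigraph: (j, i, t) with j < i and w_t i < w_t j.\<close>
definition inv_edges :: "nat \<Rightarrow> nat \<Rightarrow> (nat \<Rightarrow> nat \<Rightarrow> nat) \<Rightarrow> (nat \<times> nat \<times> nat) set" where
  "inv_edges r k w = {(j, i, t). 1 \<le> j \<and> j < i \<and> i \<le> r \<and> t \<in> {1..k} \<and> w t i < w t j}"

definition edge_rel :: "(nat \<times> nat \<times> nat) set \<Rightarrow> (nat \<times> nat) set" where
  "edge_rel K = {(j, i) | j i t. (j, i, t) \<in> K} \<union> {(i, j) | j i t. (j, i, t) \<in> K}"

definition connected_spanning :: "nat \<Rightarrow> (nat \<times> nat \<times> nat) set \<Rightarrow> bool" where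
  "connected_spanning r K \<longleftrightarrow> (\<forall>a\<in>{1..r}. \<forall>b\<in>{1..r}. (a, b) \<in> (edge_rel K)\<^sup>*)"

definition R_poly :: "nat \<Rightarrow> nat \<Rightarrow> (nat \<Rightarrow> nat \<Rightarrow> nat) \<Rightarrow> int \<Rightarrow> int" where
  "R_poly r k w q = (\<Sum>K \<in> {K. K \<subseteq> inv_edges r k w \<and> connected_spanning r K}.
                       (q - 1) ^ (card K + 1 - r))"

end

theory Submission
  imports Defs "HOL-Library.Function_Algebras"
begin

text \<open>
  If some leg map of a representation is not injective, or the combined map from the sum of the lines
  to some \<open>(i;0)\<close> is not surjective, then a summand supported on one leg splits off. Otherwise leg \<open>i\<close> is the
  same datum as a flag in \<open>k\<^sup>r\<close>, the lines being the coordinate axes. A representation of this kind is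
  (absolutely) indecomposable iff no proper nonempty coordinate projection preserves all its flags, and
  two of them are isomorphic iff their flag tuples lie in the same orbit of the diagonal torus; all orbits of
  indecomposables have size \<open>(q - 1)\<^bsup>r-1\<^esup>\<close>.

  For a partition of \<open>{1..r}\<close>, the flags preserved by the projections to its blocks decompose into Schubert cells
  indexed by words, a cell having \<open>q\<close> to the number of non-inversions inside blocks as its size. Summed over words of
  given content this does not depend on the order of the colours (both sides are sums of products of
  \<open>q\<close>-multinomials), so it equals the sum of \<open>q\<close> to the number of inversions inside blocks over \<open>S_perm\<close>, that is
  the sum of \<open>(q - 1)\<^bsup>e(K)\<^esup>\<close> over subgraphs \<open>K\<close> of the inversion graph all of whose edges lie inside blocks. Moebius inversion
  over the partitions then identifies the number of connected flag tuples with the sum over connected spanning \<open>K\<close>.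
\<close>

section \<open>Words with a colour statistic\<close>

text \<open>Connectedness does not factor over the colours, but stability under a prescribed
  collection \<open>p\<close> of vertex sets does, for flags as well as for edges. So the inversion
  runs over all collections of subsets of \<open>{1..r}\<close>; a collection enters only through
  the partition into its atoms, two vertices being equivalent when they lie in the same members of
  \<open>p\<close>. A flag tuple and a subgraph each determine such a collection
  (\<open>tstab\<close>, \<open>uncut\<close>), and connected means that it is
  \<open>{{}, {1..r}}\<close>.

  The order of the colours has to change because of the part \<open>r - n_i\<close>. In a flag it is
  the dimension of step \<open>s i + 1\<close>, the kernel of the map from the sum of the lines, so
  its letter has the highest rank; the inversions of \<open>S_perm\<close> give it the lowest rank,
  the other letters keeping their relative order.

  The exponent \<open>e(K) - r + 1\<close> records a division by the orbit size, the order of the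
  torus modulo scalars. Both sides are therefore compared after multiplication by
  \<open>(q - 1) ^ (r - 1)\<close>, which is nonzero since \<open>q > 1\<close>.\<close>

definition qnum :: "nat \<Rightarrow> nat \<Rightarrow> nat" where
  "qnum q n = (\<Sum>i<n. q ^ i)"

definition qfact :: "nat \<Rightarrow> nat \<Rightarrow> nat" where
  "qfact q n = (\<Prod>i<n. qnum q (Suc i))"

lemma qnum_add: "qnum q (a + b) = qnum q a + q ^ a * qnum q b"
  by (induction b) (auto simp: qnum_def algebra_simps power_add)

lemma qfact_pos: "qfact q n > 0"
  unfolding qfact_def qnum_def
  by (intro prod_pos ballI) (simp add: sum.lessThan_Suc_shift del: sum.lessThan_Suc)

lemma qfact_Suc: "qfact q (Suc n) = qfact q n * qnum q (Suc n)"
  by (simp add: qfact_def)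

lemma qfact_rec: "n > 0 \<Longrightarrow> qfact q n = qnum q n * qfact q (n - 1)"
  by (cases n) (simp_all add: qfact_Suc)

text \<open>The exponents of the geometric sum on the right are cut into consecutive runs, one of
  length \<open>n x\<close> for each colour, in the order of \<open>ord\<close>;
  \<open>qnum_add\<close> glues them. The right side does not involve \<open>ord\<close>, and the
  independence of the ranking used later comes from here.\<close>

lemma qnum_sum:
  fixes ord :: "'c \<Rightarrow> nat"
  assumes "finite C" "inj_on ord C"
  shows "(\<Sum>x\<in>C. q ^ (\<Sum>y | y \<in> C \<and> ord y < ord x. n y) * qnum q (n x)) = qnum q (\<Sum>x\<in>C. n x)"
  using assms
proof (induction rule: finite_ranking_induct[where f = ord])
  case empty
  then show ?case by (simp add: qnum_def)
next
  case (insert x S)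
  show ?case
  proof (cases "x \<in> S")
    case True
    then show ?thesis using insert by (simp add: insert_absorb)
  next
    case False
    have lt: "ord y < ord x" if "y \<in> S" for y
      using insert.hyps(2)[OF that] insert.prems False that by (auto simp: inj_on_def order_less_le)
    have 1: "{y. (y = x \<or> y \<in> S) \<and> ord y < ord x} = S" using lt False by auto
    have 2: "{y. (y = x \<or> y \<in> S) \<and> ord y < ord z} = {y \<in> S. ord y < ord z}" if "z \<in> S" for z
      using lt[OF that] by auto
    have "(\<Sum>z\<in>S. q ^ (\<Sum>y | (y = x \<or> y \<in> S) \<and> ord y < ord z. n y) * qnum q (n z)) = qnum q (\<Sum>x\<in>S. n x)"
      using insert.IH insert.prems by (simp add: 2 inj_on_insert cong: sum.cong)
    then show ?thesis
      using False insert.hyps(1) by (simp add: 1 qnum_add add.commute[of "n x"] add.commute[of _ "qnum q _"])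
  qed
qed

text \<open>Non-inversions inside the classes of \<open>cls\<close>. The ranking \<open>ord\<close>
  is a parameter, so that the dimension of a Schubert cell and the inversion number of a permutation
  become the same statistic for two rankings of the letters.\<close>

definition wstat :: "nat \<Rightarrow> (nat \<Rightarrow> 'b) \<Rightarrow> ('c \<Rightarrow> nat) \<Rightarrow> (nat \<Rightarrow> 'c) \<Rightarrow> nat" where
  "wstat r cls ord c =
     card {(j, i). 1 \<le> j \<and> j < i \<and> i \<le> r \<and> cls j = cls i \<and> ord (c j) < ord (c i)}"

text \<open>Prescribing the content in every class separately makes the generating function of
  \<open>wstat\<close> a product of q-multinomial coefficients, one for each class.\<close>

definition rwords :: "nat \<Rightarrow> (nat \<Rightarrow> 'b) \<Rightarrow> 'c set \<Rightarrow> ('b \<Rightarrow> 'c \<Rightarrow> nat) \<Rightarrow> (nat \<Rightarrow> 'c) set" where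
  "rwords r cls C n = {c \<in> {1..r} \<rightarrow>\<^sub>E C.
     \<forall>b. \<forall>x\<in>C. card {i \<in> {1..r}. cls i = b \<and> c i = x} = n b x}"

lemma finite_pairs: "finite {(j, i). 1 \<le> j \<and> j < i \<and> i \<le> (r::nat) \<and> P j i}"
  by (rule finite_subset[of _ "{1..r} \<times> {1..r}"]) auto

lemma wstat_Suc:
  "wstat (Suc r) cls ord c =
   wstat r cls ord c + card {j \<in> {1..r}. cls j = cls (Suc r) \<and> ord (c j) < ord (c (Suc r))}"
proof -
  let ?A = "{(j, i). 1 \<le> j \<and> j < i \<and> i \<le> r \<and> cls j = cls i \<and> ord (c j) < ord (c i)}"
  let ?B = "{j \<in> {1..r}. cls j = cls (Suc r) \<and> ord (c j) < ord (c (Suc r))}"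
  have eq: "{(j, i). 1 \<le> j \<and> j < i \<and> i \<le> Suc r \<and> cls j = cls i \<and> ord (c j) < ord (c i)}
      = ?A \<union> (\<lambda>j. (j, Suc r)) ` ?B"
    by (auto simp: le_Suc_eq)
  have "card (?A \<union> (\<lambda>j. (j, Suc r)) ` ?B) = card ?A + card ((\<lambda>j. (j, Suc r)) ` ?B)"
    by (rule card_Un_disjoint) (rule finite_pairs, auto)
  also have "card ((\<lambda>j. (j, Suc r)) ` ?B) = card ?B"
    by (rule card_image) (auto simp: inj_on_def)
  finally show ?thesis unfolding wstat_def eq .
qed

lemma wstat_cong:
  assumes "\<And>i. i \<in> {1..r} \<Longrightarrow> c i = c' i"
  shows "wstat r cls ord c = wstat r cls ord c'"
proof -
  have "{(j, i). 1 \<le> j \<and> j < i \<and> i \<le> r \<and> cls j = cls i \<and> ord (c j) < ord (c i)} =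
     {(j, i). 1 \<le> j \<and> j < i \<and> i \<le> r \<and> cls j = cls i \<and> ord (c' j) < ord (c' i)}"
    using assms by auto
  then show ?thesis by (simp add: wstat_def)
qed

lemma card_filter_Suc:
  "card {i \<in> {1..Suc r}. P i} = card {i \<in> {1..r}. P i} + (if P (Suc r) then 1 else 0)"
proof -
  have "{i \<in> {1..Suc r}. P i} = {i \<in> {1..r}. P i} \<union> (if P (Suc r) then {Suc r} else {})"
    by (auto simp: le_Suc_eq)
  then show ?thesis by (auto simp: card_insert_if)
qed

text \<open>A last letter \<open>x\<close> contributes \<open>q\<close> to the number of smaller
  letters before it in its class, and this number is fixed by the content. Together with the factor
  \<open>qnum q (n b x)\<close> released by the shrinking denominator, the sum over \<open>x\<close>
  is the q-integer of the class size, which is the recursion of the q-factorial. The denominators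
  are multiplied out so that everything stays in \<open>nat\<close>.\<close>

lemma sum_rwords:
  fixes ord :: "'c \<Rightarrow> nat" and cls :: "nat \<Rightarrow> 'b"
  assumes "finite C" "inj_on ord C" "finite Bs" "cls ` {1..r} \<subseteq> Bs"
    and "\<And>b. (\<Sum>x\<in>C. n b x) = card {i \<in> {1..r}. cls i = b}"
  shows "(\<Sum>c\<in>rwords r cls C n. q ^ wstat r cls ord c) * (\<Prod>b\<in>Bs. \<Prod>x\<in>C. qfact q (n b x))
       = (\<Prod>b\<in>Bs. qfact q (card {i \<in> {1..r}. cls i = b}))"
  using assms(4,5)
proof (induction r arbitrary: n)
  case 0
  have n0: "n b x = 0" if "x \<in> C" for b x using 0(2)[of b] that assms(1) by auto
  have "rwords 0 cls C n = {\<lambda>_. undefined}" by (auto simp: rwords_def n0)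
  then show ?case by (simp add: wstat_def n0 qfact_def)
next
  case (Suc r)
  let ?b = "cls (Suc r)"
  \<comment> \<open>Letters that can stand in the last position, and the content left after one of
    them has been taken from the class of that position.\<close>
  define C' where "C' = {x \<in> C. n ?b x > 0}"
  define m where "m x = n(?b := (n ?b)(x := n ?b x - 1))" for x
  have finC': "finite C'" using assms(1) by (simp add: C'_def)
  have mbx: "m x b y = n b y - (if b = ?b \<and> y = x then 1 else 0)" for x b y
    by (auto simp: m_def)
  have mem: "c'(Suc r := x) \<in> rwords (Suc r) cls C n" if x: "x \<in> C'" and c': "c' \<in> rwords r cls C (m x)" for x c'
  proof -
    have 1: "c'(Suc r := x) \<in> {1..Suc r} \<rightarrow>\<^sub>E C"
      using c' x by (auto simp: rwords_def C'_def PiE_def Pi_def extensional_def)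
    have 2: "card {i \<in> {1..Suc r}. cls i = b \<and> (c'(Suc r := x)) i = y} = n b y" if "y \<in> C" for b y
    proof -
      have "{i \<in> {1..r}. cls i = b \<and> (c'(Suc r := x)) i = y} = {i \<in> {1..r}. cls i = b \<and> c' i = y}" by auto
      then have A: "card {i \<in> {1..r}. cls i = b \<and> (c'(Suc r := x)) i = y} = m x b y"
        using c' that by (simp add: rwords_def)
      show ?thesis using x unfolding card_filter_Suc A by (auto simp: mbx C'_def)
    qed
    show ?thesis using 1 2 by (simp add: rwords_def)
  qed
  have mem': "c (Suc r) \<in> C' \<and> c(Suc r := undefined) \<in> rwords r cls C (m (c (Suc r)))"
    if c: "c \<in> rwords (Suc r) cls C n" for c
  proof -
    have cC: "c (Suc r) \<in> C" using c by (auto simp: rwords_def)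
    have cnt: "card {i \<in> {1..r}. cls i = b \<and> c i = y} + (if b = ?b \<and> y = c (Suc r) then 1 else 0) = n b y"
      if "y \<in> C" for b y
      using c that card_filter_Suc[of r "\<lambda>i. cls i = b \<and> c i = y"] unfolding rwords_def by auto
    have 1: "c (Suc r) \<in> C'" using cnt[OF cC, of ?b] cC by (simp add: C'_def)
    have 2: "c(Suc r := undefined) \<in> {1..r} \<rightarrow>\<^sub>E C"
      using c by (auto simp: rwords_def PiE_def Pi_def extensional_def)
    have "card {i \<in> {1..r}. cls i = b \<and> (c(Suc r := undefined)) i = y} = m (c (Suc r)) b y" if "y \<in> C" for b y
    proof -
      have "{i \<in> {1..r}. cls i = b \<and> (c(Suc r := undefined)) i = y} = {i \<in> {1..r}. cls i = b \<and> c i = y}" by auto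
      then show ?thesis using cnt[OF that, of b] by (auto simp: mbx)
    qed
    with 1 2 show ?thesis by (simp add: rwords_def)
  qed
  have ext: "c'(Suc r := undefined) = c'" if "c' \<in> rwords r cls C k" for c' k
    using that by (auto simp: rwords_def PiE_def extensional_def)
  have fin: "finite (rwords r cls C k)" for k
    by (rule finite_subset[of _ "{1..r} \<rightarrow>\<^sub>E C"]) (auto simp: rwords_def assms(1) intro: finite_PiE)
  have st: "wstat (Suc r) cls ord (c'(Suc r := x)) = wstat r cls ord c' + (\<Sum>y | y \<in> C \<and> ord y < ord x. n ?b y)"
    if x: "x \<in> C'" and c': "c' \<in> rwords r cls C (m x)" for x c'
  proof -
    let ?J = "{j \<in> {1..r}. cls j = ?b \<and> ord (c' j) < ord x}"
    have eq: "?J = (\<Union>y\<in>{y. y \<in> C \<and> ord y < ord x}. {j \<in> {1..r}. cls j = ?b \<and> c' j = y})"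
      using c' by (auto simp: rwords_def)
    have "card ?J = (\<Sum>y | y \<in> C \<and> ord y < ord x. card {j \<in> {1..r}. cls j = ?b \<and> c' j = y})"
      unfolding eq by (rule card_UN_disjoint) (auto simp: assms(1))
    also have "\<dots> = (\<Sum>y | y \<in> C \<and> ord y < ord x. n ?b y)"
    proof (rule sum.cong[OF refl])
      fix y assume y: "y \<in> {y. y \<in> C \<and> ord y < ord x}"
      then have "card {j \<in> {1..r}. cls j = ?b \<and> c' j = y} = m x ?b y" using c' by (simp add: rwords_def)
      then show "card {j \<in> {1..r}. cls j = ?b \<and> c' j = y} = n ?b y" using y by (auto simp: mbx)
    qed
    finally have J: "card ?J = \<dots>" .
    have "{j \<in> {1..r}. cls j = ?b \<and> ord ((c'(Suc r := x)) j) < ord x} = ?J" by auto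
    moreover have "wstat r cls ord (c'(Suc r := x)) = wstat r cls ord c'"
      by (rule wstat_cong) auto
    ultimately show ?thesis using J by (simp add: wstat_Suc)
  qed
  have prodm: "(\<Prod>b\<in>Bs. \<Prod>y\<in>C. qfact q (n b y)) = qnum q (n ?b x) * (\<Prod>b\<in>Bs. \<Prod>y\<in>C. qfact q (m x b y))"
    if x: "x \<in> C'" for x
  proof -
    have bB: "?b \<in> Bs" using Suc.prems(1) by auto
    have xC: "x \<in> C" using x by (simp add: C'_def)
    have inner: "(\<Prod>y\<in>C. qfact q (n ?b y)) = qnum q (n ?b x) * (\<Prod>y\<in>C. qfact q (m x ?b y))"
    proof -
      have "(\<Prod>y\<in>C - {x}. qfact q (n ?b y)) = (\<Prod>y\<in>C - {x}. qfact q (m x ?b y))"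
        by (rule prod.cong) (auto simp: mbx)
      then show ?thesis using x xC qfact_rec[of "n ?b x" q]
        by (simp add: prod.remove[OF assms(1) xC] mbx C'_def)
    qed
    have "(\<Prod>b\<in>Bs - {?b}. \<Prod>y\<in>C. qfact q (n b y)) = (\<Prod>b\<in>Bs - {?b}. \<Prod>y\<in>C. qfact q (m x b y))"
      by (rule prod.cong) (auto simp: mbx intro!: prod.cong)
    then show ?thesis by (simp add: prod.remove[OF assms(3) bB] inner)
  qed
  have IH: "(\<Sum>c\<in>rwords r cls C (m x). q ^ wstat r cls ord c) * (\<Prod>b\<in>Bs. \<Prod>y\<in>C. qfact q (m x b y))
       = (\<Prod>b\<in>Bs. qfact q (card {i \<in> {1..r}. cls i = b}))" if x: "x \<in> C'" for x
  proof (rule Suc.IH)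
    show "cls ` {1..r} \<subseteq> Bs" using Suc.prems(1) by auto
    fix b
    have xC: "x \<in> C" using x by (simp add: C'_def)
    have "(\<Sum>y\<in>C. n b y) = (\<Sum>y\<in>C. m x b y) + (if b = ?b then 1 else 0)"
    proof (cases "b = ?b")
      case True
      have "(\<Sum>y\<in>C - {x}. n b y) = (\<Sum>y\<in>C - {x}. m x b y)"
        by (rule sum.cong) (auto simp: mbx)
      then show ?thesis using x True by (simp add: sum.remove[OF assms(1) xC] mbx C'_def)
    qed (auto simp: mbx)
    then show "(\<Sum>y\<in>C. m x b y) = card {i \<in> {1..r}. cls i = b}"
      using Suc.prems(2)[of b, unfolded card_filter_Suc] by (simp split: if_splits)
  qed
  have "(\<Sum>c\<in>rwords (Suc r) cls C n. q ^ wstat (Suc r) cls ord c)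
      = (\<Sum>(x, c')\<in>Sigma C' (\<lambda>x. rwords r cls C (m x)). q ^ wstat (Suc r) cls ord (c'(Suc r := x)))"
    by (rule sum.reindex_bij_witness[where i = "\<lambda>(x, c'). c'(Suc r := x)"
          and j = "\<lambda>c. (c (Suc r), c(Suc r := undefined))"])
      (use mem mem' ext in \<open>auto\<close>)
  also have "\<dots> = (\<Sum>x\<in>C'. \<Sum>c'\<in>rwords r cls C (m x). q ^ wstat (Suc r) cls ord (c'(Suc r := x)))"
    using finC' fin by (subst sum.Sigma) auto
  also have "\<dots> = (\<Sum>x\<in>C'. q ^ (\<Sum>y | y \<in> C \<and> ord y < ord x. n ?b y) * (\<Sum>c'\<in>rwords r cls C (m x). q ^ wstat r cls ord c'))"
    by (intro sum.cong refl) (simp add: st power_add mult.commute flip: sum_distrib_right)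
  finally have "(\<Sum>c\<in>rwords (Suc r) cls C n. q ^ wstat (Suc r) cls ord c) * (\<Prod>b\<in>Bs. \<Prod>x\<in>C. qfact q (n b x))
     = (\<Sum>x\<in>C'. q ^ (\<Sum>y | y \<in> C \<and> ord y < ord x. n ?b y) * (\<Sum>c'\<in>rwords r cls C (m x). q ^ wstat r cls ord c')
          * (\<Prod>b\<in>Bs. \<Prod>x\<in>C. qfact q (n b x)))"
    by (simp add: sum_distrib_right)
  also have "\<dots> = (\<Sum>x\<in>C'. q ^ (\<Sum>y | y \<in> C \<and> ord y < ord x. n ?b y) * qnum q (n ?b x)
          * (\<Prod>b\<in>Bs. qfact q (card {i \<in> {1..r}. cls i = b})))"
  proof (rule sum.cong[OF refl])
    fix x assume x: "x \<in> C'"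
    show "q ^ (\<Sum>y | y \<in> C \<and> ord y < ord x. n ?b y) * (\<Sum>c'\<in>rwords r cls C (m x). q ^ wstat r cls ord c')
          * (\<Prod>b\<in>Bs. \<Prod>x\<in>C. qfact q (n b x)) =
      q ^ (\<Sum>y | y \<in> C \<and> ord y < ord x. n ?b y) * qnum q (n ?b x)
          * (\<Prod>b\<in>Bs. qfact q (card {i \<in> {1..r}. cls i = b}))"
      unfolding prodm[OF x] IH[OF x, symmetric] by (simp add: algebra_simps)
  qed
  also have "\<dots> = (\<Sum>x\<in>C'. q ^ (\<Sum>y | y \<in> C \<and> ord y < ord x. n ?b y) * qnum q (n ?b x))
          * (\<Prod>b\<in>Bs. qfact q (card {i \<in> {1..r}. cls i = b}))"
    by (simp add: sum_distrib_right)
  \<comment> \<open>A letter absent from the class has \<open>qnum q 0 = 0\<close>, so the sum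
    extends to all of \<open>C\<close>, where \<open>qnum_sum\<close> applies.\<close>
  also have "(\<Sum>x\<in>C'. q ^ (\<Sum>y | y \<in> C \<and> ord y < ord x. n ?b y) * qnum q (n ?b x))
      = (\<Sum>x\<in>C. q ^ (\<Sum>y | y \<in> C \<and> ord y < ord x. n ?b y) * qnum q (n ?b x))"
    by (rule sum.mono_neutral_left) (auto simp: assms(1) C'_def qnum_def)
  also have "\<dots> = qnum q (\<Sum>x\<in>C. n ?b x)" by (rule qnum_sum[OF assms(1,2)])
  also have "(\<Sum>x\<in>C. n ?b x) = card {i \<in> {1..Suc r}. cls i = ?b}" by (rule Suc.prems(2))
  also have "qnum q (card {i \<in> {1..Suc r}. cls i = ?b}) * (\<Prod>b\<in>Bs. qfact q (card {i \<in> {1..r}. cls i = b}))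
     = (\<Prod>b\<in>Bs. qfact q (card {i \<in> {1..Suc r}. cls i = b}))"
  proof -
    have bB: "?b \<in> Bs" using Suc.prems(1) by auto
    have 1: "card {i \<in> {1..Suc r}. cls i = ?b} = Suc (card {i \<in> {1..r}. cls i = ?b})"
      unfolding card_filter_Suc by simp
    have 2: "(\<Prod>b\<in>Bs - {?b}. qfact q (card {i \<in> {1..Suc r}. cls i = b}))
        = (\<Prod>b\<in>Bs - {?b}. qfact q (card {i \<in> {1..r}. cls i = b}))"
      by (rule prod.cong[OF refl], unfold card_filter_Suc) auto
    show ?thesis
      unfolding prod.remove[OF assms(3) bB] 1 2 qfact_Suc by (simp only: mult_ac)
  qed
  finally show ?case .
qed

definition cwords :: "nat \<Rightarrow> 'c set \<Rightarrow> ('c \<Rightarrow> nat) \<Rightarrow> (nat \<Rightarrow> 'c) set" where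
  "cwords r C k = {c \<in> {1..r} \<rightarrow>\<^sub>E C. \<forall>x\<in>C. card {i \<in> {1..r}. c i = x} = k x}"

text \<open>Words are grouped by their content in each class. By \<open>sum_rwords\<close> each
  group, multiplied by the same positive product of q-factorials, has a sum that does not mention
  the ranking; the product is then cancelled.\<close>

lemma sum_cwords_ord:
  fixes q :: nat and ord ord' :: "'c \<Rightarrow> nat" and cls :: "nat \<Rightarrow> 'b"
  assumes "finite C" "inj_on ord C" "inj_on ord' C"
  shows "(\<Sum>c\<in>cwords r C k. q ^ wstat r cls ord c) = (\<Sum>c\<in>cwords r C k. q ^ wstat r cls ord' c)"
proof -
  define cont where "cont c = (\<lambda>b x. card {i \<in> {1..r}. cls i = b \<and> c i = x})" for c :: "nat \<Rightarrow> 'c"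
  define cc where "cc c = (\<lambda>b x. if x \<in> C then cont c b x else 0)" for c :: "nat \<Rightarrow> 'c"
  have finW: "finite (cwords r C k)"
    by (rule finite_subset[of _ "{1..r} \<rightarrow>\<^sub>E C"]) (auto simp: cwords_def assms(1) intro: finite_PiE)
  have tot: "card {i \<in> {1..r}. c i = x} = (\<Sum>b\<in>cls ` {1..r}. cont c b x)" for c :: "nat \<Rightarrow> 'c" and x
  proof -
    have eq: "{i \<in> {1..r}. c i = x} = (\<Union>b\<in>cls ` {1..r}. {i \<in> {1..r}. cls i = b \<and> c i = x})" by auto
    show ?thesis unfolding eq cont_def by (rule card_UN_disjoint) auto
  qed
  have fib: "{c \<in> cwords r C k. cc c = cc c0} = rwords r cls C (cc c0)" if c0: "c0 \<in> cwords r C k" for c0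
  proof (intro equalityI subsetI)
    fix c assume "c \<in> {c \<in> cwords r C k. cc c = cc c0}"
    then have c: "c \<in> cwords r C k" "cc c = cc c0" by auto
    have "cont c b x = cc c0 b x" if "x \<in> C" for b x
      unfolding c(2)[symmetric] using that by (simp add: cc_def)
    with c(1) show "c \<in> rwords r cls C (cc c0)" by (simp add: rwords_def cwords_def cont_def)
  next
    fix c assume c: "c \<in> rwords r cls C (cc c0)"
    then have e: "cont c b x = cont c0 b x" if "x \<in> C" for b x
      using that by (auto simp: rwords_def cc_def cont_def)
    then have "cc c = cc c0" by (auto simp: cc_def fun_eq_iff)
    moreover have "card {i \<in> {1..r}. c i = x} = card {i \<in> {1..r}. c0 i = x}" if "x \<in> C" for x
      unfolding tot using e[OF that] by simp
    then have "c \<in> cwords r C k"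
      using c c0 by (simp add: rwords_def cwords_def)
    ultimately show "c \<in> {c \<in> cwords r C k. cc c = cc c0}" by simp
  qed
  have eq: "(\<Sum>c\<in>rwords r cls C (cc c0). q ^ wstat r cls ord c) = (\<Sum>c\<in>rwords r cls C (cc c0). q ^ wstat r cls ord' c)"
    if c0: "c0 \<in> cwords r C k" for c0
  proof -
    have sm: "(\<Sum>x\<in>C. cc c0 b x) = card {i \<in> {1..r}. cls i = b}" for b
    proof -
      have eq: "{i \<in> {1..r}. cls i = b} = (\<Union>x\<in>C. {i \<in> {1..r}. cls i = b \<and> c0 i = x})"
        using c0 by (auto simp: cwords_def)
      have "card {i \<in> {1..r}. cls i = b} = (\<Sum>x\<in>C. cont c0 b x)"
        unfolding eq cont_def by (rule card_UN_disjoint) (auto simp: assms(1))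
      then show ?thesis by (simp add: cc_def)
    qed
    let ?P = "\<Prod>b\<in>cls ` {1..r}. \<Prod>x\<in>C. qfact q (cc c0 b x)"
    have "?P > 0" by (intro prod_pos ballI qfact_pos)
    then have nz: "?P \<noteq> 0" by (rule gr_implies_not0)
    have "(\<Sum>c\<in>rwords r cls C (cc c0). q ^ wstat r cls ord c) * ?P = (\<Sum>c\<in>rwords r cls C (cc c0). q ^ wstat r cls ord' c) * ?P"
      using sum_rwords[OF assms(1,2), of "cls ` {1..r}" cls r "cc c0" q] sum_rwords[OF assms(1,3), of "cls ` {1..r}" cls r "cc c0" q] sm
      by simp
    then show ?thesis by (rule mult_right_cancel[THEN iffD1, OF nz])
  qed
  have grp: "(\<Sum>c\<in>cwords r C k. g c) = (\<Sum>n\<in>cc ` cwords r C k. \<Sum>c | c \<in> cwords r C k \<and> cc c = n. g c)" for g :: "(nat \<Rightarrow> 'c) \<Rightarrow> nat"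
    by (rule sum.image_gen[OF finW])
  show ?thesis unfolding grp
    by (rule sum.cong[OF refl]) (auto simp: fib eq)
qed

section \<open>Standardization of words\<close>

definition psum :: "nat list \<Rightarrow> nat \<Rightarrow> nat" where
  "psum bs t = sum_list (take t bs)"

text \<open>Blocks are numbered from 0. Taking the least \<open>t\<close> skips blocks of size 0, so
  that for \<open>a\<close> in range the chosen block really contains \<open>a\<close>.\<close>

definition bk :: "nat list \<Rightarrow> nat \<Rightarrow> nat" where
  "bk bs a = (LEAST t. a \<le> psum bs (Suc t))"

lemma psum_Suc: "t < length bs \<Longrightarrow> psum bs (Suc t) = psum bs t + bs ! t"
  by (simp add: psum_def take_Suc_conv_app_nth)

lemma psum_mono: "t \<le> t' \<Longrightarrow> psum bs t \<le> psum bs t'"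
proof -
  assume "t \<le> t'"
  then obtain d where "t' = t + d" using le_Suc_ex by blast
  then show ?thesis by (simp add: psum_def take_add)
qed

lemma bk_props:
  assumes "1 \<le> a" "a \<le> sum_list bs"
  shows "bk bs a < length bs" "psum bs (bk bs a) < a" "a \<le> psum bs (Suc (bk bs a))"
proof -
  have L: "0 < length bs" using assms by (cases bs) auto
  have ex: "a \<le> psum bs (Suc (length bs - 1))" using assms L by (simp add: psum_def)
  show 3: "a \<le> psum bs (Suc (bk bs a))" unfolding bk_def by (rule LeastI, rule ex)
  have "bk bs a \<le> length bs - 1" unfolding bk_def by (rule Least_le, rule ex)
  then show "bk bs a < length bs" using L by linarith
  show "psum bs (bk bs a) < a"
  proof (cases "bk bs a")
    case 0
    then show ?thesis using assms by (simp add: psum_def)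
  next
    case (Suc t)
    then have "\<not> a \<le> psum bs (Suc t)" unfolding bk_def by (intro not_less_Least) simp
    then show ?thesis using Suc by simp
  qed
qed

lemma bk_unique:
  assumes "psum bs t < a" "a \<le> psum bs (Suc t)"
  shows "bk bs a = t"
  unfolding bk_def
proof (rule Least_equality)
  fix y assume "a \<le> psum bs (Suc y)"
  then have "\<not> Suc y \<le> t" using assms(1) psum_mono[of "Suc y" t bs] by linarith
  then show "t \<le> y" by simp
qed (rule assms(2))

lemma same_block_iff:
  assumes "a \<in> {1..sum_list ss}" "b \<in> {1..sum_list ss}"
  shows "same_block ss a b \<longleftrightarrow> bk (rev ss) a = bk (rev ss) b"
proof
  assume "same_block ss a b"
  then obtain t where "psum (rev ss) t < a" "a \<le> psum (rev ss) (Suc t)"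
    "psum (rev ss) t < b" "b \<le> psum (rev ss) (Suc t)"
    by (auto simp: same_block_def Let_def psum_def)
  then show "bk (rev ss) a = bk (rev ss) b" by (simp add: bk_unique)
next
  assume eq: "bk (rev ss) a = bk (rev ss) b"
  show "same_block ss a b"
    using bk_props[of a "rev ss"] bk_props[of b "rev ss"] assms eq
    unfolding same_block_def Let_def psum_def
    by (intro exI[of _ "bk (rev ss) a"]) auto
qed

lemma bk_mono:
  assumes "1 \<le> a" "a \<le> b" "b \<le> sum_list bs"
  shows "bk bs a \<le> bk bs b"
  unfolding bk_def[of bs a]
  by (rule Least_le) (use assms bk_props(3)[of b bs] in linarith)

lemma bk_less:
  assumes "1 \<le> a" "a \<le> sum_list bs" "1 \<le> b" "b \<le> sum_list bs" "bk bs a < bk bs b"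
  shows "a < b"
  using bk_mono[of b a bs] assms by (meson not_le)

text \<open>Standardization: the occurrences of the letter \<open>t\<close> receive the entries of
  block \<open>t\<close> from left to right. Outside \<open>{1..r}\<close> the value is
  \<open>i\<close> because \<open>permutes\<close> demands it.\<close>

definition stdz :: "nat \<Rightarrow> nat list \<Rightarrow> (nat \<Rightarrow> nat) \<Rightarrow> nat \<Rightarrow> nat" where
  "stdz r bs c i = (if i \<in> {1..r} then psum bs (c i) + card {i' \<in> {1..i}. c i' = c i} else i)"

lemma stdz_props:
  assumes c: "c \<in> cwords r {..<length bs} (\<lambda>t. bs ! t)" and i: "i \<in> {1..r}"
  shows "psum bs (c i) < stdz r bs c i" "stdz r bs c i \<le> psum bs (Suc (c i))"
    "bk bs (stdz r bs c i) = c i"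
proof -
  have ci: "c i < length bs" using c i by (auto simp: cwords_def)
  have "i \<in> {i' \<in> {1..i}. c i' = c i}" using i by simp
  then have "card {i' \<in> {1..i}. c i' = c i} > 0" unfolding card_gt_0_iff by (intro conjI) (blast, simp)
  then show 1: "psum bs (c i) < stdz r bs c i" using i by (simp only: stdz_def if_True less_add_same_cancel1)
  have "card {i' \<in> {1..i}. c i' = c i} \<le> card {i' \<in> {1..r}. c i' = c i}"
    by (rule card_mono) (use i in auto)
  also have "\<dots> = bs ! c i" using c ci by (simp add: cwords_def)
  finally show 2: "stdz r bs c i \<le> psum bs (Suc (c i))"
    using i ci by (simp add: stdz_def psum_Suc)
  show "bk bs (stdz r bs c i) = c i" by (rule bk_unique[OF 1 2])
qed

lemma stdz_less:
  assumes "i < j" "c i = c j" "i \<in> {1..r}" "j \<in> {1..r}"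
  shows "stdz r bs c i < stdz r bs c j"
proof -
  have "card {i' \<in> {1..i}. c i' = c i} < card {i' \<in> {1..j}. c i' = c j}"
  proof (rule psubset_card_mono)
    have "j \<in> {i' \<in> {1..j}. c i' = c j}" "j \<notin> {i' \<in> {1..i}. c i' = c i}" using assms by auto
    moreover have "{i' \<in> {1..i}. c i' = c i} \<subseteq> {i' \<in> {1..j}. c i' = c j}" using assms by auto
    ultimately show "{i' \<in> {1..i}. c i' = c i} \<subset> {i' \<in> {1..j}. c i' = c j}" by blast
  qed simp
  then show ?thesis using assms by (simp add: stdz_def)
qed

lemma stdz_S_perm:
  assumes r: "r = sum_list ss" and c: "c \<in> cwords r {..<length ss} (\<lambda>t. rev ss ! t)"
  shows "stdz r (rev ss) c \<in> S_perm r ss"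
proof -
  let ?w = "stdz r (rev ss) c"
  have c': "c \<in> cwords r {..<length (rev ss)} (\<lambda>t. rev ss ! t)" using c by simp
  have rng: "?w i \<in> {1..r}" if i: "i \<in> {1..r}" for i
  proof -
    have "c i < length ss" using c i by (auto simp: cwords_def)
    then have "psum (rev ss) (Suc (c i)) \<le> psum (rev ss) (length ss)"
      by (intro psum_mono) simp
    also have "\<dots> = r" by (simp add: psum_def r)
    finally show ?thesis using stdz_props[OF c' i] by simp
  qed
  have inj: "inj_on ?w {1..r}"
  proof (rule inj_onI)
    fix i j assume ij: "i \<in> {1..r}" "j \<in> {1..r}" "?w i = ?w j"
    then have "c i = c j" using stdz_props(3)[OF c'] by metis
    then show "i = j" using stdz_less[of i j c r "rev ss"] stdz_less[of j i c r "rev ss"] ij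
      by (metis less_irrefl nat_neq_iff)
  qed
  have perm: "?w permutes {1..r}"
    by (rule inj_imp_permutes[OF inj]) (use rng in \<open>auto simp: stdz_def\<close>)
  have "Hilbert_Choice.inv ?w a < Hilbert_Choice.inv ?w b" if ab: "a < b" "same_block ss a b" for a b
  proof -
    have "a \<in> {1..r} \<and> b \<in> {1..r}"
    proof -
      obtain t where t: "t < length ss" "psum (rev ss) t < a" "b \<le> psum (rev ss) (Suc t)"
        using ab by (auto simp: same_block_def Let_def psum_def)
      have "psum (rev ss) (Suc t) \<le> psum (rev ss) (length ss)" using t by (intro psum_mono) simp
      also have "\<dots> = r" by (simp add: psum_def r)
      finally show ?thesis using t ab by simp
    qed
    then have ab': "a \<in> {1..r}" "b \<in> {1..r}" by auto
    obtain i j where ij: "i \<in> {1..r}" "j \<in> {1..r}" "a = ?w i" "b = ?w j"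
      using ab' permutes_image[OF perm] by (metis imageE)
    have "c i = c j" using ab(2) same_block_iff[of a ss b] ab' r ij stdz_props(3)[OF c'] by metis
    then have "i < j" using stdz_less[of j i c r "rev ss"] ij ab(1)
      by (metis less_asym less_irrefl nat_neq_iff)
    then show ?thesis using ij permutes_inverses(2)[OF perm] by simp
  qed
  then show ?thesis using perm by (simp add: S_perm_def)
qed

text \<open>The condition on the inverse permutation is applied to the two values in a common block,
  once in each order, which turns it into a statement about positions.\<close>

lemma S_perm_mono:
  assumes w: "w \<in> S_perm r ss" and r: "r = sum_list ss"
    and ij: "i \<in> {1..r}" "j \<in> {1..r}" "bk (rev ss) (w i) = bk (rev ss) (w j)"
  shows "w i < w j \<longleftrightarrow> i < j"
proof -
  have perm: "w permutes {1..r}" using w by (simp add: S_perm_def)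
  have in': "w l \<in> {1..r}" if "l \<in> {1..r}" for l using permutes_in_image[OF perm] that by blast
  have lt: "i < j" if "w i < w j" "i \<in> {1..r}" "j \<in> {1..r}" "bk (rev ss) (w i) = bk (rev ss) (w j)" for i j
  proof -
    have "same_block ss (w i) (w j)"
      using same_block_iff[of "w i" ss "w j"] in' that r by simp
    then have "Hilbert_Choice.inv w (w i) < Hilbert_Choice.inv w (w j)"
      using w that(1) by (simp add: S_perm_def)
    then show ?thesis by (simp add: permutes_inverses(2)[OF perm])
  qed
  have "w i = w j \<Longrightarrow> i = j" using permutes_inj[OF perm] by (simp add: inj_eq)
  then show ?thesis using lt[of i j] lt[of j i] ij by (metis less_asym less_irrefl nat_neq_iff)
qed

text \<open>Recording the block of each value turns \<open>w\<close> into a word, and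
  \<open>stdz\<close> is the inverse map. Values in one block are never inverted, so an inversion of
  \<open>w\<close> is a strict descent of the word; the reversing ranking
  \<open>length ss - t\<close> makes \<open>wstat\<close> count these.\<close>

lemma sum_S_perm:
  fixes q :: nat
  assumes r: "r = sum_list ss"
  shows "(\<Sum>w\<in>S_perm r ss. q ^ card {(j, i). 1 \<le> j \<and> j < i \<and> i \<le> r \<and> cls j = cls i \<and> w i < w j})
    = (\<Sum>c\<in>cwords r {..<length ss} (\<lambda>t. rev ss ! t). q ^ wstat r cls (\<lambda>t. length ss - t) c)"
proof (rule sum.reindex_bij_witness[where i = "stdz r (rev ss)" and j = "\<lambda>w. restrict (bk (rev ss) \<circ> w) {1..r}"])
  fix w assume w: "w \<in> S_perm r ss"
  have perm: "w permutes {1..r}" using w by (simp add: S_perm_def)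
  have in': "w l \<in> {1..r}" if "l \<in> {1..r}" for l using permutes_in_image[OF perm] that by blast
  let ?c = "restrict (bk (rev ss) \<circ> w) {1..r}"
  have rr: "sum_list (rev ss) = r" using r by simp
  have bp: "bk (rev ss) (w i) < length ss" "psum (rev ss) (bk (rev ss) (w i)) < w i"
     "w i \<le> psum (rev ss) (Suc (bk (rev ss) (w i)))" if "i \<in> {1..r}" for i
    using bk_props[of "w i" "rev ss"] in'[OF that] rr by auto
  show "stdz r (rev ss) ?c = w"
  proof
    fix i
    show "stdz r (rev ss) ?c i = w i"
    proof (cases "i \<in> {1..r}")
      case False
      then have "w i = i" using perm by (simp add: permutes_def)
      moreover have "stdz r (rev ss) ?c i = i" unfolding stdz_def by (rule if_not_P[OF False])
      ultimately show ?thesis by simp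
    next
      case i: True
      let ?t = "bk (rev ss) (w i)"
      let ?J = "{i' \<in> {1..i}. bk (rev ss) (w i') = ?t}"
      have Jeq: "{i' \<in> {1..i}. ?c i' = ?c i} = ?J" using i by auto
      \<comment> \<open>Since \<open>w\<close> is increasing on the positions that map into one
        block, those up to \<open>i\<close> hit exactly the entries of the block up to
        \<open>w i\<close>. The count in \<open>stdz\<close> therefore recovers
        \<open>w i\<close>.\<close>
      have "w ` ?J = {psum (rev ss) ?t <.. w i}"
      proof (intro equalityI subsetI)
        fix a assume "a \<in> w ` ?J"
        then obtain i' where i': "i' \<in> {1..i}" "bk (rev ss) (w i') = ?t" "a = w i'" by auto
        have i'r: "i' \<in> {1..r}" using i' i by auto
        have "\<not> w i < w i'" using S_perm_mono[OF w r i i'r] i' by auto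
        then show "a \<in> {psum (rev ss) ?t <.. w i}" using bp(2)[OF i'r] i' by simp
      next
        fix a assume a: "a \<in> {psum (rev ss) ?t <.. w i}"
        then have "a \<in> {1..r}" using in'[OF i] by auto
        then obtain i' where i': "i' \<in> {1..r}" "a = w i'" using permutes_image[OF perm] by (metis imageE)
        have bke: "bk (rev ss) (w i') = ?t" using a i' bp(3)[OF i] by (intro bk_unique) auto
        have "\<not> i < i'" using S_perm_mono[OF w r i i'(1)] bke a i' by auto
        then show "a \<in> w ` ?J" using i' bke by auto
      qed
      then have "card (w ` ?J) = w i - psum (rev ss) ?t" by simp
      moreover have "card (w ` ?J) = card ?J"
        by (rule card_image) (rule inj_on_subset[OF permutes_inj[OF perm]], simp)
      ultimately have "card {i' \<in> {1..i}. ?c i' = ?c i} = w i - psum (rev ss) ?t" unfolding Jeq by simp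
      then show ?thesis unfolding stdz_def using i bp(2)[OF i] by simp
    qed
  qed
  have "card {i \<in> {1..r}. ?c i = t} = rev ss ! t" if t: "t < length ss" for t
  proof -
    let ?I = "{i \<in> {1..r}. bk (rev ss) (w i) = t}"
    have "{i \<in> {1..r}. ?c i = t} = ?I" by auto
    moreover have "w ` ?I = {psum (rev ss) t <.. psum (rev ss) (Suc t)}"
    proof (intro equalityI subsetI)
      fix a assume "a \<in> w ` ?I"
      then show "a \<in> {psum (rev ss) t <.. psum (rev ss) (Suc t)}" using bp by auto
    next
      fix a assume a: "a \<in> {psum (rev ss) t <.. psum (rev ss) (Suc t)}"
      have "psum (rev ss) (Suc t) \<le> psum (rev ss) (length ss)" using t by (intro psum_mono) simp
      also have "\<dots> = r" by (simp add: psum_def r)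
      finally have "a \<in> {1..r}" using a by auto
      then obtain i' where i': "i' \<in> {1..r}" "a = w i'" using permutes_image[OF perm] by (metis imageE)
      have "bk (rev ss) a = t" using a by (intro bk_unique) auto
      then show "a \<in> w ` ?I" using i' by auto
    qed
    moreover have "card (w ` ?I) = card ?I"
      by (rule card_image) (rule inj_on_subset[OF permutes_inj[OF perm]], simp)
    ultimately show ?thesis using t by (simp add: psum_Suc)
  qed
  then show cw: "?c \<in> cwords r {..<length ss} (\<lambda>t. rev ss ! t)"
    using bp(1) by (auto simp: cwords_def)
  have "{(j, i). 1 \<le> j \<and> j < i \<and> i \<le> r \<and> cls j = cls i \<and> w i < w j} =
      {(j, i). 1 \<le> j \<and> j < i \<and> i \<le> r \<and> cls j = cls i \<and> length ss - ?c j < length ss - ?c i}"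
  proof -
    have "w i < w j \<longleftrightarrow> length ss - ?c j < length ss - ?c i" if "1 \<le> j" "j < i" "i \<le> r" for i j
    proof -
      have ij: "i \<in> {1..r}" "j \<in> {1..r}" using that by auto
      have m: "bk (rev ss) (w i) \<le> bk (rev ss) (w j)" if "w i < w j"
        using bk_mono[of "w i" "w j" "rev ss"] in'[OF ij(1)] in'[OF ij(2)] that rr by simp
      have n: "w i < w j" if "bk (rev ss) (w i) < bk (rev ss) (w j)"
        using bk_less[of "w i" "rev ss" "w j"] in'[OF ij(1)] in'[OF ij(2)] that rr by simp
      have e: "\<not> w i < w j" if "bk (rev ss) (w i) = bk (rev ss) (w j)"
        using S_perm_mono[OF w r ij] that \<open>j < i\<close> by simp
      have "?c i = bk (rev ss) (w i)" "?c j = bk (rev ss) (w j)" using ij by simp_all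
      moreover have "length ss - bk (rev ss) (w j) < length ss - bk (rev ss) (w i)
          \<longleftrightarrow> bk (rev ss) (w i) < bk (rev ss) (w j)"
        using bp(1)[OF ij(1)] bp(1)[OF ij(2)] by linarith
      ultimately show ?thesis using m n e by (metis le_neq_implies_less)
    qed
    then show ?thesis by auto
  qed
  then show "q ^ wstat r cls (\<lambda>t. length ss - t) ?c =
    q ^ card {(j, i). 1 \<le> j \<and> j < i \<and> i \<le> r \<and> cls j = cls i \<and> w i < w j}"
    by (simp add: wstat_def)
next
  fix c assume c: "c \<in> cwords r {..<length ss} (\<lambda>t. rev ss ! t)"
  show "stdz r (rev ss) c \<in> S_perm r ss" by (rule stdz_S_perm[OF r c])
  show "restrict (bk (rev ss) \<circ> stdz r (rev ss) c) {1..r} = c"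
  proof
    fix i
    show "restrict (bk (rev ss) \<circ> stdz r (rev ss) c) {1..r} i = c i"
      using stdz_props(3)[of c r "rev ss" i] c
      by (auto simp: restrict_def cwords_def PiE_def extensional_def)
  qed
qed

section \<open>Inversion over collections of vertex sets\<close>

text \<open>Inversion on the Boolean lattice \<open>Pow Q\<close> without a Moebius function: a sum
  over labels containing \<open>p\<close> is the sum over label \<open>p\<close> plus the sums over
  strictly larger labels, which agree by induction on the size of the complement.\<close>

lemma sum_superset_inversion:
  fixes f :: "'a \<Rightarrow> 'c::ab_group_add" and g :: "'b \<Rightarrow> 'c"
  assumes "finite Q" "finite A" "finite B" "a ` A \<subseteq> Pow Q" "b ` B \<subseteq> Pow Q"
    and eq: "\<And>p. p \<subseteq> Q \<Longrightarrow> (\<Sum>x | x \<in> A \<and> p \<subseteq> a x. f x) = (\<Sum>x | x \<in> B \<and> p \<subseteq> b x. g x)"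
    and "p \<subseteq> Q"
  shows "(\<Sum>x | x \<in> A \<and> a x = p. f x) = (\<Sum>x | x \<in> B \<and> b x = p. g x)"
  using \<open>p \<subseteq> Q\<close>
proof (induction "card (Q - p)" arbitrary: p rule: less_induct)
  case less
  define U where "U = {p'. p \<subset> p' \<and> p' \<subseteq> Q}"
  have finU: "finite U" by (rule finite_subset[of _ "Pow Q"]) (auto simp: U_def assms(1))
  have split: "(\<Sum>x | x \<in> C \<and> p \<subseteq> c x. h x) = (\<Sum>x | x \<in> C \<and> c x = p. h x) + (\<Sum>p'\<in>U. \<Sum>x | x \<in> C \<and> c x = p'. h x)"
    if C: "finite C" "c ` C \<subseteq> Pow Q" for C and c :: "'x \<Rightarrow> _" and h :: "'x \<Rightarrow> 'c"
  proof -
    have "{x. x \<in> C \<and> p \<subseteq> c x} = {x. x \<in> C \<and> c x = p} \<union> (\<Union>p'\<in>U. {x. x \<in> C \<and> c x = p'})"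
      using C by (auto simp: U_def)
    moreover have "(\<Sum>x\<in>{x. x \<in> C \<and> c x = p} \<union> (\<Union>p'\<in>U. {x. x \<in> C \<and> c x = p'}). h x)
      = (\<Sum>x | x \<in> C \<and> c x = p. h x) + (\<Sum>x\<in>(\<Union>p'\<in>U. {x. x \<in> C \<and> c x = p'}). h x)"
      by (rule sum.union_disjoint) (use C finU in \<open>auto simp: U_def\<close>)
    moreover have "(\<Sum>x\<in>(\<Union>p'\<in>U. {x. x \<in> C \<and> c x = p'}). h x) = (\<Sum>p'\<in>U. \<Sum>x | x \<in> C \<and> c x = p'. h x)"
      by (rule sum.UNION_disjoint) (use C finU in auto)
    ultimately show ?thesis by simp
  qed
  have "(\<Sum>x | x \<in> A \<and> a x = p'. f x) = (\<Sum>x | x \<in> B \<and> b x = p'. g x)" if "p' \<in> U" for p'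
  proof (rule less.hyps)
    show "p' \<subseteq> Q" using that by (simp add: U_def)
    show "card (Q - p') < card (Q - p)"
      by (rule psubset_card_mono) (use that assms(1) in \<open>auto simp: U_def\<close>)
  qed
  then have "(\<Sum>p'\<in>U. \<Sum>x | x \<in> A \<and> a x = p'. f x) = (\<Sum>p'\<in>U. \<Sum>x | x \<in> B \<and> b x = p'. g x)"
    by (intro sum.cong refl)
  then show ?case
    using eq[OF less.prems] split[OF assms(2,4), of f] split[OF assms(3,5), of g] by simp
qed

section \<open>Connectivity of graphs in terms of vertex sets that no edge leaves\<close>

definition uncut :: "nat \<Rightarrow> (nat \<times> nat \<times> nat) set \<Rightarrow> nat set set" where
  "uncut r K = {I. I \<subseteq> {1..r} \<and> (\<forall>(j, i, t)\<in>K. j \<in> I \<longleftrightarrow> i \<in> I)}"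

lemma finite_uncut: "finite (uncut r K)"
  by (rule finite_subset[of _ "Pow {1..r}"]) (auto simp: uncut_def)

text \<open>A nonempty uncut set is closed under reachability, and the set of vertices reachable
  from a given one is itself uncut.\<close>

lemma connected_spanning_iff_uncut:
  assumes K: "\<And>j i t. (j, i, t) \<in> K \<Longrightarrow> j \<in> {1..r} \<and> i \<in> {1..r}"
  shows "connected_spanning r K \<longleftrightarrow> uncut r K = {{}, {1..r}}"
proof
  assume con: "connected_spanning r K"
  have "I = {1..r}" if I: "I \<in> uncut r K" "I \<noteq> {}" for I
  proof -
    obtain a where a: "a \<in> I" using I by auto
    have "b \<in> I" if "(a, b) \<in> (edge_rel K)\<^sup>*" for b
      using that
    proof induction
      case (step y z)
      then show ?case using I(1) by (auto simp: edge_rel_def uncut_def)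
    qed (rule a)
    moreover have sub: "I \<subseteq> {1..r}" using I by (simp add: uncut_def)
    ultimately have "{1..r} \<subseteq> I" using con a unfolding connected_spanning_def by blast
    then show ?thesis using sub by blast
  qed
  moreover have "{} \<in> uncut r K" by (auto simp: uncut_def)
  moreover have "{1..r} \<in> uncut r K" using K by (auto simp: uncut_def)
  ultimately show "uncut r K = {{}, {1..r}}" by blast
next
  assume u: "uncut r K = {{}, {1..r}}"
  show "connected_spanning r K"
    unfolding connected_spanning_def
  proof (intro ballI)
    fix a b assume ab: "a \<in> {1..r}" "b \<in> {1..r}"
    define I where "I = {b \<in> {1..r}. (a, b) \<in> (edge_rel K)\<^sup>*}"
    have "j \<in> I \<longleftrightarrow> i \<in> I" if "(j, i, t) \<in> K" for j i t
    proof -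
      have "(j, i) \<in> edge_rel K" "(i, j) \<in> edge_rel K" using that by (auto simp: edge_rel_def)
      then show ?thesis using K[OF that] by (auto simp: I_def intro: rtrancl.rtrancl_into_rtrancl)
    qed
    then have "I \<in> uncut r K" by (auto simp: uncut_def I_def)
    moreover have "a \<in> I" using ab by (simp add: I_def)
    ultimately have "I = {1..r}" using u by auto
    then have "b \<in> I" using ab by blast
    then show "(a, b) \<in> (edge_rel K)\<^sup>*" unfolding I_def by blast
  qed
qed

text \<open>Under symmetric difference the uncut sets form a vector space over the field with two
  elements. A new edge imposes one linear equation and so at most halves their number: the sets that
  it cuts, if there are any, are carried injectively to uncut ones by symmetric difference with one
  of them.\<close>

lemma card_uncut:
  assumes "finite K"
  shows "2 ^ r \<le> card (uncut r K) * 2 ^ card K"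
  using assms
proof induction
  case empty
  have "uncut r {} = Pow {1..r}" by (auto simp: uncut_def)
  then show ?case by (simp add: card_Pow)
next
  case (insert e K)
  obtain j i t where e: "e = (j, i, t)" by (cases e)
  let ?G = "uncut r (insert e K)"
  define B where "B = {I \<in> uncut r K. (j \<in> I) \<noteq> (i \<in> I)}"
  have eq: "uncut r K = ?G \<union> B" by (auto simp: uncut_def B_def e)
  have "card B \<le> card ?G"
  proof (cases "B = {}")
    case False
    then obtain J where J: "J \<in> B" by auto
    have sub: "(\<lambda>I. (I - J) \<union> (J - I)) ` B \<subseteq> ?G"
    proof
      fix x assume "x \<in> (\<lambda>I. (I - J) \<union> (J - I)) ` B"
      then obtain I where I: "I \<in> B" "x = (I - J) \<union> (J - I)" by auto
      have "x \<subseteq> {1..r}" using I J by (auto simp: B_def uncut_def)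
      moreover have "a \<in> x \<longleftrightarrow> b \<in> x" if "(a, b, c) \<in> insert e K" for a b c
        using I J that by (auto simp: B_def uncut_def e)
      ultimately show "x \<in> ?G" by (auto simp: uncut_def)
    qed
    have "inj_on (\<lambda>I. (I - J) \<union> (J - I)) B" by (rule inj_onI) blast
    then show ?thesis by (rule card_inj_on_le[OF _ sub finite_uncut])
  qed simp
  moreover have "card (uncut r K) \<le> card ?G + card B" unfolding eq by (rule card_Un_le)
  ultimately have "card (uncut r K) \<le> 2 * card ?G" by simp
  then have "card (uncut r K) * 2 ^ card K \<le> 2 * card ?G * 2 ^ card K" by (rule mult_right_mono) simp
  with insert.IH have "2 ^ r \<le> 2 * card ?G * 2 ^ card K" by (rule order_trans)
  then show ?case using insert.hyps by (simp add: mult_ac)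
qed

text \<open>A connected graph has only two uncut sets, so \<open>card_uncut\<close> gives
  \<open>2 ^ r \<le> 2 * 2 ^ card K\<close>. This makes the natural-number subtraction in the
  exponent of \<open>R_poly\<close> a true one.\<close>

lemma connected_spanning_card:
  assumes "finite K" "\<And>j i t. (j, i, t) \<in> K \<Longrightarrow> j \<in> {1..r} \<and> i \<in> {1..r}" "connected_spanning r K"
  shows "r \<le> card K + 1"
proof -
  have "uncut r K = {{}, {1..r}}" using assms connected_spanning_iff_uncut by blast
  moreover have "card {{}, {1..r}} \<le> 2" by (simp add: card_insert_if)
  ultimately have "card (uncut r K) \<le> 2" by simp
  then have "card (uncut r K) * 2 ^ card K \<le> 2 * 2 ^ card K" by (rule mult_right_mono) simp
  then have "(2::nat) ^ r \<le> 2 ^ (card K + 1)" using order_trans[OF card_uncut[OF assms(1), of r]] by simp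
  then show ?thesis by (rule power_le_imp_le_exp[rotated]) simp
qed

text \<open>The binomial expansion of \<open>((x - 1) + 1) ^ card E\<close>, edge by edge. It turns
  a power of \<open>q\<close> with an inversion number as exponent into a sum over
  subgraphs.\<close>

lemma sum_Pow_power_card:
  fixes x :: "'a::comm_ring_1"
  assumes "finite E"
  shows "(\<Sum>K\<in>Pow E. (x - 1) ^ card K) = x ^ card E"
  using assms
proof induction
  case (insert e E)
  have "(\<Sum>K\<in>Pow (insert e E). (x - 1) ^ card K)
      = (\<Sum>K\<in>Pow E. (x - 1) ^ card K) + (\<Sum>K\<in>insert e ` Pow E. (x - 1) ^ card K)"
    unfolding Pow_insert by (rule sum.union_disjoint) (use insert in auto)
  also have "(\<Sum>K\<in>insert e ` Pow E. (x - 1) ^ card K) = (\<Sum>K\<in>Pow E. (x - 1) ^ card (insert e K))"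
    by (rule sum.reindex_cong[OF _ refl refl]) (use insert in \<open>auto simp: inj_on_def\<close>)
  also have "\<dots> = (\<Sum>K\<in>Pow E. (x - 1) * (x - 1) ^ card K)"
    by (rule sum.cong[OF refl]) (use insert in \<open>auto simp: card_insert_if finite_subset\<close>)
  also have "\<dots> = (x - 1) * x ^ card E" by (simp add: insert.IH flip: sum_distrib_left)
  finally show ?case using insert by (simp add: algebra_simps)
qed simp

lemma finite_inv_edges: "finite (inv_edges r k w)"
  by (rule finite_subset[of _ "{1..r} \<times> {1..r} \<times> {1..k}"]) (auto simp: inv_edges_def)

lemma finite_S_perm: "finite (S_perm r ss)"
  by (rule finite_subset[OF _ finite_permutations[of "{1..r}"]]) (auto simp: S_perm_def)

lemma card_fibre_inv_edges:
  "card {(j, i, t) \<in> inv_edges r k w. P j i}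
   = (\<Sum>t\<in>{1..k}. card {(j, i). 1 \<le> j \<and> j < i \<and> i \<le> r \<and> P j i \<and> w t i < w t j})"
proof -
  let ?S = "\<lambda>t. {(j, i). 1 \<le> j \<and> j < i \<and> i \<le> r \<and> P j i \<and> w t i < w t j}"
  have fin: "finite (?S t)" for t
    by (rule finite_subset[of _ "{1..r} \<times> {1..r}"]) auto
  have "card {(j, i, t) \<in> inv_edges r k w. P j i} = card (Sigma {1..k} ?S)"
    by (rule bij_betw_same_card[of "\<lambda>(j, i, t). (t, j, i)"], rule bij_betwI[where g = "\<lambda>(t, j, i). (j, i, t)"])
      (auto simp: inv_edges_def)
  also have "\<dots> = (\<Sum>t\<in>{1..k}. card (?S t))" by (rule card_SigmaI) (use fin in auto)
  finally show ?thesis .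
qed

text \<open>Elements of \<open>A\<close> carry the label \<open>a x\<close> and weight 1; pairs of a
  permutation tuple \<open>w\<close> and a subgraph \<open>K\<close> carry the label
  \<open>uncut r K\<close> and weight \<open>(q - 1) ^ card K\<close>. The hypothesis says that the
  weights with label above \<open>p\<close> have the same sum on both sides for every
  \<open>p\<close>, and the inversion is then read at the label \<open>{{}, {1..r}}\<close>.\<close>

lemma count_connected_eq_R_poly:
  fixes q :: nat
  assumes "r \<ge> 1" "finite A" "a ` A \<subseteq> Pow (Pow {1..r})"
    and cnt: "\<And>p. p \<subseteq> Pow {1..r} \<Longrightarrow> card {x \<in> A. p \<subseteq> a x} =
      (\<Prod>t\<in>{1..k}. \<Sum>w\<in>S_perm r (ss t). q ^ card {(j, i). 1 \<le> j \<and> j < i \<and> i \<le> r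
          \<and> {I \<in> p. j \<in> I} = {I \<in> p. i \<in> I} \<and> w i < w j})"
  shows "int (card {x \<in> A. a x = {{}, {1..r}}}) =
    (int q - 1) ^ (r - 1) * (\<Sum>w\<in>(\<Pi>\<^sub>E t\<in>{1..k}. S_perm r (ss t)). R_poly r k w (int q))"
proof -
  let ?W = "\<Pi>\<^sub>E t\<in>{1..k}. S_perm r (ss t)"
  let ?B = "Sigma ?W (\<lambda>w. Pow (inv_edges r k w))"
  let ?g = "\<lambda>(w, K). (int q - 1) ^ card K"
  have finW: "finite ?W" by (intro finite_PiE finite_S_perm) simp
  have finB: "finite ?B" using finW finite_inv_edges by auto
  have key: "(\<Sum>x | x \<in> A \<and> p \<subseteq> a x. 1) = (\<Sum>x | x \<in> ?B \<and> p \<subseteq> (uncut r \<circ> snd) x. ?g x)" if p: "p \<subseteq> Pow {1..r}" for p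
  proof -
    let ?P = "\<lambda>j i. {I \<in> p. j \<in> I} = {I \<in> p. i \<in> I}"
    let ?E = "\<lambda>w. {(j, i, t) \<in> inv_edges r k w. ?P j i}"
    \<comment> \<open>Membership of all of \<open>p\<close> becomes a condition on single edges, so
      the admissible subgraphs are all subsets of the edge set \<open>?E w\<close>.\<close>
    have unc: "p \<subseteq> uncut r K \<longleftrightarrow> (\<forall>(j, i, t)\<in>K. ?P j i)" for K
    proof
      assume "p \<subseteq> uncut r K"
      then show "\<forall>(j, i, t)\<in>K. ?P j i" by (fastforce simp: uncut_def)
    next
      assume a: "\<forall>(j, i, t)\<in>K. ?P j i"
      have "j \<in> I \<longleftrightarrow> i \<in> I" if "I \<in> p" "(j, i, t) \<in> K" for I j i t
      proof -
        have "?P j i" using a that by auto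
        then show ?thesis using that(1) by blast
      qed
      then show "p \<subseteq> uncut r K" using p by (auto simp: uncut_def)
    qed
    have gen: "{x. x \<in> Sigma W (\<lambda>w. Pow (E w)) \<and> snd x \<subseteq> S} = Sigma W (\<lambda>w. Pow (E w \<inter> S))"
      for W :: "'w set" and E :: "'w \<Rightarrow> 'e set" and S by auto
    have "?E w = inv_edges r k w \<inter> {e. case e of (j, i, t) \<Rightarrow> ?P j i}" for w by blast
    moreover have "(\<forall>(j, i, t)\<in>K. ?P j i) \<longleftrightarrow> K \<subseteq> {e. case e of (j, i, t) \<Rightarrow> ?P j i}" for K :: "(nat \<times> nat \<times> nat) set"
      by blast
    ultimately have "{x. x \<in> ?B \<and> p \<subseteq> (uncut r \<circ> snd) x} = Sigma ?W (\<lambda>w. Pow (?E w))"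
      unfolding comp_def unc by (simp only: gen)
    then have "(\<Sum>x | x \<in> ?B \<and> p \<subseteq> (uncut r \<circ> snd) x. ?g x) = (\<Sum>x\<in>Sigma ?W (\<lambda>w. Pow (?E w)). ?g x)"
      by (simp only:)
    also have "\<dots> = (\<Sum>w\<in>?W. \<Sum>K\<in>Pow (?E w). (int q - 1) ^ card K)"
      by (subst sum.Sigma) (use finW finite_inv_edges in \<open>auto intro: finite_subset\<close>)
    also have "\<dots> = (\<Sum>w\<in>?W. int q ^ card (?E w))"
      by (intro sum.cong refl sum_Pow_power_card finite_subset[OF _ finite_inv_edges]) auto
    also have "\<dots> = (\<Sum>w\<in>?W. \<Prod>t\<in>{1..k}. int q ^ card {(j, i). 1 \<le> j \<and> j < i \<and> i \<le> r \<and> ?P j i \<and> w t i < w t j})"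
      unfolding card_fibre_inv_edges by (simp add: power_sum)
    also have "\<dots> = (\<Prod>t\<in>{1..k}. \<Sum>v\<in>S_perm r (ss t). int q ^ card {(j, i). 1 \<le> j \<and> j < i \<and> i \<le> r \<and> ?P j i \<and> v i < v j})"
      by (subst prod_sum_PiE) (auto intro: finite_S_perm)
    also have "\<dots> = int (card {x \<in> A. p \<subseteq> a x})" unfolding cnt[OF p] by simp
    finally show ?thesis by simp
  qed
  have "int (card {x \<in> A. a x = {{}, {1..r}}}) = (\<Sum>x | x \<in> A \<and> a x = {{}, {1..r}}. 1)" by simp
  also have "\<dots> = (\<Sum>x | x \<in> ?B \<and> (uncut r \<circ> snd) x = {{}, {1..r}}. ?g x)"
  proof (rule sum_superset_inversion[where Q = "Pow {1..r}"])
    show "(uncut r \<circ> snd) ` ?B \<subseteq> Pow (Pow {1..r})" by (auto simp: uncut_def)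
    show "(\<Sum>x | x \<in> A \<and> p \<subseteq> a x. 1) = (\<Sum>x | x \<in> ?B \<and> p \<subseteq> (uncut r \<circ> snd) x. ?g x)"
      if "p \<subseteq> Pow {1..r}" for p by (rule key[OF that])
  qed (use assms(2,3) finB in auto)
  also have "{x. x \<in> ?B \<and> (uncut r \<circ> snd) x = {{}, {1..r}}}
      = Sigma ?W (\<lambda>w. {K. K \<subseteq> inv_edges r k w \<and> connected_spanning r K})"
  proof -
    have *: "connected_spanning r K \<longleftrightarrow> uncut r K = {{}, {1..r}}" if "K \<subseteq> inv_edges r k w" for K w
      by (rule connected_spanning_iff_uncut) (use that in \<open>auto simp: inv_edges_def\<close>)
    have gen: "{x. x \<in> Sigma W (\<lambda>w. Pow (E w)) \<and> (f \<circ> snd) x = T} = Sigma W (\<lambda>w. {K. K \<subseteq> E w \<and> C K})"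
      if "\<And>w K. K \<subseteq> E w \<Longrightarrow> C K \<longleftrightarrow> f K = T"
      for W :: "'w set" and E :: "'w \<Rightarrow> 'e set" and f :: "'e set \<Rightarrow> 'f" and C T
      using that by auto
    show ?thesis by (rule gen) (rule *)
  qed
  also have "(\<Sum>x\<in>\<dots>. ?g x) = (\<Sum>w\<in>?W. \<Sum>K\<in>{K. K \<subseteq> inv_edges r k w \<and> connected_spanning r K}. (int q - 1) ^ card K)"
    by (subst sum.Sigma) (use finW finite_inv_edges in auto)
  also have "\<dots> = (\<Sum>w\<in>?W. (int q - 1) ^ (r - 1) * R_poly r k w (int q))"
  proof (rule sum.cong[OF refl])
    fix w
    \<comment> \<open>The factor split off is the orbit size of the torus; the remaining exponent is
      nonnegative by the edge bound.\<close>
    have "(int q - 1) ^ card K = (int q - 1) ^ (r - 1) * (int q - 1) ^ (card K + 1 - r)"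
      if "K \<in> {K. K \<subseteq> inv_edges r k w \<and> connected_spanning r K}" for K
    proof -
      have "r \<le> card K + 1"
        by (rule connected_spanning_card) (use that finite_subset[OF _ finite_inv_edges] in \<open>auto simp: inv_edges_def\<close>)
      then have "card K = (r - 1) + (card K + 1 - r)" using assms(1) by simp
      then show ?thesis by (metis power_add)
    qed
    then show "(\<Sum>K\<in>{K. K \<subseteq> inv_edges r k w \<and> connected_spanning r K}. (int q - 1) ^ card K)
      = (int q - 1) ^ (r - 1) * R_poly r k w (int q)"
      by (simp add: R_poly_def sum_distrib_left)
  qed
  finally show ?thesis by (simp add: sum_distrib_left)
qed

section \<open>Pivots of subspaces\<close>

text \<open>Vectors are added, and multiplied by diagonal matrices, with the pointwise operations on
  functions; scalar multiplication gets a name so that the vector space locale can be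
  interpreted.\<close>

definition smul :: "'k::field \<Rightarrow> (nat \<Rightarrow> 'k) \<Rightarrow> (nat \<Rightarrow> 'k)" where
  "smul c x = (\<lambda>i. c * x i)"

lemma smul_apply [simp]: "smul c x i = c * x i"
  by (simp add: smul_def)

interpretation fs: vector_space "smul :: 'k::field \<Rightarrow> (nat \<Rightarrow> 'k) \<Rightarrow> (nat \<Rightarrow> 'k)"
  by unfold_locales (auto simp: fun_eq_iff algebra_simps)

interpretation fsp: vector_space_pair "smul :: 'k::field \<Rightarrow> (nat \<Rightarrow> 'k) \<Rightarrow> (nat \<Rightarrow> 'k)"
    "smul :: 'k::field \<Rightarrow> (nat \<Rightarrow> 'k) \<Rightarrow> (nat \<Rightarrow> 'k)"
  by unfold_locales

definition supp_on :: "nat set \<Rightarrow> (nat \<Rightarrow> 'k::zero) set" where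
  "supp_on S = {x. \<forall>i. i \<notin> S \<longrightarrow> x i = 0}"

definition proj :: "nat set \<Rightarrow> (nat \<Rightarrow> 'k::zero) \<Rightarrow> (nat \<Rightarrow> 'k)" where
  "proj I x = (\<lambda>i. if i \<in> I then x i else 0)"

text \<open>The pivot columns of a reduced echelon form read from the right: positions that occur as
  the last nonzero coordinate of a vector of \<open>U\<close>. For a subspace they determine its
  Schubert cell.\<close>

definition piv :: "(nat \<Rightarrow> 'k::field) set \<Rightarrow> nat set" where
  "piv U = {i. \<exists>x\<in>U. x i = 1 \<and> (\<forall>l>i. x l = 0)}"

lemma supp_onD: "x \<in> supp_on S \<Longrightarrow> i \<notin> S \<Longrightarrow> x i = 0"
  by (simp add: supp_on_def)

lemma subspace_supp_on: "fs.subspace (supp_on S)"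
  by (auto simp: fs.subspace_def supp_on_def)

lemma card_supp_on:
  assumes "finite S"
  shows "card (supp_on S :: (nat \<Rightarrow> 'k::{zero,finite}) set) = card (UNIV :: 'k set) ^ card S"
proof -
  have "bij_betw (\<lambda>x. restrict x S) (supp_on S :: (nat \<Rightarrow> 'k) set) (S \<rightarrow>\<^sub>E UNIV)"
    by (rule bij_betwI[where g = "\<lambda>x i. if i \<in> S then x i else 0"])
      (auto simp: supp_on_def fun_eq_iff restrict_def PiE_def extensional_def)
  then have "card (supp_on S :: (nat \<Rightarrow> 'k) set) = card (S \<rightarrow>\<^sub>E (UNIV :: 'k set))"
    by (rule bij_betw_same_card)
  then show ?thesis using assms by (simp add: card_PiE)
qed

lemma finite_supp_on:
  assumes "finite S"
  shows "finite (supp_on S :: (nat \<Rightarrow> 'k::{zero,finite}) set)"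
  by (rule card_ge_0_finite) (simp add: card_supp_on[OF assms] finite_UNIV_card_ge_0)

lemma piv_subset: "U \<subseteq> supp_on S \<Longrightarrow> piv U \<subseteq> S"
  by (force simp: piv_def supp_on_def)

lemma pivE:
  assumes "i \<in> piv U"
  obtains x where "x \<in> U" "x i = 1" "\<forall>l>i. x l = 0"
  using assms unfolding piv_def by blast

lemma pivI:
  assumes "fs.subspace U" "x \<in> U" "x i \<noteq> 0" "\<And>l. l > i \<Longrightarrow> x l = 0"
  shows "i \<in> piv U"
proof -
  have "smul (inverse (x i)) x \<in> U" using assms fs.subspace_scale by blast
  moreover have "smul (inverse (x i)) x i = 1" using assms by simp
  moreover have "\<forall>l>i. smul (inverse (x i)) x l = 0" using assms by simp
  ultimately show ?thesis unfolding piv_def by blast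
qed

text \<open>The pivots are treated from right to left. Adding a multiple of a pivot vector corrects
  the value at its pivot and changes only positions further left. With \<open>piv_unique\<close>
  this makes restriction to the pivots an isomorphism.\<close>

lemma piv_reduce:
  assumes U: "fs.subspace U" "U \<subseteq> supp_on {1..r}"
  shows "\<exists>u\<in>U. \<forall>i\<in>piv U. u i = v i"
proof -
  \<comment> \<open>The condition \<open>i + d > r\<close> selects the last \<open>d\<close>
    positions of \<open>{1..r}\<close>.\<close>
  have "\<exists>u\<in>U. \<forall>i\<in>piv U. i + d > r \<longrightarrow> u i = v i" for d
  proof (induction d)
    case 0
    have "0 \<in> U" using U fs.subspace_0 by blast
    then show ?case using piv_subset[OF U(2)] by (intro bexI[of _ 0]) auto
  next
    case (Suc d)
    then obtain u where u: "u \<in> U" "\<And>i. i \<in> piv U \<Longrightarrow> i + d > r \<Longrightarrow> u i = v i" by blast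
    show ?case
    proof (cases "d \<le> r \<and> r - d \<in> piv U")
      case False
      then have "u i = v i" if "i \<in> piv U" "i + Suc d > r" for i
        using u(2)[of i] that by (cases "i + d > r") (auto simp: le_Suc_eq not_less
            dest: le_antisym)
      then show ?thesis using u(1) by blast
    next
      case True
      then obtain x where x: "x \<in> U" "x (r - d) = 1" "\<And>l. l > r - d \<Longrightarrow> x l = 0"
        by (auto simp: piv_def)
      let ?u = "u + smul (v (r - d) - u (r - d)) x"
      have "?u \<in> U" using u x U by (intro fs.subspace_add fs.subspace_scale)
      moreover have "?u i = v i" if "i \<in> piv U" "i + Suc d > r" for i
      proof (cases "i = r - d")
        case True
        then show ?thesis by (simp add: x)
      next
        case False
        then have "i > r - d" "i + d > r" using that True by auto
        then show ?thesis using u(2)[OF that(1)] x(3) by simp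
      qed
      ultimately show ?thesis by blast
    qed
  qed
  from this[of "Suc r"] show ?thesis by auto
qed

text \<open>The last nonzero position of a nonzero vector of \<open>U\<close> is a pivot by
  definition, and there \<open>w\<close> vanishes.\<close>

lemma piv_unique:
  assumes U: "fs.subspace U" "U \<subseteq> supp_on {1..r}" and w: "w \<in> U" "\<And>i. i \<in> piv U \<Longrightarrow> w i = 0"
  shows "w = 0"
proof (rule ccontr)
  assume "w \<noteq> 0"
  then obtain i0 where i0: "w i0 \<noteq> 0" by (auto simp: fun_eq_iff)
  define S where "S = {i. w i \<noteq> 0}"
  have "S \<subseteq> {1..r}" using w(1) U(2) unfolding S_def supp_on_def by blast
  then have S: "finite S" "S \<noteq> {}" using i0 by (auto simp: S_def intro: finite_subset)
  have "w (Max S) \<noteq> 0" using Max_in[OF S] by (simp add: S_def)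
  moreover have "w l = 0" if "l > Max S" for l
    using Max_ge[OF S(1), of l] that by (auto simp: S_def)
  ultimately show False using pivI[OF U(1) w(1)] w(2) by blast
qed

lemma card_subspace_piv:
  fixes U :: "(nat \<Rightarrow> 'k::{field,finite}) set"
  assumes U: "fs.subspace U" "U \<subseteq> supp_on {1..r}"
  shows "card U = card (UNIV :: 'k set) ^ card (piv U)"
proof -
  have "bij_betw (\<lambda>u. restrict u (piv U)) U (piv U \<rightarrow>\<^sub>E UNIV)"
  proof (rule bij_betw_imageI)
    show "inj_on (\<lambda>u. restrict u (piv U)) U"
    proof (rule inj_onI)
      fix u u' assume u: "u \<in> U" "u' \<in> U" "restrict u (piv U) = restrict u' (piv U)"
      have "(u - u') i = 0" if "i \<in> piv U" for i
        using fun_cong[OF u(3), of i] that by simp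
      then have "u - u' = 0" using u U by (intro piv_unique[OF U]) (auto intro: fs.subspace_diff)
      then show "u = u'" by simp
    qed
    show "(\<lambda>u. restrict u (piv U)) ` U = piv U \<rightarrow>\<^sub>E UNIV"
    proof (intro equalityI subsetI)
      fix f :: "nat \<Rightarrow> 'k" assume f: "f \<in> piv U \<rightarrow>\<^sub>E UNIV"
      obtain u where u: "u \<in> U" "\<forall>i\<in>piv U. u i = f i" using piv_reduce[OF U] by blast
      have "restrict u (piv U) = f" using u f by (auto simp: fun_eq_iff restrict_def PiE_def extensional_def)
      then show "f \<in> (\<lambda>u. restrict u (piv U)) ` U" using u by blast
    qed auto
  qed
  then have "card U = card (piv U \<rightarrow>\<^sub>E (UNIV :: 'k set))" by (rule bij_betw_same_card)
  moreover have "finite (piv U)" using piv_subset[OF U(2)] finite_subset by blast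
  ultimately show ?thesis by (simp add: card_PiE)
qed

section \<open>Schubert cells of projection-stable flags, built one coordinate at a time\<close>

definition cstable :: "(nat \<Rightarrow> 'b) \<Rightarrow> (nat \<Rightarrow> 'k::field) set \<Rightarrow> bool" where
  "cstable cls U \<longleftrightarrow> (\<forall>b. \<forall>x\<in>U. proj {i. cls i = b} x \<in> U)"

text \<open>A Schubert cell of decreasing flags: the letter \<open>c i\<close> is the last step that
  still has the pivot \<open>i\<close>. Steps are indexed by all of \<open>nat\<close>, so that
  flags of different lengths have one type.\<close>

definition pflags :: "nat \<Rightarrow> (nat \<Rightarrow> 'b) \<Rightarrow> (nat \<Rightarrow> nat) \<Rightarrow> (nat \<Rightarrow> (nat \<Rightarrow> 'k::field) set) set" where
  "pflags r cls c = {G. antimono G \<and> (\<forall>j. fs.subspace (G j) \<and> G j \<subseteq> supp_on {1..r} \<and>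
     cstable cls (G j) \<and> piv (G j) = {i \<in> {1..r}. j \<le> c i})}"

definition unitv :: "nat \<Rightarrow> nat \<Rightarrow> 'k::field" where
  "unitv n = (\<lambda>i. if i = n then 1 else 0)"

text \<open>Adds the vector \<open>unitv n + v\<close> to all steps up to \<open>g\<close>. Vectors
  of the given steps vanish at \<open>n\<close>, so the coefficient of the new vector in
  \<open>x\<close> is the coordinate \<open>x n\<close>, which explains the set
  comprehension.\<close>

definition fext :: "nat \<Rightarrow> nat \<Rightarrow> (nat \<Rightarrow> (nat \<Rightarrow> 'k::field) set) \<Rightarrow> (nat \<Rightarrow> 'k) \<Rightarrow> nat \<Rightarrow> (nat \<Rightarrow> 'k) set" where
  "fext n g G v j = (if j \<le> g then {x. x - smul (x n) (unitv n + v) \<in> G j} else G j)"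

lemma fext_mem:
  fixes G :: "nat \<Rightarrow> (nat \<Rightarrow> 'k::field) set"
  assumes G: "G \<in> pflags r cls c"
    and v: "v \<in> supp_on {j \<in> {1..r}. cls j = cls (Suc r) \<and> c j < c (Suc r)}"
  shows "fext (Suc r) (c (Suc r)) G v \<in> pflags (Suc r) cls c"
proof -
  let ?n = "Suc r" and ?g = "c (Suc r)"
  define y :: "nat \<Rightarrow> 'k" where "y = unitv ?n + v"
  have yn: "y ?n = 1" using v by (auto simp: y_def unitv_def supp_on_def)
  have ysupp: "y \<in> supp_on {1..?n}" using v by (auto simp: y_def unitv_def supp_on_def)
  have ycls: "y i = 0" if "cls i \<noteq> cls ?n" for i
    using v that by (auto simp: y_def unitv_def supp_on_def)
  have sub: "fs.subspace (G j)" and sup: "G j \<subseteq> supp_on {1..r}" and st: "cstable cls (G j)"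
    and pv: "piv (G j) = {i \<in> {1..r}. j \<le> c i}" and anti: "antimono G" for j
    using G by (auto simp: pflags_def)
  have Gn: "x ?n = 0" if "x \<in> G j" for x j using sup[of j] that by (auto simp: supp_on_def)
  let ?F = "fext ?n ?g G v"
  have F: "?F j = (if j \<le> ?g then {x. x - smul (x ?n) y \<in> G j} else G j)" for j
    by (simp add: fext_def y_def)
  have GF: "G j \<subseteq> ?F j" for j
  proof
    fix x assume x: "x \<in> G j"
    then show "x \<in> ?F j" using Gn[OF x] by (simp add: F)
  qed
  have 1: "fs.subspace (?F j)" for j
  proof (cases "j \<le> ?g")
    case True
    have a: "x + x' - smul ((x + x') ?n) y = (x - smul (x ?n) y) + (x' - smul (x' ?n) y)" for x x' :: "nat \<Rightarrow> 'k"
      by (auto simp: fun_eq_iff algebra_simps)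
    have b: "smul a x - smul (smul a x ?n) y = smul a (x - smul (x ?n) y)" for a and x :: "nat \<Rightarrow> 'k"
      by (auto simp: fun_eq_iff algebra_simps)
    have "fs.subspace {x. x - smul (x ?n) y \<in> G j}"
    proof (rule fs.subspaceI; unfold mem_Collect_eq)
      show "0 - smul (0 ?n) y \<in> G j" using fs.subspace_0[OF sub] by simp
    qed (unfold a b, auto intro: fs.subspace_add fs.subspace_scale sub)
    then show ?thesis using True by (simp add: F)
  qed (simp add: F sub)
  have 2: "?F j \<subseteq> supp_on {1..?n}" for j
  proof
    fix x assume "x \<in> ?F j"
    then consider "x - smul (x ?n) y \<in> G j" | "x \<in> G j" by (auto simp: F split: if_splits)
    then show "x \<in> supp_on {1..?n}"
    proof cases
      case 1
      then have a: "x - smul (x ?n) y \<in> supp_on {1..r}" using sup by blast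
      have "x i = 0" if "i \<notin> {1..?n}" for i
      proof -
        have "(x - smul (x ?n) y) i = 0" by (rule supp_onD[OF a]) (use that in auto)
        moreover have "y i = 0" by (rule supp_onD[OF ysupp that])
        ultimately show ?thesis by simp
      qed
      then show ?thesis by (simp add: supp_on_def)
    next
      case 2
      then show ?thesis using sup by (fastforce simp: supp_on_def)
    qed
  qed
  have 3: "cstable cls (?F j)" for j
  proof (cases "j \<le> ?g")
    case True
    show ?thesis unfolding cstable_def
    proof (intro allI ballI)
      fix b x assume "x \<in> ?F j"
      then have x: "x - smul (x ?n) y \<in> G j" using True by (simp add: F)
      let ?I = "{i. cls i = b}"
      have "proj ?I x - smul (proj ?I x ?n) y = proj ?I (x - smul (x ?n) y)"
        using ycls by (auto simp: fun_eq_iff proj_def)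
      moreover have "proj ?I (x - smul (x ?n) y) \<in> G j" using x st[of j] by (auto simp: cstable_def)
      ultimately show "proj ?I x \<in> ?F j" using True by (simp add: F)
    qed
  qed (simp add: F st)
  have 4: "piv (?F j) = {i \<in> {1..?n}. j \<le> c i}" for j
  proof (cases "j \<le> ?g")
    case True
    have "y \<in> ?F j" using True yn fs.subspace_0[OF sub[of j]] by (simp add: F)
    moreover have "\<forall>l>?n. y l = 0" using ysupp by (auto simp: supp_on_def)
    ultimately have n: "?n \<in> piv (?F j)" using yn by (auto simp: piv_def)
    have "i \<in> piv (G j)" if i: "i \<in> piv (?F j)" "i \<noteq> ?n" for i
    proof -
      obtain x where x: "x \<in> ?F j" "x i = 1" "\<forall>l>i. x l = 0" using i(1) by (rule pivE)
      have "i \<in> {1..?n}" using supp_onD[OF subsetD[OF 2 x(1)], of i] x(2) by force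
      then have "i \<le> ?n" by simp
      then have "x ?n = 0" using x(3) i(2) by auto
      then have "x \<in> G j" using x(1) True by (simp add: F)
      then show ?thesis using x by (auto simp: piv_def)
    qed
    moreover have "piv (G j) \<subseteq> piv (?F j)" using GF[of j] by (auto simp: piv_def)
    ultimately have "piv (?F j) = insert ?n (piv (G j))" using n by blast
    then show ?thesis unfolding pv using True by (auto simp: le_Suc_eq)
  next
    case False
    then show ?thesis by (auto simp: F pv le_Suc_eq)
  qed
  have 5: "antimono ?F"
  proof (rule antimonoI)
    fix j j' :: nat assume jj: "j \<le> j'"
    then have GG: "G j' \<subseteq> G j" using anti by (auto dest: antimonoD)
    show "?F j' \<subseteq> ?F j"
    proof (cases "j' \<le> ?g")
      case True
      then show ?thesis using jj GG by (auto simp: F)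
    next
      case False
      then have "?F j' = G j'" by (simp add: F)
      then show ?thesis using GG GF[of j] by blast
    qed
  qed
  show ?thesis using 1 2 3 4 5 by (simp add: pflags_def)
qed

lemma fext_Int:
  assumes G: "G \<in> pflags r cls c"
  shows "fext (Suc r) g G v j \<inter> supp_on {1..r} = G j"
proof -
  have sup: "G j \<subseteq> supp_on {1..r}" using G by (auto simp: pflags_def)
  have eq: "x - smul (x (Suc r)) y = x" if "x \<in> supp_on {1..r}" for x y :: "nat \<Rightarrow> 'a"
  proof -
    have "x (Suc r) = 0" using that by (auto simp: supp_on_def)
    then show ?thesis by simp
  qed
  show ?thesis
  proof (cases "j \<le> g")
    case True
    have "x \<in> fext (Suc r) g G v j \<longleftrightarrow> x \<in> G j" if "x \<in> supp_on {1..r}" for x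
      using True by (simp add: fext_def eq[OF that])
    then show ?thesis using sup by blast
  next
    case False
    then show ?thesis using sup by (auto simp: fext_def)
  qed
qed

text \<open>The old flag is recovered by intersecting with the first \<open>r\<close> coordinates.
  The difference of two choices of \<open>v\<close> lies in step \<open>c (Suc r)\<close> of this
  flag and is zero at its pivots, hence zero.\<close>

lemma fext_inj:
  assumes G: "G \<in> pflags r cls c" "G' \<in> pflags r cls c"
    and v: "v \<in> supp_on {j \<in> {1..r}. cls j = cls (Suc r) \<and> c j < c (Suc r)}"
      "v' \<in> supp_on {j \<in> {1..r}. cls j = cls (Suc r) \<and> c j < c (Suc r)}"
    and eq: "fext (Suc r) (c (Suc r)) G v = fext (Suc r) (c (Suc r)) G' v'"
  shows "G = G' \<and> v = v'"
proof
  show GG: "G = G'" using fext_Int[OF G(1)] fext_Int[OF G(2)] eq by (metis ext)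
  let ?n = "Suc r" and ?g = "c (Suc r)"
  have sub: "fs.subspace (G ?g)" and sup: "G ?g \<subseteq> supp_on {1..r}"
    and pv: "piv (G ?g) = {i \<in> {1..r}. ?g \<le> c i}"
    using G by (auto simp: pflags_def)
  have vn: "v ?n = 0" "v' ?n = 0" using v by (auto simp: supp_on_def)
  have "unitv ?n + v \<in> fext ?n ?g G v ?g" using vn fs.subspace_0[OF sub] by (simp add: fext_def unitv_def)
  then have "unitv ?n + v \<in> fext ?n ?g G v' ?g" using eq GG by simp
  then have "(unitv ?n + v) - smul ((unitv ?n + v) ?n) (unitv ?n + v') \<in> G ?g"
    by (simp only: fext_def order_refl if_True mem_Collect_eq)
  moreover have "(unitv ?n + v) - smul ((unitv ?n + v) ?n) (unitv ?n + v') = v - v'"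
    using vn by (auto simp: fun_eq_iff unitv_def)
  ultimately have "v - v' \<in> G ?g" by (simp only:)
  moreover have "(v - v') i = 0" if "i \<in> piv (G ?g)" for i
    using that v unfolding pv by (auto simp: supp_on_def)
  ultimately have "v - v' = 0" by (rule piv_unique[OF sub sup])
  then show "v = v'" by simp
qed

text \<open>The step \<open>c (Suc r)\<close> contains a vector with pivot \<open>r + 1\<close>. It
  can be normalised to be supported in the class of \<open>r + 1\<close> and to vanish at all other
  pivots of that step, which leaves free exactly the earlier coordinates of the class with a smaller
  letter.\<close>

lemma fext_surj:
  fixes F :: "nat \<Rightarrow> (nat \<Rightarrow> 'k::field) set"
  assumes F: "F \<in> pflags (Suc r) cls c"
  shows "\<exists>G\<in>pflags r cls c. \<exists>v\<in>supp_on {j \<in> {1..r}. cls j = cls (Suc r) \<and> c j < c (Suc r)}.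
     F = fext (Suc r) (c (Suc r)) G v"
proof -
  let ?n = "Suc r" and ?g = "c (Suc r)"
  let ?I = "{i. cls i = cls ?n}"
  have sub: "fs.subspace (F j)" and sup: "F j \<subseteq> supp_on {1..?n}" and st: "cstable cls (F j)"
    and pv: "piv (F j) = {i \<in> {1..?n}. j \<le> c i}" and anti: "antimono F" for j
    using F by (auto simp: pflags_def)
  define G where "G j = F j \<inter> supp_on {1..r}" for j
  have Gsub: "fs.subspace (G j)" for j unfolding G_def by (intro fs.subspace_inter sub subspace_supp_on)
  have inX: "x \<in> supp_on {1..r}" if "x \<in> supp_on {1..?n}" "x ?n = 0" for x :: "nat \<Rightarrow> 'k"
    using that unfolding supp_on_def by (auto simp: le_Suc_eq)
  have Gpv: "piv (G j) = {i \<in> {1..r}. j \<le> c i}" for j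
  proof (intro equalityI subsetI)
    fix i assume i: "i \<in> piv (G j)"
    then have "i \<in> piv (F j)" by (auto simp: piv_def G_def)
    moreover have "i \<in> {1..r}" using piv_subset[of "G j" "{1..r}"] i by (auto simp: G_def)
    ultimately show "i \<in> {i \<in> {1..r}. j \<le> c i}" by (simp add: pv)
  next
    fix i assume i: "i \<in> {i \<in> {1..r}. j \<le> c i}"
    then have "i \<in> piv (F j)" by (simp add: pv)
    then obtain x where x: "x \<in> F j" "x i = 1" "\<forall>l>i. x l = 0" by (rule pivE)
    then have "x \<in> G j" using i sup[of j] inX[of x] by (auto simp: G_def)
    then show "i \<in> piv (G j)" using x by (auto simp: piv_def)
  qed
  have Gst: "cstable cls (G j)" for j
    using st[of j] by (auto simp: cstable_def G_def supp_on_def proj_def)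
  have Gsup: "G j \<subseteq> supp_on {1..r}" for j by (simp add: G_def)
  have "antimono G" using anti unfolding G_def antimono_def by blast
  then have Gp: "G \<in> pflags r cls c"
    using Gsub Gpv Gst Gsup by (simp add: pflags_def)
  have "?n \<in> piv (F ?g)" by (simp add: pv)
  then obtain x where x: "x \<in> F ?g" "x ?n = 1" by (rule pivE)
  \<comment> \<open>Stability under the class projections allows cutting the vector down to the
    class of \<open>r + 1\<close> without losing its entry 1 there.\<close>
  define z where "z = proj ?I x"
  have z: "z \<in> F ?g" "z ?n = 1" using x st[of ?g] by (auto simp: cstable_def z_def proj_def)
  have zc: "z i = 0" if "cls i \<noteq> cls ?n" for i using that by (simp add: z_def proj_def)
  \<comment> \<open>Reduction is done inside the class, so that the correction \<open>u\<close> does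
    not spoil the support of \<open>z\<close>. By stability this smaller space still has every pivot
    of the step that lies in the class.\<close>
  define U where "U = G ?g \<inter> supp_on ?I"
  have U: "fs.subspace U" "U \<subseteq> supp_on {1..r}"
    unfolding U_def by (intro fs.subspace_inter Gsub subspace_supp_on) (auto simp: G_def)
  obtain u where u: "u \<in> U" "\<forall>i\<in>piv U. u i = z i" using piv_reduce[OF U] by blast
  define v where "v = z - u - unitv ?n"
  have pU: "i \<in> piv U" if "i \<in> {1..r}" "cls i = cls ?n" "?g \<le> c i" for i
  proof -
    have "i \<in> piv (G ?g)" using that by (simp add: Gpv)
    then obtain x where x: "x \<in> G ?g" "x i = 1" "\<forall>l>i. x l = 0" by (rule pivE)
    have "proj ?I x \<in> U" using x Gst[of ?g] by (auto simp: U_def cstable_def supp_on_def proj_def)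
    moreover have "proj ?I x i = 1" "\<forall>l>i. proj ?I x l = 0" using x that by (auto simp: proj_def)
    ultimately show ?thesis unfolding piv_def by blast
  qed
  have un: "u ?n = 0" using u(1) U(2) by (auto simp: supp_on_def)
  have vS: "v \<in> supp_on {j \<in> {1..r}. cls j = cls ?n \<and> c j < ?g}"
  proof -
    have "v i = 0" if i: "i \<notin> {j \<in> {1..r}. cls j = cls ?n \<and> c j < ?g}" for i
    proof (cases "i = ?n")
      case True
      then show ?thesis using z un by (simp add: v_def unitv_def)
    next
      case ne: False
      consider "cls i \<noteq> cls ?n" | "i \<notin> {1..?n}" | "i \<in> {1..r}" "cls i = cls ?n" "?g \<le> c i"
        using i ne by (force simp: le_Suc_eq)
      then show ?thesis
      proof cases
        case 1
        then show ?thesis using ne zc u(1) by (auto simp: v_def unitv_def U_def supp_on_def)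
      next
        case 2
        then have "z i = 0" "u i = 0" using z(1) sup[of ?g] u(1) U(2) by (auto simp: supp_on_def subset_iff)
        then show ?thesis using ne by (simp add: v_def unitv_def)
      next
        case 3
        then show ?thesis using u(2) pU[OF 3] ne by (simp add: v_def unitv_def)
      qed
    qed
    then show ?thesis by (simp add: supp_on_def)
  qed
  have yv: "unitv ?n + v = z - u" by (simp add: v_def)
  have zu: "z - u \<in> F ?g" using z u sub by (intro fs.subspace_diff) (auto simp: U_def G_def)
  have "F j = fext ?n ?g G v j" for j
  proof (cases "j \<le> ?g")
    case True
    then have zuj: "z - u \<in> F j" using zu anti by (auto dest: antimonoD)
    have "x \<in> F j \<longleftrightarrow> x - smul (x ?n) (z - u) \<in> G j" for x
    proof
      assume x: "x \<in> F j"
      have a: "x - smul (x ?n) (z - u) \<in> F j"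
        by (rule fs.subspace_diff[OF sub x fs.subspace_scale[OF sub zuj]])
      have "(x - smul (x ?n) (z - u)) ?n = 0" using z un by simp
      then have "x - smul (x ?n) (z - u) \<in> supp_on {1..r}" using a sup by (intro inX) auto
      with a show "x - smul (x ?n) (z - u) \<in> G j" by (simp add: G_def)
    next
      assume "x - smul (x ?n) (z - u) \<in> G j"
      then have "x - smul (x ?n) (z - u) + smul (x ?n) (z - u) \<in> F j"
        by (intro fs.subspace_add[OF sub _ fs.subspace_scale[OF sub zuj]]) (simp add: G_def)
      then show "x \<in> F j" by simp
    qed
    then have "F j = {x. x - smul (x ?n) (z - u) \<in> G j}" by blast
    then show ?thesis using True by (simp add: fext_def yv)
  next
    case False
    \<comment> \<open>Above step \<open>c (Suc r)\<close> the position \<open>r + 1\<close> is not a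
      pivot. It is the last coordinate, so every vector of such a step vanishes there.\<close>
    have "x \<in> supp_on {1..r}" if x: "x \<in> F j" for x
    proof (rule inX)
      show xs: "x \<in> supp_on {1..?n}" using x sup by blast
      have "?n \<notin> piv (F j)" using False by (simp add: pv)
      then show "x ?n = 0" using pivI[OF sub x, of ?n] xs by (auto simp: supp_on_def)
    qed
    then show ?thesis using False by (auto simp: fext_def G_def)
  qed
  then show ?thesis using Gp vS by blast
qed

text \<open>A flag on \<open>r + 1\<close> coordinates is a flag on \<open>r\<close> coordinates
  together with a vector supported on the set counted in \<open>wstat_Suc\<close>.\<close>

lemma card_pflags:
  "finite (pflags r cls c :: (nat \<Rightarrow> (nat \<Rightarrow> 'k::{field,finite}) set) set) \<and>
   card (pflags r cls c :: (nat \<Rightarrow> (nat \<Rightarrow> 'k) set) set) = card (UNIV :: 'k set) ^ wstat r cls (\<lambda>x. x) c"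
proof (induction r)
  case 0
  have X: "supp_on {1..0::nat} = {0 :: nat \<Rightarrow> 'k}" by (auto simp: supp_on_def fun_eq_iff)
  have "(pflags 0 cls c :: (nat \<Rightarrow> (nat \<Rightarrow> 'k) set) set) = {\<lambda>_. {0}}"
  proof (intro equalityI subsetI)
    fix G :: "nat \<Rightarrow> (nat \<Rightarrow> 'k) set" assume G: "G \<in> pflags 0 cls c"
    have "G j = {0}" for j
      using G fs.subspace_0[of "G j"] unfolding pflags_def X by blast
    then show "G \<in> {\<lambda>_. {0}}" by auto
  next
    fix G :: "nat \<Rightarrow> (nat \<Rightarrow> 'k) set" assume "G \<in> {\<lambda>_. {0}}"
    then show "G \<in> pflags 0 cls c"
      by (auto simp: pflags_def antimono_def fs.subspace_def supp_on_def cstable_def proj_def piv_def fun_eq_iff)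
  qed
  moreover have "wstat 0 cls (\<lambda>x. x) c = 0" unfolding wstat_def card_eq_0_iff by auto
  ultimately show ?case by simp
next
  case (Suc r)
  let ?S = "{j \<in> {1..r}. cls j = cls (Suc r) \<and> c j < c (Suc r)}"
  let ?A = "pflags r cls c \<times> supp_on ?S :: ((nat \<Rightarrow> (nat \<Rightarrow> 'k) set) \<times> (nat \<Rightarrow> 'k)) set"
  have bij: "bij_betw (\<lambda>(G, v). fext (Suc r) (c (Suc r)) G v) ?A (pflags (Suc r) cls c)"
  proof (rule bij_betw_imageI)
    show "inj_on (\<lambda>(G, v). fext (Suc r) (c (Suc r)) G v) ?A"
    proof (rule inj_onI)
      fix a b assume ab: "a \<in> ?A" "b \<in> ?A"
        "(\<lambda>(G, v). fext (Suc r) (c (Suc r)) G v) a = (\<lambda>(G, v). fext (Suc r) (c (Suc r)) G v) b"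
      obtain G v G' v' where e: "a = (G, v)" "b = (G', v')" by (cases a, cases b)
      have "G = G' \<and> v = v'" by (rule fext_inj[where cls = cls and c = c and r = r]) (use ab in \<open>simp_all add: e\<close>)
      then show "a = b" by (simp add: e)
    qed
    show "(\<lambda>(G, v). fext (Suc r) (c (Suc r)) G v) ` ?A = pflags (Suc r) cls c"
    proof (intro equalityI subsetI)
      fix F assume "F \<in> (\<lambda>(G, v). fext (Suc r) (c (Suc r)) G v) ` ?A"
      then obtain G v where "G \<in> pflags r cls c" "v \<in> supp_on ?S" "F = fext (Suc r) (c (Suc r)) G v" by auto
      then show "F \<in> pflags (Suc r) cls c" using fext_mem by simp
    next
      fix F :: "nat \<Rightarrow> (nat \<Rightarrow> 'k) set" assume "F \<in> pflags (Suc r) cls c"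
      from fext_surj[OF this] obtain G v where G: "G \<in> pflags r cls c" "v \<in> supp_on ?S"
        "F = fext (Suc r) (c (Suc r)) G v" by blast
      show "F \<in> (\<lambda>(G, v). fext (Suc r) (c (Suc r)) G v) ` ?A"
        by (rule image_eqI[of _ _ "(G, v)"]) (use G in simp_all)
    qed
  qed
  have fS: "finite ?S" by simp
  have "finite ?A" by (intro finite_cartesian_product finite_supp_on[OF fS]) (simp add: Suc)
  then have "finite (pflags (Suc r) cls c :: (nat \<Rightarrow> (nat \<Rightarrow> 'k) set) set)"
    using bij_betw_finite[OF bij] by simp
  moreover have "card (pflags (Suc r) cls c :: (nat \<Rightarrow> (nat \<Rightarrow> 'k) set) set) = card ?A"
    using bij_betw_same_card[OF bij] by simp
  moreover have "card ?A = card (UNIV :: 'k set) ^ wstat r cls (\<lambda>x. x) c * card (UNIV :: 'k set) ^ card ?S"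
    unfolding card_cartesian_product card_supp_on[OF fS] by (simp add: Suc)
  ultimately show ?case unfolding wstat_Suc power_add by (simp only: simp_thms)
qed

section \<open>Counting flags compatible with coordinate projections\<close>

definition stab :: "nat \<Rightarrow> (nat \<Rightarrow> (nat \<Rightarrow> 'k::field) set) \<Rightarrow> nat set set" where
  "stab r G = {I. I \<subseteq> {1..r} \<and> (\<forall>j. \<forall>x\<in>G j. proj I x \<in> G j)}"

lemma sum_apply: "(\<Sum>b\<in>B. f b) i = (\<Sum>b\<in>B. f b i)"
  by (induction B rule: infinite_finite_induct) auto

lemma proj_Compl: "proj (- I) x = x - proj I (x :: nat \<Rightarrow> 'k::field)"
  by (auto simp: proj_def fun_eq_iff)

lemma proj_proj: "proj I (proj J x) = proj (I \<inter> J) x"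
  by (auto simp: proj_def fun_eq_iff)

text \<open>The classes are the atoms of the Boolean algebra generated by \<open>p\<close>: each is
  an intersection of members of \<open>p\<close> and of their complements, and each member of
  \<open>p\<close> is a union of atoms. Projections compose along intersections and add up over
  disjoint unions.\<close>

lemma subset_stab_iff:
  assumes p: "p \<subseteq> Pow {1..r}"
    and G: "\<And>j. fs.subspace (G j)" "\<And>j. G j \<subseteq> supp_on {1..r}"
  shows "p \<subseteq> stab r G \<longleftrightarrow> (\<forall>j. cstable (\<lambda>i. {I \<in> p. i \<in> I}) (G j))"
proof
  assume ps: "p \<subseteq> stab r G"
  have finp: "finite p" using p finite_subset by blast
  \<comment> \<open>The atom with membership pattern \<open>b\<close> is reached by imposing the
    members of \<open>p\<close> one at a time; a complement is handled by subtracting the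
    projection.\<close>
  have *: "proj {i. \<forall>I\<in>p'. i \<in> I \<longleftrightarrow> I \<in> b} x \<in> G j" if "finite p'" "p' \<subseteq> p" "x \<in> G j" for p' b x j
    using that
  proof (induction p')
    case empty
    then show ?case by (simp add: proj_def)
  next
    case (insert I p')
    let ?y = "proj {i. \<forall>I\<in>p'. i \<in> I \<longleftrightarrow> I \<in> b} x"
    have y: "?y \<in> G j" using insert by auto
    then have "proj I ?y \<in> G j" using insert.prems ps by (auto simp: stab_def)
    moreover have "proj (- I) ?y \<in> G j" unfolding proj_Compl
      by (rule fs.subspace_diff[OF G(1) y]) fact
    moreover have "{i. \<forall>J\<in>insert I p'. i \<in> J \<longleftrightarrow> J \<in> b} =
        (if I \<in> b then I else - I) \<inter> {i. \<forall>I\<in>p'. i \<in> I \<longleftrightarrow> I \<in> b}" by auto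
    ultimately show ?case by (simp only: proj_proj split: if_split) simp
  qed
  show "\<forall>j. cstable (\<lambda>i. {I \<in> p. i \<in> I}) (G j)"
    unfolding cstable_def
  proof (intro allI ballI)
    fix j b x assume x: "x \<in> G j"
    show "proj {i. {I \<in> p. i \<in> I} = b} x \<in> G j"
    proof (cases "b \<subseteq> p")
      case True
      then have "{i. {I \<in> p. i \<in> I} = b} = {i. \<forall>I\<in>p. i \<in> I \<longleftrightarrow> I \<in> b}" by blast
      then show ?thesis using *[OF finp order_refl x, of b] by simp
    next
      case False
      then have "{i. {I \<in> p. i \<in> I} = b} = {}" by blast
      then have "proj {i. {I \<in> p. i \<in> I} = b} x = 0" by (auto simp: proj_def fun_eq_iff)
      then show ?thesis using fs.subspace_0[OF G(1)] by simp
    qed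
  qed
next
  let ?c = "\<lambda>i. {I \<in> p. i \<in> I}"
  assume st: "\<forall>j. cstable ?c (G j)"
  show "p \<subseteq> stab r G"
  proof
    fix I assume I: "I \<in> p"
    have "proj I x \<in> G j" if x: "x \<in> G j" for x j
    proof -
      \<comment> \<open>Atoms contained in \<open>I\<close>. Those met by \<open>{1..r}\<close>
        suffice, since \<open>x\<close> vanishes elsewhere.\<close>
      let ?B = "{b \<in> ?c ` {1..r}. I \<in> b}"
      have "proj I x = (\<Sum>b\<in>?B. proj {i. ?c i = b} x)"
      proof
        fix i
        have "(\<Sum>b\<in>?B. proj {i. ?c i = b} x) i = (\<Sum>b\<in>?B. if ?c i = b then x i else 0)"
          by (simp add: proj_def sum_apply)
        also have "\<dots> = (if ?c i \<in> ?B then x i else 0)"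
          by (rule sum.delta') simp
        also have "\<dots> = proj I x i"
        proof (cases "i \<in> {1..r}")
          case True
          then show ?thesis using I by (simp add: proj_def)
        next
          case False
          then have "x i = 0" using supp_onD[OF subsetD[OF G(2) x]] by blast
          then show ?thesis by (simp add: proj_def)
        qed
        finally show "proj I x i = (\<Sum>b\<in>?B. proj {i. ?c i = b} x) i" by simp
      qed
      moreover have "(\<Sum>b\<in>?B. proj {i. ?c i = b} x) \<in> G j"
        by (rule fs.subspace_sum[OF G(1)]) (use st x in \<open>auto simp: cstable_def\<close>)
      ultimately show ?thesis by simp
    qed
    then show "I \<in> stab r G" using p I by (auto simp: stab_def)
  qed
qed

text \<open>Over a finite field the dimension is read off the cardinality, which is also the form in
  which kernels and images are compared later.\<close>

definition flags :: "nat \<Rightarrow> (nat \<Rightarrow> nat) \<Rightarrow> (nat \<Rightarrow> (nat \<Rightarrow> 'k::field) set) set" where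
  "flags r D = {G. antimono G \<and> (\<forall>j. fs.subspace (G j) \<and> G j \<subseteq> supp_on {1..r} \<and>
     card (G j) = card (UNIV :: 'k set) ^ D j)}"

definition dwords :: "nat \<Rightarrow> nat \<Rightarrow> (nat \<Rightarrow> nat) \<Rightarrow> (nat \<Rightarrow> nat) set" where
  "dwords r m D = {c \<in> {1..r} \<rightarrow>\<^sub>E {..m}. \<forall>j. card {i \<in> {1..r}. j \<le> c i} = D j}"

lemma card_UNIV_field_gt1: "card (UNIV :: 'k::{field,finite} set) > 1"
proof -
  have "card {0, 1 :: 'k} \<le> card (UNIV :: 'k set)" by (rule card_mono) auto
  then show ?thesis by simp
qed

text \<open>The pivot sets decrease along the flag, so they are determined by the last step at which
  each pivot survives. This maximum exists because every position is a pivot of step 0 and there are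
  no pivots beyond step \<open>m\<close>.\<close>

lemma flags_cstable_eq:
  fixes cls :: "nat \<Rightarrow> 'b"
  assumes D: "D 0 = r" "\<And>j. j > m \<Longrightarrow> D j = 0"
  shows "{G :: nat \<Rightarrow> (nat \<Rightarrow> 'k::{field,finite}) set. G \<in> flags r D \<and> (\<forall>j. cstable cls (G j))}
    = (\<Union>c\<in>dwords r m D. pflags r cls c)"
proof (intro equalityI subsetI)
  fix G :: "nat \<Rightarrow> (nat \<Rightarrow> 'k) set" assume "G \<in> {G. G \<in> flags r D \<and> (\<forall>j. cstable cls (G j))}"
  then have G: "antimono G" "\<And>j. fs.subspace (G j)" "\<And>j. G j \<subseteq> supp_on {1..r}"
    "\<And>j. card (G j) = card (UNIV :: 'k set) ^ D j" "\<And>j. cstable cls (G j)"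
    by (auto simp: flags_def)
  have cp: "card (piv (G j)) = D j" for j
    using card_subspace_piv[OF G(2,3), of j] G(4)[of j] card_UNIV_field_gt1[where 'k = 'k] by simp
  have ps: "piv (G j) \<subseteq> {1..r}" for j by (rule piv_subset[OF G(3)])
  have fin: "finite (piv (G j))" for j using ps finite_subset by blast
  have p0: "piv (G 0) = {1..r}" using card_subset_eq[OF _ ps, of 0] cp[of 0] D(1) by simp
  have pm: "piv (G j) = {}" if "j > m" for j using cp[of j] D(2)[OF that] fin[of j] by simp
  have anti: "piv (G j') \<subseteq> piv (G j)" if "j \<le> j'" for j j'
  proof -
    have "G j' \<subseteq> G j" using G(1) that by (rule antimonoD)
    then show ?thesis unfolding piv_def by blast
  qed
  define c where "c = restrict (\<lambda>i. Max {j. i \<in> piv (G j)}) {1..r}"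
  have J: "finite {j. i \<in> piv (G j)}" "i \<in> {1..r} \<Longrightarrow> {j. i \<in> piv (G j)} \<noteq> {}" for i
  proof -
    have "{j. i \<in> piv (G j)} \<subseteq> {..m}" using pm by (auto simp: not_less[symmetric])
    then show "finite {j. i \<in> piv (G j)}" using finite_subset by blast
    show "i \<in> {1..r} \<Longrightarrow> {j. i \<in> piv (G j)} \<noteq> {}" using p0 by blast
  qed
  have iff: "i \<in> piv (G j) \<longleftrightarrow> j \<le> c i" if i: "i \<in> {1..r}" for i j
  proof
    assume "i \<in> piv (G j)"
    then show "j \<le> c i" using J(1) i by (auto simp: c_def intro: Max_ge)
  next
    assume j: "j \<le> c i"
    have "c i \<in> {j. i \<in> piv (G j)}" using Max_in[OF J(1) J(2)[OF i]] i by (simp add: c_def)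
    then show "i \<in> piv (G j)" using anti[OF j] by blast
  qed
  have pc: "piv (G j) = {i \<in> {1..r}. j \<le> c i}" for j using iff ps[of j] by blast
  have "c i \<le> m" if i: "i \<in> {1..r}" for i
    using iff[OF i, of "c i"] pm[of "c i"] by (cases "c i > m") auto
  then have "c \<in> dwords r m D" using cp unfolding pc by (auto simp: dwords_def c_def)
  moreover have "G \<in> pflags r cls c" using G pc by (simp add: pflags_def)
  ultimately show "G \<in> (\<Union>c\<in>dwords r m D. pflags r cls c)" by blast
next
  fix G :: "nat \<Rightarrow> (nat \<Rightarrow> 'k) set" assume "G \<in> (\<Union>c\<in>dwords r m D. pflags r cls c)"
  then obtain c where c: "c \<in> dwords r m D" "G \<in> pflags r cls c" by blast
  have G: "antimono G" "\<And>j. fs.subspace (G j)" "\<And>j. G j \<subseteq> supp_on {1..r}"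
     "\<And>j. cstable cls (G j)" "\<And>j. piv (G j) = {i \<in> {1..r}. j \<le> c i}"
    using c(2) by (auto simp: pflags_def)
  have "card (G j) = card (UNIV :: 'k set) ^ D j" for j
    unfolding card_subspace_piv[OF G(2,3)] G(5) using c(1) by (simp add: dwords_def)
  then show "G \<in> {G. G \<in> flags r D \<and> (\<forall>j. cstable cls (G j))}" using G by (simp add: flags_def)
qed

lemma card_flags_cstable:
  fixes cls :: "nat \<Rightarrow> 'b"
  assumes D: "D 0 = r" "\<And>j. j > m \<Longrightarrow> D j = 0"
  shows "finite {G :: nat \<Rightarrow> (nat \<Rightarrow> 'k::{field,finite}) set. G \<in> flags r D \<and> (\<forall>j. cstable cls (G j))}"
    and "card {G :: nat \<Rightarrow> (nat \<Rightarrow> 'k::{field,finite}) set. G \<in> flags r D \<and> (\<forall>j. cstable cls (G j))}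
    = (\<Sum>c\<in>dwords r m D. card (UNIV :: 'k set) ^ wstat r cls (\<lambda>x. x) c)"
proof -
  have finD: "finite (dwords r m D)"
    by (rule finite_subset[of _ "{1..r} \<rightarrow>\<^sub>E {..m}"]) (auto simp: dwords_def intro: finite_PiE)
  have fin: "finite (pflags r cls c :: (nat \<Rightarrow> (nat \<Rightarrow> 'k) set) set)" for c
    using card_pflags by blast
  have eq: "{G :: nat \<Rightarrow> (nat \<Rightarrow> 'k) set. G \<in> flags r D \<and> (\<forall>j. cstable cls (G j))}
    = (\<Union>c\<in>dwords r m D. pflags r cls c)"
    by (rule flags_cstable_eq) (rule D, erule D(2))
  show "finite {G :: nat \<Rightarrow> (nat \<Rightarrow> 'k) set. G \<in> flags r D \<and> (\<forall>j. cstable cls (G j))}"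
    unfolding eq using finD fin by blast
  have disj: "pflags r cls c \<inter> pflags r cls c' = ({} :: (nat \<Rightarrow> (nat \<Rightarrow> 'k) set) set)"
    if c: "c \<in> dwords r m D" "c' \<in> dwords r m D" "c \<noteq> c'" for c c'
  proof (rule ccontr)
    assume "pflags r cls c \<inter> pflags r cls c' \<noteq> ({} :: (nat \<Rightarrow> (nat \<Rightarrow> 'k) set) set)"
    then obtain G :: "nat \<Rightarrow> (nat \<Rightarrow> 'k) set" where "G \<in> pflags r cls c" "G \<in> pflags r cls c'" by blast
    then have eq: "{i \<in> {1..r}. j \<le> c i} = {i \<in> {1..r}. j \<le> c' i}" for j
      unfolding pflags_def by blast
    have "c i = c' i" for i
    proof (cases "i \<in> {1..r}")
      case True
      then show ?thesis using eq[of "c i"] eq[of "c' i"] by (auto intro: le_antisym)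
    next
      case False
      then show ?thesis using c by (auto simp: dwords_def PiE_def extensional_def)
    qed
    then show False using c(3) by auto
  qed
  show "card {G :: nat \<Rightarrow> (nat \<Rightarrow> 'k) set. G \<in> flags r D \<and> (\<forall>j. cstable cls (G j))}
    = (\<Sum>c\<in>dwords r m D. card (UNIV :: 'k set) ^ wstat r cls (\<lambda>x. x) c)"
    unfolding eq
    by (subst card_UN_disjoint) (use finD fin disj in \<open>auto simp: card_pflags\<close>)
qed

lemma dwords_eq_cwords:
  assumes D: "\<And>j. j > m \<Longrightarrow> D j = 0" and k: "\<And>j. j \<le> m \<Longrightarrow> D j = k j + D (Suc j)"
  shows "dwords r m D = cwords r {..m} k"
proof -
  have split: "card {i \<in> {1..r}. j \<le> c i} = card {i \<in> {1..r}. c i = j} + card {i \<in> {1..r}. Suc j \<le> c i}"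
    for c :: "nat \<Rightarrow> nat" and j
  proof -
    have "{i \<in> {1..r}. j \<le> c i} = {i \<in> {1..r}. c i = j} \<union> {i \<in> {1..r}. Suc j \<le> c i}" by auto
    moreover have "card ({i \<in> {1..r}. c i = j} \<union> {i \<in> {1..r}. Suc j \<le> c i}) =
       card {i \<in> {1..r}. c i = j} + card {i \<in> {1..r}. Suc j \<le> c i}"
      by (rule card_Un_disjoint) auto
    ultimately show ?thesis by simp
  qed
  show ?thesis
  proof (intro equalityI subsetI)
    fix c assume c: "c \<in> dwords r m D"
    have "card {i \<in> {1..r}. c i = j} = k j" if "j \<le> m" for j
    proof -
      have "card {i \<in> {1..r}. l \<le> c i} = D l" for l using c unfolding dwords_def by blast
      then show ?thesis using split[of j c] k[OF that] by simp
    qed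
    then show "c \<in> cwords r {..m} k" using c unfolding dwords_def cwords_def by blast
  next
    fix c assume c: "c \<in> cwords r {..m} k"
    have big: "card {i \<in> {1..r}. j \<le> c i} = D j" if "j > m" for j
    proof -
      have "{i \<in> {1..r}. j \<le> c i} = {}" using c that by (force simp: cwords_def PiE_def Pi_def)
      then have "card {i \<in> {1..r}. j \<le> c i} = 0" by (simp only: card.empty)
      then show ?thesis using D[OF that] by simp
    qed
    have "card {i \<in> {1..r}. j \<le> c i} = D j" for j
    proof (cases "j > m")
      case False
      then have "j \<le> Suc m" by simp
      then show ?thesis
      proof (induction rule: inc_induct)
        case base
        show ?case by (rule big) simp
      next
        case (step n)
        have n: "n \<le> m" using step by simp
        have "card {i \<in> {1..r}. c i = n} = k n" using c n unfolding cwords_def by blast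
        then show ?case using split[of n c] step.IH k[OF n] by simp
      qed
    qed (rule big)
    then show "c \<in> dwords r m D" using c unfolding dwords_def cwords_def by blast
  qed
qed

text \<open>The involution \<open>sg\<close> renames the letters; content and ranking are
  transported with it, so comparisons of letters are unchanged.\<close>

lemma sum_cwords_relabel:
  fixes q :: nat and cls :: "nat \<Rightarrow> 'b"
  assumes sg: "\<And>x. x \<in> C \<Longrightarrow> sg x \<in> C \<and> sg (sg x) = x \<and> k' (sg x) = k x \<and> ord' (sg x) = ord x"
  shows "(\<Sum>c\<in>cwords r C k. q ^ wstat r cls ord c) = (\<Sum>c\<in>cwords r C k'. q ^ wstat r cls ord' c)"
proof -
  have mem: "restrict (sg \<circ> c) {1..r} \<in> cwords r C k2"
    if c: "c \<in> cwords r C k1" and k: "\<And>x. x \<in> C \<Longrightarrow> k2 x = k1 (sg x)" for c k1 k2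
  proof -
    have cC: "c i \<in> C" if "i \<in> {1..r}" for i using c that by (auto simp: cwords_def)
    have "card {i \<in> {1..r}. restrict (sg \<circ> c) {1..r} i = x} = k2 x" if x: "x \<in> C" for x
    proof -
      have "{i \<in> {1..r}. restrict (sg \<circ> c) {1..r} i = x} = {i \<in> {1..r}. c i = sg x}"
      proof (intro Collect_cong conj_cong refl)
        fix i assume i: "i \<in> {1..r}"
        have "restrict (sg \<circ> c) {1..r} i = sg (c i)" using i by simp
        then show "restrict (sg \<circ> c) {1..r} i = x \<longleftrightarrow> c i = sg x" using sg[OF cC[OF i]] sg[OF x] by auto
      qed
      moreover have "card {i \<in> {1..r}. c i = sg x} = k1 (sg x)" using c sg[OF x] unfolding cwords_def by blast
      ultimately show ?thesis using k[OF x] by simp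
    qed
    then show ?thesis using cC sg unfolding cwords_def by auto
  qed
  have inv: "restrict (sg \<circ> restrict (sg \<circ> c) {1..r}) {1..r} = c" if "c \<in> cwords r C k1" for c k1
  proof
    fix i
    show "restrict (sg \<circ> restrict (sg \<circ> c) {1..r}) {1..r} i = c i"
    proof (cases "i \<in> {1..r}")
      case True
      then have "c i \<in> C" using that by (auto simp: cwords_def)
      then show ?thesis using True sg by simp
    next
      case False
      then have "c i = undefined" using that unfolding cwords_def PiE_def extensional_def by blast
      then show ?thesis unfolding restrict_def using False by (simp only: if_False)
    qed
  qed
  have st: "wstat r cls ord' (restrict (sg \<circ> c) {1..r}) = wstat r cls ord c" if c: "c \<in> cwords r C k" for c
  proof -
    have "ord' (restrict (sg \<circ> c) {1..r} i) = ord (c i)" if "1 \<le> i" "i \<le> r" for i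
    proof -
      have "c i \<in> C" using c that by (auto simp: cwords_def)
      then show ?thesis using sg that by simp
    qed
    then show ?thesis unfolding wstat_def by (intro arg_cong[where f = card]) auto
  qed
  have m1: "restrict (sg \<circ> c) {1..r} \<in> cwords r C k'" if "c \<in> cwords r C k" for c
  proof (rule mem[OF that])
    fix x assume "x \<in> C"
    then show "k' x = k (sg x)" using sg[of x] sg[of "sg x"] by simp
  qed
  have m2: "restrict (sg \<circ> c) {1..r} \<in> cwords r C k" if "c \<in> cwords r C k'" for c
    by (rule mem[OF that]) (simp add: sg)
  show ?thesis
    by (rule sum.reindex_bij_witness[where i = "\<lambda>c. restrict (sg \<circ> c) {1..r}" and j = "\<lambda>c. restrict (sg \<circ> c) {1..r}"])
      (use inv st m1 m2 in \<open>simp_all del: restrict_apply\<close>)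
qed

text \<open>Step \<open>j\<close> is going to be the preimage in \<open>k^r\<close> of the image of
  \<open>(i;j)\<close> in \<open>(i;0)\<close>. For \<open>j = s i + 1\<close> this is the kernel,
  of dimension \<open>r - n_i\<close>. Later steps are set to 0, which makes the kernel the last
  block of the flag.\<close>

definition fdim :: "nat \<Rightarrow> (nat \<Rightarrow> nat) \<Rightarrow> (nat \<Rightarrow> nat \<Rightarrow> nat) \<Rightarrow> nat \<Rightarrow> nat \<Rightarrow> nat" where
  "fdim r s mu i j = (if j \<le> s i + 1 then r - (\<Sum>f = 1..j. mu i f) else 0)"

lemma card_flags_stab:
  assumes r: "psize s mu i \<le> r" and p: "p \<subseteq> Pow {1..r}"
  shows "finite {G \<in> flags r (fdim r s mu i) :: (nat \<Rightarrow> (nat \<Rightarrow> 'k::{field,finite}) set) set. p \<subseteq> stab r G}"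
   and "card {G \<in> flags r (fdim r s mu i) :: (nat \<Rightarrow> (nat \<Rightarrow> 'k) set) set. p \<subseteq> stab r G} =
    (\<Sum>w\<in>S_perm r (mu_tilde r s mu i). card (UNIV :: 'k set) ^ card {(j, i). 1 \<le> j \<and> j < i \<and> i \<le> r
          \<and> {I \<in> p. j \<in> I} = {I \<in> p. i \<in> I} \<and> w i < w j})"
proof -
  let ?ss = "mu_tilde r s mu i" and ?cls = "\<lambda>i. {I \<in> p. i \<in> I}" and ?q = "card (UNIV :: 'k set)"
  let ?m = "s i + 1" and ?D = "fdim r s mu i"
  \<comment> \<open>The number of coordinates with last step \<open>j\<close>, that is the drop in
    dimension from step \<open>j\<close> to step \<open>j + 1\<close>.\<close>
  define k where "k j = (if j \<le> s i then mu i (Suc j) else r - psize s mu i)" for j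
  \<comment> \<open>Blocks in \<open>S_perm\<close> come in the order of the parts with indices
    \<open>s i + 1, ..., 1, 0\<close>, the letters of a flag in the order
    \<open>1, ..., s i + 1, 0\<close>. The two agree up to reversing all but the last.\<close>
  define sg where "sg t = (if t \<le> s i then s i - t else t)" for t
  have len: "length ?ss = s i + 2" by (simp add: mu_tilde_def)
  have sumss: "r = sum_list ?ss"
  proof -
    have "sum_list (map (mu i) [1..<s i + 2]) = psize s mu i"
      unfolding psize_def interv_sum_list_conv_sum_set_nat by (rule sum.cong) auto
    then show ?thesis using r by (simp add: mu_tilde_def)
  qed
  have D0: "?D 0 = r" by (simp add: fdim_def)
  have Dm: "?D j = 0" if "j > ?m" for j using that by (simp add: fdim_def)
  have part: "(\<Sum>f = 1..j. mu i f) \<le> r" if "j \<le> s i + 1" for j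
    using sum_mono2[of "{1..s i + 1}" "{1..j}" "mu i"] that r by (simp add: psize_def)
  have kD: "?D j = k j + ?D (Suc j)" if "j \<le> ?m" for j
  proof (cases "j \<le> s i")
    case True
    then show ?thesis using part[of "Suc j"] by (simp add: fdim_def k_def)
  next
    case False
    then have "j = s i + 1" using that by simp
    then show ?thesis by (simp add: fdim_def k_def psize_def)
  qed
  have eq: "{G \<in> flags r ?D :: (nat \<Rightarrow> (nat \<Rightarrow> 'k) set) set. p \<subseteq> stab r G} = {G. G \<in> flags r ?D \<and> (\<forall>j. cstable ?cls (G j))}"
  proof (intro Collect_cong conj_cong refl)
    fix G :: "nat \<Rightarrow> (nat \<Rightarrow> 'k) set" assume "G \<in> flags r ?D"
    then show "p \<subseteq> stab r G \<longleftrightarrow> (\<forall>j. cstable ?cls (G j))"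
      by (intro subset_stab_iff[OF p]) (auto simp: flags_def)
  qed
  show "finite {G \<in> flags r ?D :: (nat \<Rightarrow> (nat \<Rightarrow> 'k) set) set. p \<subseteq> stab r G}"
    unfolding eq by (rule card_flags_cstable(1)) (rule D0, erule Dm)
  have "card {G \<in> flags r ?D :: (nat \<Rightarrow> (nat \<Rightarrow> 'k) set) set. p \<subseteq> stab r G} =
     (\<Sum>c\<in>dwords r ?m ?D. ?q ^ wstat r ?cls (\<lambda>x. x) c)"
    unfolding eq by (rule card_flags_cstable(2)) (rule D0, erule Dm)
  also have "dwords r ?m ?D = cwords r {..?m} k"
    by (rule dwords_eq_cwords) (erule Dm, erule kD)
  \<comment> \<open>The new ranking gives a letter \<open>j \<le> s i\<close> the value
    \<open>j + 2\<close> and the letter \<open>s i + 1\<close> of the kernel the value 1: the kernel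
    moves from the top of the order to the bottom.\<close>
  also have "(\<Sum>c\<in>cwords r {..?m} k. ?q ^ wstat r ?cls (\<lambda>x. x) c)
      = (\<Sum>c\<in>cwords r {..?m} k. ?q ^ wstat r ?cls (\<lambda>x. length ?ss - sg x) c)"
  proof (rule sum_cwords_ord)
    show "inj_on (\<lambda>x. length ?ss - sg x) {..?m}"
      unfolding len sg_def by (rule inj_onI) (auto split: if_splits)
  qed auto
  also have "\<dots> = (\<Sum>c\<in>cwords r {..?m} ((!) (rev ?ss)). ?q ^ wstat r ?cls (\<lambda>t. length ?ss - t) c)"
  proof (rule sum_cwords_relabel[where sg = sg])
    fix x assume x: "x \<in> {..?m}"
    have "rev ?ss ! sg x = k x"
    proof (cases "x \<le> s i")
      case True
      then have sx: "sg x < length ?ss" by (simp add: sg_def len)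
      have "rev ?ss ! sg x = ?ss ! (Suc x)" unfolding rev_nth[OF sx] using True by (simp add: len sg_def)
      then show ?thesis using True by (simp add: mu_tilde_def k_def nth_append del: upt_Suc)
    next
      case False
      then have e: "x = s i + 1" using x by simp
      have sx: "sg x < length ?ss" using e by (simp add: sg_def len)
      have "rev ?ss ! sg x = ?ss ! 0" unfolding rev_nth[OF sx] using e by (simp add: len sg_def)
      then show ?thesis using e by (simp add: mu_tilde_def k_def)
    qed
    then show "sg x \<in> {..?m} \<and> sg (sg x) = x \<and> rev ?ss ! sg x = k x \<and> length ?ss - sg x = length ?ss - sg x"
      using x by (auto simp: sg_def)
  qed
  also have "{..?m} = {..<length ?ss}" by (auto simp: len)
  also have "(\<Sum>c\<in>cwords r {..<length ?ss} ((!) (rev ?ss)). ?q ^ wstat r ?cls (\<lambda>t. length ?ss - t) c)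
     = (\<Sum>w\<in>S_perm r ?ss. ?q ^ card {(j, i). 1 \<le> j \<and> j < i \<and> i \<le> r \<and> ?cls j = ?cls i \<and> w i < w j})"
    by (rule sum_S_perm[OF sumss, symmetric])
  finally show "card {G \<in> flags r (fdim r s mu i) :: (nat \<Rightarrow> (nat \<Rightarrow> 'k) set) set. p \<subseteq> stab r G} =
    (\<Sum>w\<in>S_perm r ?ss. ?q ^ card {(j, i). 1 \<le> j \<and> j < i \<and> i \<le> r
          \<and> {I \<in> p. j \<in> I} = {I \<in> p. i \<in> I} \<and> w i < w j})" .
qed

definition flag_tuples :: "nat \<Rightarrow> nat \<Rightarrow> (nat \<Rightarrow> nat \<Rightarrow> nat) \<Rightarrow> (nat \<Rightarrow> nat \<Rightarrow> (nat \<Rightarrow> 'k::field) set) set" where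
  "flag_tuples r k D = (\<Pi>\<^sub>E i\<in>{1..k}. flags r (D i))"

definition tstab :: "nat \<Rightarrow> nat \<Rightarrow> (nat \<Rightarrow> nat \<Rightarrow> (nat \<Rightarrow> 'k::field) set) \<Rightarrow> nat set set" where
  "tstab r k F = {I. I \<subseteq> {1..r} \<and> (\<forall>i\<in>{1..k}. I \<in> stab r (F i))}"

text \<open>Stability under a fixed collection \<open>p\<close> is imposed on each leg separately,
  so the count of stable tuples is a product over the legs. This is the hypothesis needed by
  \<open>count_connected_eq_R_poly\<close>.\<close>

lemma card_connected_flag_tuples:
  assumes "r \<ge> 1" "\<And>i. i \<in> {1..k} \<Longrightarrow> psize s mu i \<le> r"
  shows "finite (flag_tuples r k (fdim r s mu) :: (nat \<Rightarrow> nat \<Rightarrow> (nat \<Rightarrow> 'k::{field,finite}) set) set)"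
    and "int (card {F \<in> flag_tuples r k (fdim r s mu) :: (nat \<Rightarrow> nat \<Rightarrow> (nat \<Rightarrow> 'k) set) set.
            tstab r k F = {{}, {1..r}}}) =
      (int (card (UNIV :: 'k set)) - 1) ^ (r - 1) *
      (\<Sum>w\<in>(\<Pi>\<^sub>E i\<in>{1..k}. S_perm r (mu_tilde r s mu i)). R_poly r k w (int (card (UNIV :: 'k set))))"
proof -
  let ?A = "flag_tuples r k (fdim r s mu) :: (nat \<Rightarrow> nat \<Rightarrow> (nat \<Rightarrow> 'k) set) set"
  have "finite (flags r (fdim r s mu i) :: (nat \<Rightarrow> (nat \<Rightarrow> 'k) set) set)" if "i \<in> {1..k}" for i
    using card_flags_stab(1)[OF assms(2)[OF that], of "{}", where 'k = 'k] by simp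
  then show fin: "finite ?A" unfolding flag_tuples_def by (intro finite_PiE) auto
  show "int (card {F \<in> ?A. tstab r k F = {{}, {1..r}}}) =
      (int (card (UNIV :: 'k set)) - 1) ^ (r - 1) *
      (\<Sum>w\<in>(\<Pi>\<^sub>E i\<in>{1..k}. S_perm r (mu_tilde r s mu i)). R_poly r k w (int (card (UNIV :: 'k set))))"
  proof (rule count_connected_eq_R_poly[OF assms(1) fin])
    show "tstab r k ` ?A \<subseteq> Pow (Pow {1..r})" by (auto simp: tstab_def)
    fix p assume p: "p \<subseteq> Pow {1..r}"
    have "{F \<in> ?A. p \<subseteq> tstab r k F} = (\<Pi>\<^sub>E i\<in>{1..k}. {G \<in> flags r (fdim r s mu i). p \<subseteq> stab r G})"
      using p unfolding flag_tuples_def tstab_def by (auto simp: PiE_def Pi_def)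
    then have "card {F \<in> ?A. p \<subseteq> tstab r k F} =
        (\<Prod>i\<in>{1..k}. card {G \<in> flags r (fdim r s mu i) :: (nat \<Rightarrow> (nat \<Rightarrow> 'k) set) set. p \<subseteq> stab r G})"
      by (simp add: card_PiE)
    also have "\<dots> = (\<Prod>t\<in>{1..k}. \<Sum>w\<in>S_perm r (mu_tilde r s mu t). card (UNIV :: 'k set) ^ card {(j, i). 1 \<le> j \<and> j < i \<and> i \<le> r
          \<and> {I \<in> p. j \<in> I} = {I \<in> p. i \<in> I} \<and> w i < w j})"
      by (rule prod.cong[OF refl], rule card_flags_stab(2)[OF assms(2) p])
    finally show "card {F \<in> ?A. p \<subseteq> tstab r k F} = \<dots>" .
  qed
qed

section \<open>Torus orbits of flag tuples\<close>

lemma flag_tuplesD: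
  fixes F :: "nat \<Rightarrow> nat \<Rightarrow> (nat \<Rightarrow> 'k::field) set"
  assumes "F \<in> flag_tuples r k D" "i \<in> {1..k}"
  shows "fs.subspace (F i j)" "F i j \<subseteq> supp_on {1..r}" "card (F i j) = card (UNIV :: 'k set) ^ D i j"
proof -
  have "F i \<in> flags r (D i)" using assms unfolding flag_tuples_def by (rule PiE_mem)
  then show "fs.subspace (F i j)" "F i j \<subseteq> supp_on {1..r}" "card (F i j) = card (UNIV :: 'k set) ^ D i j"
    unfolding flags_def by blast+
qed

text \<open>Coordinates outside \<open>{1..r}\<close> are pinned to 1, so that each torus element is
  one function and the torus over a finite field is finite.\<close>

definition torus :: "nat \<Rightarrow> (nat \<Rightarrow> 'k::field) set" where
  "torus r = {t. (\<forall>l. t l \<noteq> 0) \<and> (\<forall>l. l \<notin> {1..r} \<longrightarrow> t l = 1)}"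

definition act :: "nat \<Rightarrow> (nat \<Rightarrow> 'k::field) \<Rightarrow> (nat \<Rightarrow> nat \<Rightarrow> (nat \<Rightarrow> 'k) set) \<Rightarrow> (nat \<Rightarrow> nat \<Rightarrow> (nat \<Rightarrow> 'k) set)" where
  "act k t F = restrict (\<lambda>i j. (*) t ` F i j) {1..k}"

definition orb :: "nat \<Rightarrow> nat \<Rightarrow> (nat \<Rightarrow> nat \<Rightarrow> (nat \<Rightarrow> 'k::field) set) \<Rightarrow> (nat \<Rightarrow> nat \<Rightarrow> (nat \<Rightarrow> 'k) set) set" where
  "orb r k F = (\<lambda>t. act k t F) ` torus r"

lemma card_torus: "finite (torus r :: (nat \<Rightarrow> 'k::{field,finite}) set)"
  "card (torus r :: (nat \<Rightarrow> 'k::{field,finite}) set) = (card (UNIV :: 'k set) - 1) ^ r"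
proof -
  have bij: "bij_betw (\<lambda>t. restrict t {1..r}) (torus r :: (nat \<Rightarrow> 'k) set) ({1..r} \<rightarrow>\<^sub>E - {0})"
    by (rule bij_betwI[where g = "\<lambda>t l. if l \<in> {1..r} then t l else 1"])
      (auto simp: torus_def fun_eq_iff restrict_def PiE_def Pi_def extensional_def)
  have "finite ({1..r} \<rightarrow>\<^sub>E - {0 :: 'k})" by (intro finite_PiE) auto
  then show "finite (torus r :: (nat \<Rightarrow> 'k) set)" using bij_betw_finite[OF bij] by blast
  have "card (torus r :: (nat \<Rightarrow> 'k) set) = card ({1..r} \<rightarrow>\<^sub>E - {0 :: 'k})"
    by (rule bij_betw_same_card[OF bij])
  also have "card (- {0 :: 'k}) = card (UNIV :: 'k set) - 1" by (simp add: Compl_eq_Diff_UNIV)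
  then have "card ({1..r} \<rightarrow>\<^sub>E - {0 :: 'k}) = (card (UNIV :: 'k set) - 1) ^ r" by (simp add: card_PiE)
  finally show "card (torus r :: (nat \<Rightarrow> 'k) set) = (card (UNIV :: 'k set) - 1) ^ r" .
qed

lemma torus_mult: "t \<in> torus r \<Longrightarrow> t' \<in> torus r \<Longrightarrow> t * t' \<in> torus r"
  by (simp add: torus_def)

lemma torus_one: "1 \<in> torus r"
  by (simp add: torus_def)

lemma torus_inverse: "t \<in> torus r \<Longrightarrow> (\<lambda>l. inverse (t l)) \<in> torus r"
  by (simp add: torus_def)

lemma torus_inverse_mult: "t \<in> torus r \<Longrightarrow> (\<lambda>l. inverse (t l)) * t = 1"
  by (auto simp: torus_def fun_eq_iff)

lemma act_act: "act k t (act k t' F) = act k (t * t') F"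
  by (auto simp: act_def fun_eq_iff image_image mult.assoc)

lemma act_one: "F \<in> flag_tuples r k D \<Longrightarrow> act k 1 F = F"
  by (auto simp: act_def fun_eq_iff flag_tuples_def PiE_def extensional_def restrict_def)

lemma inj_torus: "t \<in> torus r \<Longrightarrow> inj ((*) t)"
  by (rule injI) (auto simp: torus_def fun_eq_iff)

lemma act_flag_tuples:
  assumes t: "t \<in> torus r" and F: "F \<in> flag_tuples r k D"
  shows "act k t F \<in> flag_tuples r k D"
proof -
  have "(\<lambda>j. (*) t ` G j) \<in> flags r D'" if G: "G \<in> flags r D'" for G D'
  proof -
    have G': "antimono G" "\<And>j. fs.subspace (G j)" "\<And>j. G j \<subseteq> supp_on {1..r}"
      "\<And>j. card (G j) = card (UNIV :: 'a set) ^ D' j" using G by (auto simp: flags_def)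
    have "antimono (\<lambda>j. (*) t ` G j)" using G'(1) unfolding antimono_def by (blast intro: image_mono)
    moreover have "fs.subspace ((*) t ` G j)" for j
    proof (rule fs.subspaceI)
      show "0 \<in> (*) t ` G j" using fs.subspace_0[OF G'(2)] by (intro image_eqI[of _ _ 0]) auto
      show "x + y \<in> (*) t ` G j" if xy: "x \<in> (*) t ` G j" "y \<in> (*) t ` G j" for x y
      proof -
        obtain x' y' where "x = t * x'" "y = t * y'" "x' \<in> G j" "y' \<in> G j" using xy by blast
        then show ?thesis using fs.subspace_add[OF G'(2)]
          by (intro image_eqI[of _ _ "x' + y'"]) (auto simp: distrib_left)
      qed
      show "smul c x \<in> (*) t ` G j" if x: "x \<in> (*) t ` G j" for c x
      proof -
        obtain x' where "x = t * x'" "x' \<in> G j" using x by blast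
        then show ?thesis using fs.subspace_scale[OF G'(2)]
          by (intro image_eqI[of _ _ "smul c x'"]) (auto simp: fun_eq_iff)
      qed
    qed
    moreover have "(*) t ` G j \<subseteq> supp_on {1..r}" for j
      using G'(3)[of j] by (auto simp: supp_on_def)
    moreover have "card ((*) t ` G j) = card (UNIV :: 'a set) ^ D' j" for j
      using card_image[OF inj_on_subset[OF inj_torus[OF t] subset_UNIV]] G'(4) by metis
    ultimately show ?thesis by (simp add: flags_def)
  qed
  then show ?thesis using F unfolding flag_tuples_def act_def by auto
qed

lemma tstab_mono_act: "tstab r k F \<subseteq> tstab r k (act k t F)"
proof
  fix I assume I: "I \<in> tstab r k F"
  have "proj I y \<in> act k t F i j" if i: "i \<in> {1..k}" and y: "y \<in> act k t F i j" for i j y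
  proof -
    obtain x where x: "y = t * x" "x \<in> F i j" using y i by (auto simp: act_def)
    have "proj I y = t * proj I x" using x by (auto simp: proj_def fun_eq_iff)
    moreover have "proj I x \<in> F i j" using I i x unfolding tstab_def stab_def by blast
    ultimately show ?thesis using i by (simp add: act_def)
  qed
  then show "I \<in> tstab r k (act k t F)" using I unfolding tstab_def stab_def by blast
qed

lemma tstab_act:
  assumes t: "t \<in> torus r" and F: "F \<in> flag_tuples r k D"
  shows "tstab r k (act k t F) = tstab r k F"
proof
  show "tstab r k F \<subseteq> tstab r k (act k t F)" by (rule tstab_mono_act)
  have "tstab r k (act k t F) \<subseteq> tstab r k (act k (\<lambda>l. inverse (t l)) (act k t F))" by (rule tstab_mono_act)
  then show "tstab r k (act k t F) \<subseteq> tstab r k F"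
    unfolding act_act torus_inverse_mult[OF t] act_one[OF F] .
qed

lemma orb_eq:
  assumes F: "F \<in> flag_tuples r k D" and F': "F' \<in> orb r k F"
  shows "orb r k F' = orb r k F"
proof -
  have sub: "orb r k (act k t F) \<subseteq> orb r k F" if "t \<in> torus r" for t and F :: "nat \<Rightarrow> nat \<Rightarrow> (nat \<Rightarrow> 'a) set"
    using that torus_mult by (auto simp: orb_def act_act)
  obtain t where t: "t \<in> torus r" "F' = act k t F" using F' by (auto simp: orb_def)
  have "F = act k (\<lambda>l. inverse (t l)) F'" unfolding t(2) act_act torus_inverse_mult[OF t(1)] act_one[OF F] ..
  then have "orb r k F \<subseteq> orb r k F'" using sub[OF torus_inverse[OF t(1)], of F'] by simp
  then show ?thesis using sub[OF t(1), of F] t(2) by blast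
qed

lemma orb_self: "F \<in> flag_tuples r k D \<Longrightarrow> F \<in> orb r k F"
  unfolding orb_def by (rule image_eqI[of _ _ 1]) (simp_all add: act_one torus_one)

text \<open>A diagonal matrix preserving a subspace also preserves it after applying the Lagrange
  interpolation polynomial that singles out one of its eigenvalues.\<close>

lemma stabilizer_scalar:
  fixes u :: "nat \<Rightarrow> 'k::field"
  assumes con: "tstab r k F = {{}, {1..r}}" and F: "F \<in> flag_tuples r k D"
    and u: "\<And>i j x. i \<in> {1..k} \<Longrightarrow> x \<in> F i j \<Longrightarrow> u * x \<in> F i j"
    and l: "l \<in> {1..r}" "m \<in> {1..r}"
  shows "u l = u m"
proof -
  define a where "a = u m"
  define I where "I = {l \<in> {1..r}. u l = a}"
  have "proj I x \<in> F i j" if i: "i \<in> {1..k}" and x: "x \<in> F i j" for i j x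
  proof -
    have Fij: "fs.subspace (F i j)" "F i j \<subseteq> supp_on {1..r}"
      by (rule flag_tuplesD[OF F i])+
    have *: "(\<lambda>l. (\<Prod>b\<in>B. (u l - b) / (a - b)) * x l) \<in> F i j" if "finite B" for B
      using that
    proof induction
      case empty
      then show ?case using x by simp
    next
      case (insert b B)
      let ?y = "\<lambda>l. (\<Prod>b\<in>B. (u l - b) / (a - b)) * x l"
      have "smul (1 / (a - b)) (u * ?y - smul b ?y) \<in> F i j"
        by (intro fs.subspace_scale fs.subspace_diff Fij(1) u i insert.IH)
      moreover have "smul (1 / (a - b)) (u * ?y - smul b ?y) = (\<lambda>l. (\<Prod>b\<in>insert b B. (u l - b) / (a - b)) * x l)"
        using insert.hyps by (auto simp: fun_eq_iff algebra_simps diff_divide_distrib)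
      ultimately show ?case by (simp only:)
    qed
    let ?B = "u ` {1..r} - {a}"
    have "(\<lambda>l. (\<Prod>b\<in>?B. (u l - b) / (a - b)) * x l) = proj I x"
    proof
      fix l
      show "(\<Prod>b\<in>?B. (u l - b) / (a - b)) * x l = proj I x l"
      proof (cases "l \<in> {1..r}")
        case False
        then have "x l = 0" using supp_onD[OF subsetD[OF Fij(2) x]] by blast
        then show ?thesis by (simp add: proj_def)
      next
        case l: True
        show ?thesis
        proof (cases "u l = a")
          case True
          have "(\<Prod>b\<in>?B. (u l - b) / (a - b)) = 1" by (rule prod.neutral) (auto simp: True)
          then show ?thesis using True l by (simp add: proj_def I_def)
        next
          case False
          then have "u l \<in> ?B" using l by blast
          then have "(\<Prod>b\<in>?B. (u l - b) / (a - b)) = 0" by (intro prod_zero) auto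
          then show ?thesis using False by (simp add: proj_def I_def)
        qed
      qed
    qed
    then show ?thesis using *[of ?B] by simp
  qed
  moreover have "I \<subseteq> {1..r}" by (auto simp: I_def)
  ultimately have "I \<in> tstab r k F" unfolding tstab_def stab_def by blast
  moreover have "m \<in> I" using l by (simp add: I_def a_def)
  ultimately have "I = {1..r}" using con by auto
  then have "l \<in> I" using l by simp
  then show ?thesis by (simp add: I_def a_def)
qed

text \<open>If \<open>t\<close> and \<open>t'\<close> move \<open>F\<close> to the same tuple, their
  quotient preserves every flag step and is constant on \<open>{1..r}\<close> by
  \<open>stabilizer_scalar\<close>. Conversely, subspaces are invariant under scalars.\<close>

lemma act_eq_iff:
  fixes t t' :: "nat \<Rightarrow> 'k::field"
  assumes r: "r \<ge> 1" and con: "tstab r k F = {{}, {1..r}}" and F: "F \<in> flag_tuples r k D"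
    and t: "t \<in> torus r" "t' \<in> torus r"
  shows "act k t F = act k t' F \<longleftrightarrow> (\<exists>c. c \<noteq> 0 \<and> t = (\<lambda>l. if l \<in> {1..r} then c * t' l else 1))"
proof
  assume eq: "act k t F = act k t' F"
  define u where "u = (\<lambda>l. t l / t' l)"
  have "u * x \<in> F i j" if i: "i \<in> {1..k}" and x: "x \<in> F i j" for i j x
  proof -
    have "t * x \<in> act k t F i j" using i x by (simp add: act_def)
    then obtain y where y: "t * x = t' * y" "y \<in> F i j" unfolding eq using i by (auto simp: act_def)
    have "u l * x l = y l" for l
      using fun_cong[OF y(1), of l] t(2) by (simp add: u_def torus_def field_simps)
    then have "u * x = y" by (auto simp: fun_eq_iff)
    then show ?thesis using y by simp
  qed
  then have uc: "u l = u 1" if "l \<in> {1..r}" for l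
    using stabilizer_scalar[OF con F, of u l 1] that r by simp
  have "t l = (if l \<in> {1..r} then u 1 * t' l else 1)" for l
  proof (cases "l \<in> {1..r}")
    case True
    have "t l = u l * t' l" using t(2) by (simp add: u_def torus_def)
    then show ?thesis using uc[OF True] True by simp
  next
    case False
    then show ?thesis using t(1) by (auto simp: torus_def)
  qed
  moreover have "u 1 \<noteq> 0" using t by (simp add: u_def torus_def)
  ultimately show "\<exists>c. c \<noteq> 0 \<and> t = (\<lambda>l. if l \<in> {1..r} then c * t' l else 1)" by blast
next
  assume "\<exists>c. c \<noteq> 0 \<and> t = (\<lambda>l. if l \<in> {1..r} then c * t' l else 1)"
  then obtain c where c: "c \<noteq> 0" "t = (\<lambda>l. if l \<in> {1..r} then c * t' l else 1)" by blast
  have "(*) t ` F i j = (*) t' ` F i j" if i: "i \<in> {1..k}" for i j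
  proof -
    have Fij: "fs.subspace (F i j)" "F i j \<subseteq> supp_on {1..r}"
      by (rule flag_tuplesD[OF F i])+
    have e: "t * x = t' * smul c x" if "x \<in> F i j" for x
    proof
      fix l
      have "l \<notin> {1..r} \<Longrightarrow> x l = 0" using supp_onD[OF subsetD[OF Fij(2) that]] by blast
      then show "(t * x) l = (t' * smul c x) l" by (cases "l \<in> {1..r}") (auto simp: c(2))
    qed
    show ?thesis
    proof (intro equalityI subsetI)
      fix y assume "y \<in> (*) t ` F i j"
      then obtain x where "y = t * x" "x \<in> F i j" by blast
      then show "y \<in> (*) t' ` F i j" using e fs.subspace_scale[OF Fij(1)] by blast
    next
      fix y assume "y \<in> (*) t' ` F i j"
      then obtain x where x: "y = t' * x" "x \<in> F i j" by blast
      have x': "smul (inverse c) x \<in> F i j" using fs.subspace_scale[OF Fij(1) x(2)] .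
      have "y = t * smul (inverse c) x" unfolding e[OF x'] x(1) using c(1) by simp
      then show "y \<in> (*) t ` F i j" using x' by blast
    qed
  qed
  then show "act k t F = act k t' F" by (auto simp: act_def fun_eq_iff)
qed

text \<open>Each fibre of the orbit map is a coset of the scalars, of size \<open>q - 1\<close>, in
  a torus of order \<open>(q - 1) ^ r\<close>.\<close>

lemma card_orb:
  fixes F :: "nat \<Rightarrow> nat \<Rightarrow> (nat \<Rightarrow> 'k::{field,finite}) set"
  assumes r: "r \<ge> 1" and con: "tstab r k F = {{}, {1..r}}" and F: "F \<in> flag_tuples r k D"
  shows "card (orb r k F) = (card (UNIV :: 'k set) - 1) ^ (r - 1)"
proof -
  let ?q = "card (UNIV :: 'k set)"
  let ?T = "torus r :: (nat \<Rightarrow> 'k) set"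
  have fib: "card {t \<in> ?T. act k t F = F'} = ?q - 1" if F': "F' \<in> orb r k F" for F'
  proof -
    obtain t' where t': "t' \<in> ?T" "F' = act k t' F" using F' by (auto simp: orb_def)
    let ?h = "\<lambda>c l. if l \<in> {1..r} then c * t' l else 1"
    have "{t \<in> ?T. act k t F = F'} = ?h ` (- {0})"
    proof (intro equalityI subsetI)
      fix t assume "t \<in> {t \<in> ?T. act k t F = F'}"
      then show "t \<in> ?h ` (- {0})" using act_eq_iff[OF r con F _ t'(1)] t'(2) by auto
    next
      fix t assume "t \<in> ?h ` (- {0})"
      then obtain c where c: "c \<noteq> 0" "t = ?h c" by auto
      have "t \<in> ?T" using c t'(1) by (auto simp: torus_def)
      then show "t \<in> {t \<in> ?T. act k t F = F'}" using act_eq_iff[OF r con F _ t'(1)] t'(2) c by auto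
    qed
    moreover have "inj ?h"
    proof (rule injI)
      fix c d assume "?h c = ?h d"
      from fun_cong[OF this, of 1] show "c = d" using r t'(1) by (simp add: torus_def)
    qed
    ultimately show ?thesis
      using card_image[of ?h "- {0}"] by (simp add: inj_on_subset[OF _ subset_UNIV] Compl_eq_Diff_UNIV)
  qed
  have "card ?T = (\<Sum>F'\<in>orb r k F. card {t \<in> ?T. act k t F = F'})"
    unfolding orb_def using sum.image_gen[OF card_torus(1)[where 'k = 'k and r = r], of "\<lambda>_. 1 :: nat" "\<lambda>t. act k t F"] by simp
  also have "\<dots> = card (orb r k F) * (?q - 1)" by (simp add: fib)
  finally have "(?q - 1) ^ r = card (orb r k F) * (?q - 1)" by (simp add: card_torus)
  moreover have "(?q - 1) ^ r = (?q - 1) ^ (r - 1) * (?q - 1)" using r by (simp add: power_eq_if mult.commute)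
  ultimately have "card (orb r k F) * (?q - 1) = (?q - 1) ^ (r - 1) * (?q - 1)" by simp
  moreover have "?q - 1 \<noteq> 0" using card_UNIV_field_gt1[where 'k = 'k] by simp
  ultimately show ?thesis by (meson mult_right_cancel)
qed

text \<open>\<open>tstab\<close> is constant on orbits, so the connected tuples are a disjoint union
  of orbits of equal size.\<close>

lemma card_orbits:
  assumes r: "r \<ge> 1" and fin: "finite (flag_tuples r k D :: (nat \<Rightarrow> nat \<Rightarrow> (nat \<Rightarrow> 'k::{field,finite}) set) set)"
  defines "C \<equiv> {F \<in> flag_tuples r k D :: (nat \<Rightarrow> nat \<Rightarrow> (nat \<Rightarrow> 'k) set) set. tstab r k F = {{}, {1..r}}}"
  shows "card C = (card (UNIV :: 'k set) - 1) ^ (r - 1) * card (orb r k ` C)"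
proof -
  have U: "\<Union> (orb r k ` C) = C"
  proof (intro equalityI subsetI)
    fix F' assume "F' \<in> \<Union> (orb r k ` C)"
    then obtain F t where F: "F \<in> C" "t \<in> torus r" "F' = act k t F" by (auto simp: orb_def)
    then show "F' \<in> C" using act_flag_tuples[of t r F k D] tstab_act[of t r F k D] by (simp add: C_def)
  next
    fix F assume "F \<in> C"
    then show "F \<in> \<Union> (orb r k ` C)" using orb_self[of F r k D] by (auto simp: C_def)
  qed
  have finC: "finite C" using fin by (simp add: C_def)
  have "(card (UNIV :: 'k set) - 1) ^ (r - 1) * card (orb r k ` C) = card (\<Union> (orb r k ` C))"
  proof (rule card_partition)
    show "finite (orb r k ` C)" using finC by simp
    show "finite (\<Union> (orb r k ` C))" using finC U by simp
    show "card c = (card (UNIV :: 'k set) - 1) ^ (r - 1)" if "c \<in> orb r k ` C" for c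
      using that card_orb[OF r] by (auto simp: C_def)
    show "c1 \<inter> c2 = {}" if c: "c1 \<in> orb r k ` C" "c2 \<in> orb r k ` C" "c1 \<noteq> c2" for c1 c2
    proof (rule ccontr)
      assume "c1 \<inter> c2 \<noteq> {}"
      then obtain F where f: "F \<in> c1" "F \<in> c2" by blast
      have o: "orb r k F = c" if "F \<in> c" "c \<in> orb r k ` C" for c
        using that orb_eq[of _ r k D F] by (auto simp: C_def)
      show False using o[OF f(1) c(1)] o[OF f(2) c(2)] c(3) by simp
    qed
  qed
  then show ?thesis using U by simp
qed

section \<open>Decompositions and idempotents\<close>

text \<open>Linearity on the whole function space, although only the values on some
  \<open>vec n\<close> matter. Composition and the inverses supplied by linear algebra then need no
  bookkeeping of domains.\<close>

definition lin :: "((nat \<Rightarrow> 'k::field) \<Rightarrow> (nat \<Rightarrow> 'k)) \<Rightarrow> bool" where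
  "lin f \<longleftrightarrow> (\<forall>x y. f (x + y) = f x + f y) \<and> (\<forall>c x. f (smul c x) = smul c (f x))"

lemma lin_iff_linear: "lin f \<longleftrightarrow> Vector_Spaces.linear smul smul f"
  unfolding lin_def Vector_Spaces.linear_iff using fs.vector_space_axioms by blast

lemma linI: "(\<And>x y. f (x + y) = f x + f y) \<Longrightarrow> (\<And>c x. f (smul c x) = smul c (f x)) \<Longrightarrow> lin f"
  by (simp add: lin_def)

lemma lin_add: "lin f \<Longrightarrow> f (x + y) = f x + f y"
  and lin_smul: "lin f \<Longrightarrow> f (smul c x) = smul c (f x)"
  by (simp_all add: lin_def)

lemma lin_0: "lin f \<Longrightarrow> f 0 = 0"
  using lin_smul[of f 0 0] by simp

lemma lin_diff: "lin f \<Longrightarrow> f (x - y) = f x - f y"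
  using lin_add[of f "x - y" y] by simp

lemma lin_comp: "lin f \<Longrightarrow> lin g \<Longrightarrow> lin (\<lambda>x. f (g x))"
  by (simp add: lin_def)

lemma lin_id: "lin (\<lambda>x. x)" and lin_zero: "lin (\<lambda>x. 0)"
  by (simp_all add: lin_def)

lemma lin_scale: "lin (smul c)"
  by (auto simp: lin_def fun_eq_iff algebra_simps)

lemma lin_times: "lin ((*) t)"
  by (auto simp: lin_def fun_eq_iff algebra_simps)

lemma lin_left_inverse:
  assumes "lin f" "fs.subspace S" "inj_on f S"
  obtains g where "lin g" "range g \<subseteq> S" "\<And>v. v \<in> S \<Longrightarrow> g (f v) = v"
  using fsp.linear_exists_left_inverse_on[of f S] assms unfolding lin_iff_linear by blast

lemma lin_right_inverse:
  assumes "lin f" "fs.subspace S"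
  obtains g where "lin g" "range g \<subseteq> S" "\<And>v. v \<in> f ` S \<Longrightarrow> f (g v) = v"
  using fsp.linear_exists_right_inverse_on[of f S] assms unfolding lin_iff_linear by blast

lemma lin_inj_on:
  assumes "lin f" "fs.subspace S" "\<And>x. x \<in> S \<Longrightarrow> f x = 0 \<Longrightarrow> x = 0"
  shows "inj_on f S"
proof (rule inj_onI)
  fix x y assume xy: "x \<in> S" "y \<in> S" "f x = f y"
  have "x - y = 0" using assms(3)[of "x - y"] fs.subspace_diff[OF assms(2) xy(1,2)] xy(3) lin_diff[OF assms(1), of x y] by simp
  then show "x = y" by simp
qed

lemma lin_image_subspace:
  assumes "lin f" "fs.subspace S"
  shows "fs.subspace (f ` S)"
proof (rule fs.subspaceI)
  show "0 \<in> f ` S" using lin_0[OF assms(1)] fs.subspace_0[OF assms(2)] by (metis image_eqI)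
  show "x + y \<in> f ` S" if xy: "x \<in> f ` S" "y \<in> f ` S" for x y
  proof -
    obtain a b where "x = f a" "y = f b" "a \<in> S" "b \<in> S" using xy by blast
    then show ?thesis using fs.subspace_add[OF assms(2)] lin_add[OF assms(1)] by (metis image_eqI)
  qed
  show "smul c x \<in> f ` S" if x: "x \<in> f ` S" for c x
  proof -
    obtain a where "x = f a" "a \<in> S" using x by blast
    then show ?thesis using fs.subspace_scale[OF assms(2)] lin_smul[OF assms(1)] by (metis image_eqI)
  qed
qed

section \<open>Dictionary between boxed matrices and linear maps\<close>

lemma vec_eq: "vec n = supp_on {..<n}"
  by (auto simp: vec_def supp_on_def)

lemma subspace_vec: "fs.subspace (vec n)"
  by (simp add: vec_eq subspace_supp_on)

lemma vec_0 [simp]: "0 \<in> vec n"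
  and vec_add [simp]: "x \<in> vec n \<Longrightarrow> y \<in> vec n \<Longrightarrow> x + y \<in> vec n"
  and vec_diff [simp]: "x \<in> vec n \<Longrightarrow> y \<in> vec n \<Longrightarrow> x - y \<in> vec n"
  and vec_smul [simp]: "x \<in> vec n \<Longrightarrow> smul c x \<in> vec n"
  by (simp_all add: vec_def)

lemma subsp_iff: "subsp n U \<longleftrightarrow> U \<subseteq> vec n \<and> fs.subspace U"
  unfolding subsp_def fs.subspace_def by (auto simp: zero_fun_def plus_fun_def smul_def)

lemma lin_mat_vec: "lin (mat_vec n M)"
  by (auto simp: lin_def mat_vec_def fun_eq_iff algebra_simps sum.distrib sum_distrib_left)

lemma mat_vec_vec: "M \<in> mat_box m n \<Longrightarrow> mat_vec n M x \<in> vec m"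
  by (auto simp: mat_box_def vec_def mat_vec_def)

lemma mat_vec_mult: "mat_vec n (mat_mult l A B) x = mat_vec l A (mat_vec n B x)"
  unfolding mat_vec_def mat_mult_def
  by (rule ext) (simp add: sum_distrib_left sum_distrib_right mult.assoc sum.swap[of _ "{..<l}"])

lemma mat_vec_id: "x \<in> vec n \<Longrightarrow> mat_vec n (id_mat n) x = (x :: nat \<Rightarrow> 'k::comm_ring_1)"
proof
  fix i assume x: "x \<in> vec n"
  have "mat_vec n (id_mat n) x i = (\<Sum>j<n. if i = j then (if i < n then x i else 0) else 0)"
    unfolding mat_vec_def id_mat_def by (rule sum.cong) auto
  also have "\<dots> = x i" using x by (auto simp: sum.delta' vec_def)
  finally show "mat_vec n (id_mat n) x i = x i" .
qed

lemma mat_vec_zero: "mat_vec n (\<lambda>_ _. 0) x = 0"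
  by (simp add: mat_vec_def fun_eq_iff)

lemma unitv_vec: "b < n \<Longrightarrow> unitv b \<in> vec n"
  by (auto simp: vec_def unitv_def)

lemma mat_vec_unitv: "b < n \<Longrightarrow> mat_vec n A (unitv b) = (\<lambda>a. A a b)"
  by (auto simp: mat_vec_def unitv_def fun_eq_iff if_distrib[of "\<lambda>c. _ * c"] sum.delta cong: if_cong)

lemma mat_eqI:
  assumes "A \<in> mat_box m n" "B \<in> mat_box m n" "\<And>x. x \<in> vec n \<Longrightarrow> mat_vec n A x = mat_vec n B x"
  shows "A = (B :: nat \<Rightarrow> nat \<Rightarrow> 'k::field)"
proof (intro ext)
  fix a b
  show "A a b = B a b"
  proof (cases "b < n")
    case True
    have "mat_vec n A (unitv b) a = mat_vec n B (unitv b) a" using assms(3)[OF unitv_vec[OF True]] by simp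
    then show ?thesis by (simp add: mat_vec_unitv[OF True])
  next
    case False
    then show ?thesis using assms(1,2) by (simp add: mat_box_def)
  qed
qed

lemma mat_mult_box: "A \<in> mat_box m l \<Longrightarrow> B \<in> mat_box l n \<Longrightarrow> mat_mult l A B \<in> mat_box m n"
  by (auto simp: mat_box_def mat_mult_def)

lemma id_mat_box: "id_mat n \<in> mat_box n n"
  by (auto simp: mat_box_def id_mat_def)

definition mat_of :: "nat \<Rightarrow> nat \<Rightarrow> ((nat \<Rightarrow> 'k::field) \<Rightarrow> (nat \<Rightarrow> 'k)) \<Rightarrow> nat \<Rightarrow> nat \<Rightarrow> 'k" where
  "mat_of m n h = (\<lambda>a b. if a < m \<and> b < n then h (unitv b) a else 0)"

lemma mat_of_box: "mat_of m n h \<in> mat_box m n"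
  by (auto simp: mat_of_def mat_box_def)

lemma vec_sum_unitv: "x \<in> vec n \<Longrightarrow> x = (\<Sum>b<n. smul (x b) (unitv b))"
  by (auto simp: fun_eq_iff sum_apply unitv_def vec_def if_distrib[of "\<lambda>c. _ * c"] sum.delta cong: if_cong)

text \<open>Additivity is asked only on \<open>vec n\<close>: the projection onto a direct summand,
  obtained by choice, is linear only there.\<close>

lemma mat_vec_mat_of:
  assumes add: "\<And>x y. x \<in> vec n \<Longrightarrow> y \<in> vec n \<Longrightarrow> h (x + y) = h x + h y"
    and sc: "\<And>c x. x \<in> vec n \<Longrightarrow> h (smul c x) = smul c (h x)"
    and rng: "\<And>x. x \<in> vec n \<Longrightarrow> h x \<in> vec m" and x: "x \<in> vec n"
  shows "mat_vec n (mat_of m n h) x = h x"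
proof -
  have h0: "h 0 = 0" using sc[OF vec_0, of 0] by simp
  have sm: "h (\<Sum>b\<in>B. smul (x b) (unitv b)) = (\<Sum>b\<in>B. smul (x b) (h (unitv b)))"
    if "finite B" "B \<subseteq> {..<n}" for B
    using that
  proof induction
    case (insert b B)
    have 1: "smul (x b) (unitv b) \<in> vec n" "unitv b \<in> vec n"
      using insert by (auto intro: vec_smul unitv_vec)
    have 2: "(\<Sum>b\<in>B. smul (x b) (unitv b)) \<in> vec n"
      using insert by (auto intro!: fs.subspace_sum[OF subspace_vec] vec_smul unitv_vec)
    have "B \<subseteq> {..<n}" using insert.prems by blast
    then show ?case unfolding sum.insert[OF insert.hyps] add[OF 1(1) 2] sc[OF 1(2)] by (simp only: insert.IH)
  qed (simp add: h0)
  have "h x = h (\<Sum>b<n. smul (x b) (unitv b))" using vec_sum_unitv[OF x] by simp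
  also have "\<dots> = (\<Sum>b<n. smul (x b) (h (unitv b)))" by (rule sm) auto
  also have "\<dots> = mat_vec n (mat_of m n h) x"
  proof
    fix a
    show "(\<Sum>b<n. smul (x b) (h (unitv b))) a = mat_vec n (mat_of m n h) x a"
    proof (cases "a < m")
      case True
      then show ?thesis by (simp add: sum_apply mat_vec_def mat_of_def mult.commute)
    next
      case False
      have "h (unitv b) a = 0" if "b < n" for b using rng[OF unitv_vec[OF that]] False by (simp add: vec_def)
      then show ?thesis using False by (simp add: sum_apply mat_vec_def mat_of_def)
    qed
  qed
  finally show ?thesis by simp
qed

lemma mat_vec_mat_of_lin:
  assumes "lin h" "\<And>x. x \<in> vec n \<Longrightarrow> h x \<in> vec m" "x \<in> vec n"
  shows "mat_vec n (mat_of m n h) x = h x"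
  by (rule mat_vec_mat_of) (use assms lin_add lin_smul in auto)

section \<open>Morphisms and nontrivial idempotent endomorphisms\<close>

definition hom_rep :: "'v set \<Rightarrow> ('v \<times> 'v) set \<Rightarrow> ('v \<Rightarrow> nat) \<Rightarrow> ('v \<times> 'v \<Rightarrow> nat \<Rightarrow> nat \<Rightarrow> 'k::field)
    \<Rightarrow> ('v \<times> 'v \<Rightarrow> nat \<Rightarrow> nat \<Rightarrow> 'k) \<Rightarrow> ('v \<Rightarrow> (nat \<Rightarrow> 'k) \<Rightarrow> (nat \<Rightarrow> 'k)) \<Rightarrow> bool" where
  "hom_rep V A d M N E \<longleftrightarrow> (\<forall>x\<in>V. lin (E x) \<and> (\<forall>v\<in>vec (d x). E x v \<in> vec (d x))) \<and>
     (\<forall>x y. (x, y) \<in> A \<longrightarrow> (\<forall>v\<in>vec (d x).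
        E y (mat_vec (d x) (M (x, y)) v) = mat_vec (d x) (N (x, y)) (E x v)))"

definition idem_rep :: "'v set \<Rightarrow> ('v \<times> 'v) set \<Rightarrow> ('v \<Rightarrow> nat) \<Rightarrow> ('v \<times> 'v \<Rightarrow> nat \<Rightarrow> nat \<Rightarrow> 'k::field)
    \<Rightarrow> ('v \<Rightarrow> (nat \<Rightarrow> 'k) \<Rightarrow> (nat \<Rightarrow> 'k)) \<Rightarrow> bool" where
  "idem_rep V A d M E \<longleftrightarrow> hom_rep V A d M M E \<and> (\<forall>x\<in>V. \<forall>v\<in>vec (d x). E x (E x v) = E x v) \<and>
     (\<exists>x\<in>V. \<exists>v\<in>vec (d x). E x v \<noteq> 0) \<and> (\<exists>x\<in>V. \<exists>v\<in>vec (d x). E x v \<noteq> v)"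

text \<open>The same notion as \<open>idem_rep\<close> on the level of matrices. This form is needed
  because extension of scalars acts on entries.\<close>

definition idem_mat :: "'v set \<Rightarrow> ('v \<times> 'v) set \<Rightarrow> ('v \<Rightarrow> nat) \<Rightarrow> ('v \<times> 'v \<Rightarrow> nat \<Rightarrow> nat \<Rightarrow> 'k::field)
    \<Rightarrow> ('v \<Rightarrow> nat \<Rightarrow> nat \<Rightarrow> 'k) \<Rightarrow> bool" where
  "idem_mat V A d M e \<longleftrightarrow> (\<forall>x\<in>V. e x \<in> mat_box (d x) (d x) \<and> mat_mult (d x) (e x) (e x) = e x) \<and>
     (\<forall>x y. (x, y) \<in> A \<longrightarrow> mat_mult (d y) (e y) (M (x, y)) = mat_mult (d x) (M (x, y)) (e x)) \<and>
     (\<exists>x\<in>V. e x \<noteq> (\<lambda>_ _. 0)) \<and> (\<exists>x\<in>V. e x \<noteq> id_mat (d x))"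

lemma hom_rep_mat:
  assumes A: "A \<subseteq> V \<times> V" and M: "M \<in> reps A d" and N: "N \<in> reps A d"
    and e: "\<And>x. x \<in> V \<Longrightarrow> e x \<in> mat_box (d x) (d x)"
  shows "hom_rep V A d M N (\<lambda>x. mat_vec (d x) (e x)) \<longleftrightarrow>
     (\<forall>x y. (x, y) \<in> A \<longrightarrow> mat_mult (d y) (e y) (M (x, y)) = mat_mult (d x) (N (x, y)) (e x))"
proof -
  have "(\<forall>v\<in>vec (d x). mat_vec (d y) (e y) (mat_vec (d x) (M (x, y)) v) = mat_vec (d x) (N (x, y)) (mat_vec (d x) (e x) v))
     \<longleftrightarrow> mat_mult (d y) (e y) (M (x, y)) = mat_mult (d x) (N (x, y)) (e x)" if a: "(x, y) \<in> A" for x y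
  proof
    have xy: "x \<in> V" "y \<in> V" using a A by auto
    have b: "M (x, y) \<in> mat_box (d y) (d x)" "N (x, y) \<in> mat_box (d y) (d x)" using M N a by (auto simp: reps_def)
    assume v: "\<forall>v\<in>vec (d x). mat_vec (d y) (e y) (mat_vec (d x) (M (x, y)) v) = mat_vec (d x) (N (x, y)) (mat_vec (d x) (e x) v)"
    show "mat_mult (d y) (e y) (M (x, y)) = mat_mult (d x) (N (x, y)) (e x)"
      by (rule mat_eqI[of _ "d y" "d x"]) (use v xy b e in \<open>auto simp: mat_vec_mult intro: mat_mult_box\<close>)
  next
    assume eq: "mat_mult (d y) (e y) (M (x, y)) = mat_mult (d x) (N (x, y)) (e x)"
    show "\<forall>v\<in>vec (d x). mat_vec (d y) (e y) (mat_vec (d x) (M (x, y)) v) = mat_vec (d x) (N (x, y)) (mat_vec (d x) (e x) v)"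
      unfolding mat_vec_mult[symmetric] eq by simp
  qed
  then show ?thesis using e unfolding hom_rep_def by (auto simp: lin_mat_vec mat_vec_vec)
qed

lemma idem_rep_mat:
  assumes A: "A \<subseteq> V \<times> V" and M: "M \<in> reps A d" and e: "\<And>x. x \<in> V \<Longrightarrow> e x \<in> mat_box (d x) (d x)"
  shows "idem_rep V A d M (\<lambda>x. mat_vec (d x) (e x)) \<longleftrightarrow> idem_mat V A d M e"
proof -
  have 1: "(\<forall>v\<in>vec (d x). mat_vec (d x) (e x) (mat_vec (d x) (e x) v) = mat_vec (d x) (e x) v) \<longleftrightarrow>
     mat_mult (d x) (e x) (e x) = e x" if x: "x \<in> V" for x
  proof
    assume v: "\<forall>v\<in>vec (d x). mat_vec (d x) (e x) (mat_vec (d x) (e x) v) = mat_vec (d x) (e x) v"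
    show "mat_mult (d x) (e x) (e x) = e x"
      by (rule mat_eqI[of _ "d x" "d x"]) (use v e[OF x] in \<open>auto simp: mat_vec_mult intro: mat_mult_box\<close>)
  next
    assume "mat_mult (d x) (e x) (e x) = e x"
    then show "\<forall>v\<in>vec (d x). mat_vec (d x) (e x) (mat_vec (d x) (e x) v) = mat_vec (d x) (e x) v"
      unfolding mat_vec_mult[symmetric] by simp
  qed
  have 2: "(\<forall>v\<in>vec (d x). mat_vec (d x) (e x) v = 0) \<longleftrightarrow> e x = (\<lambda>_ _. 0)" if x: "x \<in> V" for x
  proof
    assume v: "\<forall>v\<in>vec (d x). mat_vec (d x) (e x) v = 0"
    show "e x = (\<lambda>_ _. 0)"
      by (rule mat_eqI[of _ "d x" "d x"]) (use v e[OF x] in \<open>auto simp: mat_vec_zero mat_box_def\<close>)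
  qed (simp add: mat_vec_zero)
  have 3: "(\<forall>v\<in>vec (d x). mat_vec (d x) (e x) v = v) \<longleftrightarrow> e x = id_mat (d x)" if x: "x \<in> V" for x
  proof
    assume v: "\<forall>v\<in>vec (d x). mat_vec (d x) (e x) v = v"
    show "e x = id_mat (d x)"
      by (rule mat_eqI[of _ "d x" "d x"]) (use v e[OF x] in \<open>auto simp: mat_vec_id id_mat_box\<close>)
  qed (simp add: mat_vec_id)
  show ?thesis
  proof -
    have a: "(\<forall>x\<in>V. \<forall>v\<in>vec (d x). mat_vec (d x) (e x) (mat_vec (d x) (e x) v) = mat_vec (d x) (e x) v)
        \<longleftrightarrow> (\<forall>x\<in>V. mat_mult (d x) (e x) (e x) = e x)" by (intro ball_cong refl 1)
    have b: "(\<exists>x\<in>V. \<exists>v\<in>vec (d x). mat_vec (d x) (e x) v \<noteq> 0) \<longleftrightarrow> (\<exists>x\<in>V. e x \<noteq> (\<lambda>_ _. 0))"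
      by (intro bex_cong refl) (simp flip: 2)
    have c: "(\<exists>x\<in>V. \<exists>v\<in>vec (d x). mat_vec (d x) (e x) v \<noteq> v) \<longleftrightarrow> (\<exists>x\<in>V. e x \<noteq> id_mat (d x))"
      by (intro bex_cong refl) (simp flip: 3)
    have h: "hom_rep V A d M M (\<lambda>x. mat_vec (d x) (e x)) \<longleftrightarrow>
     (\<forall>x y. (x, y) \<in> A \<longrightarrow> mat_mult (d y) (e y) (M (x, y)) = mat_mult (d x) (M (x, y)) (e x))"
      by (rule hom_rep_mat[OF A M M]) (rule e)
    show ?thesis unfolding idem_rep_def idem_mat_def a b c h using e by auto
  qed
qed

lemma hom_rep_mat_of:
  assumes A: "A \<subseteq> V \<times> V" and M: "M \<in> reps A d" and E: "hom_rep V A d M N E"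
  shows "hom_rep V A d M N (\<lambda>x. mat_vec (d x) (mat_of (d x) (d x) (E x)))"
    and "\<And>x v. x \<in> V \<Longrightarrow> v \<in> vec (d x) \<Longrightarrow> mat_vec (d x) (mat_of (d x) (d x) (E x)) v = E x v"
proof -
  show eq: "mat_vec (d x) (mat_of (d x) (d x) (E x)) v = E x v" if "x \<in> V" "v \<in> vec (d x)" for x v
    by (rule mat_vec_mat_of_lin) (use that E in \<open>auto simp: hom_rep_def\<close>)
  have "E y (mat_vec (d x) (M (x, y)) v) = mat_vec (d x) (N (x, y)) (E x v)" if "(x, y) \<in> A" "v \<in> vec (d x)" for x y v
    using that E unfolding hom_rep_def by blast
  moreover have "x \<in> V" "y \<in> V" "mat_vec (d x) (M (x, y)) v \<in> vec (d y)" if "(x, y) \<in> A" for x y v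
    using that A M by (auto simp: reps_def intro: mat_vec_vec)
  moreover have "E x v \<in> vec (d x)" if "x \<in> V" "v \<in> vec (d x)" for x v
    using that E by (simp add: hom_rep_def)
  ultimately show "hom_rep V A d M N (\<lambda>x. mat_vec (d x) (mat_of (d x) (d x) (E x)))"
    unfolding hom_rep_def by (auto simp: lin_mat_vec eq intro: mat_vec_vec mat_of_box)
qed

lemma idem_mat_of_idem_rep:
  fixes M :: "'v \<times> 'v \<Rightarrow> nat \<Rightarrow> nat \<Rightarrow> 'k::field"
  assumes A: "A \<subseteq> V \<times> V" and M: "M \<in> reps A d" and E: "idem_rep V A d M E"
  shows "idem_mat V A d M (\<lambda>x. mat_of (d x) (d x) (E x))"
proof -
  have h: "hom_rep V A d M M E" using E by (simp add: idem_rep_def)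
  note eq = hom_rep_mat_of(2)[OF A M h]
  have rng: "E x v \<in> vec (d x)" if "x \<in> V" "v \<in> vec (d x)" for x v using h that by (simp add: hom_rep_def)
  have "idem_rep V A d M (\<lambda>x. mat_vec (d x) (mat_of (d x) (d x) (E x)))"
    unfolding idem_rep_def
  proof (intro conjI ballI)
    show "hom_rep V A d M M (\<lambda>x. mat_vec (d x) (mat_of (d x) (d x) (E x)))" by (rule hom_rep_mat_of(1)[OF A M h])
  next
    fix x and v :: "nat \<Rightarrow> 'k" assume x: "x \<in> V" "v \<in> vec (d x)"
    then have "E x (E x v) = E x v" using E by (simp add: idem_rep_def)
    then show "mat_vec (d x) (mat_of (d x) (d x) (E x)) (mat_vec (d x) (mat_of (d x) (d x) (E x)) v)
        = mat_vec (d x) (mat_of (d x) (d x) (E x)) v" using x by (simp add: eq rng)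
  next
    obtain x v where "x \<in> V" "v \<in> vec (d x)" "E x v \<noteq> 0" using E by (auto simp: idem_rep_def)
    then show "\<exists>x\<in>V. \<exists>v\<in>vec (d x). mat_vec (d x) (mat_of (d x) (d x) (E x)) v \<noteq> 0"
      by (intro bexI[of _ x] bexI[of _ v]) (simp_all add: eq)
  next
    obtain x v where "x \<in> V" "v \<in> vec (d x)" "E x v \<noteq> v" using E by (auto simp: idem_rep_def)
    then show "\<exists>x\<in>V. \<exists>v\<in>vec (d x). mat_vec (d x) (mat_of (d x) (d x) (E x)) v \<noteq> v"
      by (intro bexI[of _ x] bexI[of _ v]) (simp_all add: eq)
  qed
  then show ?thesis using idem_rep_mat[OF A M, of "\<lambda>x. mat_of (d x) (d x) (E x)"] mat_of_box by blast
qed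

text \<open>An idempotent splits each space into its fixed vectors and its kernel; conversely a
  direct sum decomposition yields the projection onto \<open>U\<close> along \<open>W\<close>, which
  commutes with the arrows because both summands are subrepresentations.\<close>

lemma decomposable_iff_idem_mat:
  fixes M :: "'v \<times> 'v \<Rightarrow> nat \<Rightarrow> nat \<Rightarrow> 'k::field"
  assumes A: "A \<subseteq> V \<times> V" and M: "M \<in> reps A d"
  shows "decomposable V A d M \<longleftrightarrow> (\<exists>e. idem_mat V A d M e)"
proof
  assume "\<exists>e. idem_mat V A d M e"
  then obtain e where e: "idem_mat V A d M e" by blast
  define E where "E x = mat_vec (d x) (e x)" for x
  have E: "idem_rep V A d M E"
    unfolding E_def using e by (subst idem_rep_mat[OF A M]) (auto simp: idem_mat_def)
  then have h: "\<And>x. x \<in> V \<Longrightarrow> lin (E x)" "\<And>x v. x \<in> V \<Longrightarrow> v \<in> vec (d x) \<Longrightarrow> E x v \<in> vec (d x)"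
     "\<And>x y v. (x, y) \<in> A \<Longrightarrow> v \<in> vec (d x) \<Longrightarrow> E y (mat_vec (d x) (M (x, y)) v) = mat_vec (d x) (M (x, y)) (E x v)"
     "\<And>x v. x \<in> V \<Longrightarrow> v \<in> vec (d x) \<Longrightarrow> E x (E x v) = E x v"
     "\<exists>x\<in>V. \<exists>v\<in>vec (d x). E x v \<noteq> 0" "\<exists>x\<in>V. \<exists>v\<in>vec (d x). E x v \<noteq> v"
    unfolding idem_rep_def hom_rep_def by blast+
  define U where "U x = {v \<in> vec (d x). E x v = v}" for x
  define W where "W x = {v \<in> vec (d x). E x v = 0}" for x
  have Mv: "mat_vec (d x) (M (x, y)) v \<in> vec (d y)" if "(x, y) \<in> A" for x y v
    using that M by (auto simp: reps_def intro: mat_vec_vec)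
  have sum: "{(\<lambda>i. u i + w i) | u w. u \<in> U x \<and> w \<in> W x} = vec (d x)" if x: "x \<in> V" for x
  proof (intro equalityI subsetI)
    fix v assume "v \<in> {(\<lambda>i. u i + w i) | u w. u \<in> U x \<and> w \<in> W x}"
    then obtain u w where "v = u + w" "u \<in> vec (d x)" "w \<in> vec (d x)" by (auto simp: U_def W_def plus_fun_def)
    then show "v \<in> vec (d x)" using vec_add by blast
  next
    fix v :: "nat \<Rightarrow> 'k" assume v: "v \<in> vec (d x)"
    have "E x v \<in> U x" using h(2,4) x v by (simp add: U_def)
    moreover have "v - E x v \<in> W x"
      using h(2,4) x v vec_diff lin_diff[OF h(1)[OF x]] by (simp add: W_def)
    moreover have "v = (\<lambda>i. E x v i + (v - E x v) i)" by (simp add: fun_eq_iff)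
    ultimately show "v \<in> {(\<lambda>i. u i + w i) | u w. u \<in> U x \<and> w \<in> W x}" by blast
  qed
  have sub: "fs.subspace (U x)" "fs.subspace (W x)" if x: "x \<in> V" for x
    unfolding U_def W_def
    by (rule fs.subspaceI; simp add: lin_0[OF h(1)[OF x]] lin_add[OF h(1)[OF x]] lin_smul[OF h(1)[OF x]])+
  show "decomposable V A d M" unfolding decomposable_def
  proof (intro exI conjI ballI allI impI)
    fix x assume x: "x \<in> V"
    show "subsp (d x) (U x)" "subsp (d x) (W x)" using sub[OF x] by (auto simp: subsp_iff U_def W_def)
    show "U x \<inter> W x = {\<lambda>_. 0}"
      using fs.subspace_0[OF sub(1)[OF x]] fs.subspace_0[OF sub(2)[OF x]]
      by (auto simp: U_def W_def zero_fun_def)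
    show "{(\<lambda>i. u i + w i) | u w. u \<in> U x \<and> w \<in> W x} = vec (d x)" by (rule sum[OF x])
  next
    fix x y u assume "(x, y) \<in> A" "u \<in> U x"
    then show "mat_vec (d x) (M (x, y)) u \<in> U y" using h(3) Mv by (simp add: U_def)
  next
    fix x y u assume "(x, y) \<in> A" "u \<in> W x"
    then show "mat_vec (d x) (M (x, y)) u \<in> W y" using h(3) Mv lin_0[OF lin_mat_vec] by (simp add: W_def)
  next
    obtain x v where "x \<in> V" "v \<in> vec (d x)" "E x v \<noteq> 0" using h(5) by blast
    then have "x \<in> V" "E x v \<in> U x" "E x v \<noteq> 0" using h(2,4) by (auto simp: U_def)
    then show "\<exists>x\<in>V. U x \<noteq> {\<lambda>_. 0}" by (auto simp: zero_fun_def)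
  next
    obtain x v where "x \<in> V" "v \<in> vec (d x)" "E x v \<noteq> v" using h(6) by blast
    then have "x \<in> V" "v - E x v \<in> W x" "v - E x v \<noteq> 0"
      using h(2,4) vec_diff lin_diff[OF h(1)] by (auto simp: W_def)
    then have "\<exists>x\<in>V. W x \<noteq> {0}" by blast
    then show "\<exists>x\<in>V. W x \<noteq> {\<lambda>_. 0}" unfolding zero_fun_def .
  qed
next
  assume "decomposable V A d M"
  then obtain U W where D1: "\<forall>x\<in>V. subsp (d x) (U x) \<and> subsp (d x) (W x) \<and> U x \<inter> W x = {\<lambda>_. 0} \<and>
         {(\<lambda>i. u i + w i) | u w. u \<in> U x \<and> w \<in> W x} = vec (d x)"
    and D2: "\<forall>x y. (x, y) \<in> A \<longrightarrow> (\<forall>u\<in>U x. mat_vec (d x) (M (x, y)) u \<in> U y) \<and>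
                              (\<forall>w\<in>W x. mat_vec (d x) (M (x, y)) w \<in> W y)"
    and D3: "\<exists>x\<in>V. U x \<noteq> {\<lambda>_. 0}" and D4: "\<exists>x\<in>V. W x \<noteq> {\<lambda>_. 0}"
    unfolding decomposable_def by (elim exE conjE) (erule (3) that)
  have UW: "\<And>x. x \<in> V \<Longrightarrow> fs.subspace (U x) \<and> fs.subspace (W x) \<and> U x \<subseteq> vec (d x) \<and> W x \<subseteq> vec (d x)"
     "\<And>x. x \<in> V \<Longrightarrow> U x \<inter> W x = {0}"
     "\<And>x. x \<in> V \<Longrightarrow> {u + w | u w. u \<in> U x \<and> w \<in> W x} = vec (d x)"
     "\<And>x y u. (x, y) \<in> A \<Longrightarrow> u \<in> U x \<Longrightarrow> mat_vec (d x) (M (x, y)) u \<in> U y"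
     "\<And>x y u. (x, y) \<in> A \<Longrightarrow> u \<in> W x \<Longrightarrow> mat_vec (d x) (M (x, y)) u \<in> W y"
     "\<exists>x\<in>V. U x \<noteq> {0}" "\<exists>x\<in>V. W x \<noteq> {0}"
    using D1 D2 D3 D4 by (simp_all add: subsp_iff zero_fun_def plus_fun_def)
  have uniq: "u = u'" if x: "x \<in> V" and "u \<in> U x" "u' \<in> U x" "w \<in> W x" "w' \<in> W x" "u + w = u' + w'" for x u u' w w'
  proof -
    have "u - u' = w' - w" using that(6) by (simp add: algebra_simps)
    moreover have "u - u' \<in> U x" "w' - w \<in> W x" using that UW(1)[OF x] fs.subspace_diff by blast+
    ultimately have "u - u' \<in> U x \<inter> W x" by simp
    then show ?thesis using UW(2)[OF x] by simp
  qed
  have sU: "fs.subspace (U x)" and sW: "fs.subspace (W x)" if "x \<in> V" for x using UW(1)[OF that] by auto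
  \<comment> \<open>The \<open>U\<close>-component of \<open>v\<close>, unique for \<open>v\<close>
    in \<open>vec (d x)\<close>; additivity, scaling and compatibility with arrows are then
    instances of uniqueness.\<close>
  define P where "P x v = (SOME u. u \<in> U x \<and> v - u \<in> W x)" for x v
  have P: "P x v \<in> U x" "v - P x v \<in> W x" if x: "x \<in> V" and v: "v \<in> vec (d x)" for x v
  proof -
    have "v \<in> {u + w | u w. u \<in> U x \<and> w \<in> W x}" using UW(3)[OF x] v by simp
    then obtain u w where "v = u + w" "u \<in> U x" "w \<in> W x" by blast
    then have "u \<in> U x \<and> v - u \<in> W x" by simp
    then have "P x v \<in> U x \<and> v - P x v \<in> W x" unfolding P_def by (rule someI[where P = "\<lambda>u. u \<in> U x \<and> v - u \<in> W x"])
    then show "P x v \<in> U x" "v - P x v \<in> W x" by auto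
  qed
  have Peq: "P x v = u" if x: "x \<in> V" and v: "v \<in> vec (d x)" and u: "u \<in> U x" "v - u \<in> W x" for x v u
    by (rule uniq[OF x P(1)[OF x v] u(1) P(2)[OF x v] u(2)]) simp
  have Pv: "P x v \<in> vec (d x)" if "x \<in> V" "v \<in> vec (d x)" for x v using P[OF that] UW(1) that by blast
  have Padd: "P x (v + v') = P x v + P x v'" if x: "x \<in> V" and v: "v \<in> vec (d x)" "v' \<in> vec (d x)" for x v v'
  proof (rule Peq[OF x])
    show "v + v' \<in> vec (d x)" using v vec_add by blast
    show "P x v + P x v' \<in> U x" by (rule fs.subspace_add[OF sU[OF x] P(1)[OF x v(1)] P(1)[OF x v(2)]])
    have "(v - P x v) + (v' - P x v') \<in> W x" by (rule fs.subspace_add[OF sW[OF x] P(2)[OF x v(1)] P(2)[OF x v(2)]])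
    then show "v + v' - (P x v + P x v') \<in> W x" by (simp add: algebra_simps)
  qed
  have Psc: "P x (smul c v) = smul c (P x v)" if x: "x \<in> V" and v: "v \<in> vec (d x)" for x v c
  proof (rule Peq[OF x])
    show "smul c v \<in> vec (d x)" using v vec_smul by blast
    show "smul c (P x v) \<in> U x" by (rule fs.subspace_scale[OF sU[OF x] P(1)[OF x v]])
    have "smul c (v - P x v) \<in> W x" by (rule fs.subspace_scale[OF sW[OF x] P(2)[OF x v]])
    then show "smul c v - smul c (P x v) \<in> W x" by (simp add: fs.scale_right_diff_distrib)
  qed
  define e where "e x = mat_of (d x) (d x) (P x)" for x
  have eP: "mat_vec (d x) (e x) v = P x v" if "x \<in> V" "v \<in> vec (d x)" for x v
    unfolding e_def by (rule mat_vec_mat_of) (use that Padd Psc Pv in auto)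
  have Mv: "mat_vec (d x) (M (x, y)) v \<in> vec (d y)" if "(x, y) \<in> A" for x y v
    using that M by (auto simp: reps_def intro: mat_vec_vec)
  have "idem_rep V A d M (\<lambda>x. mat_vec (d x) (e x))"
    unfolding idem_rep_def hom_rep_def
  proof (intro conjI ballI allI impI)
    fix x y and v :: "nat \<Rightarrow> 'k" assume a: "(x, y) \<in> A" and v: "v \<in> vec (d x)"
    have xy: "x \<in> V" "y \<in> V" using a A by auto
    have "P y (mat_vec (d x) (M (x, y)) v) = mat_vec (d x) (M (x, y)) (P x v)"
    proof (rule Peq[OF xy(2) Mv[OF a]])
      show "mat_vec (d x) (M (x, y)) (P x v) \<in> U y" using UW(4)[OF a] P[OF xy(1) v] by blast
      have "mat_vec (d x) (M (x, y)) (v - P x v) \<in> W y" using UW(5)[OF a] P[OF xy(1) v] by blast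
      then show "mat_vec (d x) (M (x, y)) v - mat_vec (d x) (M (x, y)) (P x v) \<in> W y"
        by (simp add: lin_diff[OF lin_mat_vec])
    qed
    then show "mat_vec (d y) (e y) (mat_vec (d x) (M (x, y)) v) = mat_vec (d x) (M (x, y)) (mat_vec (d x) (e x) v)"
      using eP xy v Mv[OF a] by simp
  next
    fix x and v :: "nat \<Rightarrow> 'k" assume x: "x \<in> V" and v: "v \<in> vec (d x)"
    have "P x (P x v) = P x v"
      by (rule Peq[OF x Pv[OF x v] P(1)[OF x v]]) (simp add: fs.subspace_0[OF sW[OF x]])
    then show "mat_vec (d x) (e x) (mat_vec (d x) (e x) v) = mat_vec (d x) (e x) v"
      using eP x v Pv by simp
  next
    obtain x where x: "x \<in> V" "U x \<noteq> {0}" using UW(6) by blast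
    then obtain u where u: "u \<in> U x" "u \<noteq> 0" using fs.subspace_0[OF sU[OF x(1)]] by blast
    have uv: "u \<in> vec (d x)" using u UW(1)[OF x(1)] by blast
    have "P x u = u" by (rule Peq[OF x(1) uv u(1)]) (simp add: fs.subspace_0[OF sW[OF x(1)]])
    then show "\<exists>x\<in>V. \<exists>v\<in>vec (d x). mat_vec (d x) (e x) v \<noteq> 0" using x(1) uv u(2) eP by metis
  next
    obtain x where x: "x \<in> V" "W x \<noteq> {0}" using UW(7) by blast
    then obtain u where u: "u \<in> W x" "u \<noteq> 0" using fs.subspace_0[OF sW[OF x(1)]] by blast
    have uv: "u \<in> vec (d x)" using u UW(1)[OF x(1)] by blast
    have "P x u = 0" by (rule Peq[OF x(1) uv]) (simp_all add: u fs.subspace_0[OF sU[OF x(1)]])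
    then show "\<exists>x\<in>V. \<exists>v\<in>vec (d x). mat_vec (d x) (e x) v \<noteq> v" using x(1) uv u(2) eP by metis
  qed (auto simp: lin_mat_vec e_def intro: mat_vec_vec mat_of_box)
  then show "\<exists>e. idem_mat V A d M e"
    by (subst (asm) idem_rep_mat[OF A M]) (auto simp: e_def mat_of_box)
qed

section \<open>Descent from the algebraic closure\<close>

lemma mat_mult_to_ac:
  "mat_mult n (\<lambda>i j. to_ac (A i j)) (\<lambda>i j. to_ac (B i j)) = (\<lambda>i j. to_ac (mat_mult n A B i j))"
  by (simp add: mat_mult_def to_ac_sum)

lemma to_ac_mat_eq: "(\<lambda>i j. to_ac (A i j)) = (\<lambda>i j. to_ac (B i j)) \<longleftrightarrow> A = B"
  by (auto simp: fun_eq_iff)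

lemma idem_mat_to_ac:
  "idem_mat V A d (\<lambda>a i j. to_ac (M a i j)) (\<lambda>x i j. to_ac (e x i j)) \<longleftrightarrow> idem_mat V A d M e"
proof -
  have 1: "(\<lambda>i j. to_ac (B i j)) \<in> mat_box m n \<longleftrightarrow> B \<in> mat_box m n" for B :: "nat \<Rightarrow> nat \<Rightarrow> 'b" and m n
    by (simp add: mat_box_def)
  have 2: "id_mat n = (\<lambda>i j. to_ac (id_mat n i j :: 'b))" for n
    by (auto simp: id_mat_def fun_eq_iff)
  have 3: "(\<lambda>_ _. 0) = (\<lambda>i j. to_ac ((\<lambda>_ _. 0 :: 'b) (i :: nat) (j :: nat)))" by simp
  show ?thesis unfolding idem_mat_def 1 2 3 mat_mult_to_ac to_ac_mat_eq by simp
qed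

lemma idem_mat_cong:
  assumes A: "A \<subseteq> V \<times> V" and eq: "\<And>x. x \<in> V \<Longrightarrow> e x = e' x"
  shows "idem_mat V A d M e \<longleftrightarrow> idem_mat V A d M e'"
proof -
  have "mat_mult (d y) (e y) (M (x, y)) = mat_mult (d x) (M (x, y)) (e x) \<longleftrightarrow>
      mat_mult (d y) (e' y) (M (x, y)) = mat_mult (d x) (M (x, y)) (e' x)" if "(x, y) \<in> A" for x y
  proof -
    have "e x = e' x" "e y = e' y" using that A eq by auto
    then show ?thesis by simp
  qed
  then show ?thesis unfolding idem_mat_def by (simp add: eq cong: ball_cong bex_cong conj_cong)
qed

lemma range_to_ac_sum: "(\<And>x. x \<in> S \<Longrightarrow> f x \<in> range to_ac) \<Longrightarrow> sum f S \<in> range to_ac"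
proof -
  assume "\<And>x. x \<in> S \<Longrightarrow> f x \<in> range to_ac"
  then have "sum f S = to_ac (\<Sum>x\<in>S. of_ac (f x))" unfolding to_ac_sum by (intro sum.cong refl) (simp add: to_ac_of_ac)
  then show ?thesis by simp
qed

lemma range_to_ac_mult: "x \<in> range to_ac \<Longrightarrow> y \<in> range to_ac \<Longrightarrow> x * y \<in> range to_ac"
  by (auto simp flip: to_ac_mult)

section \<open>Representations with surjective line maps and injective leg maps, and descent of
  their idempotents\<close>

definition legmap :: "(gvert \<Rightarrow> nat) \<Rightarrow> (gvert \<times> gvert \<Rightarrow> nat \<Rightarrow> nat \<Rightarrow> 'k::field) \<Rightarrow> nat \<Rightarrow> nat \<Rightarrow> (nat \<Rightarrow> 'k) \<Rightarrow> (nat \<Rightarrow> 'k)" where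
  "legmap d M i j = mat_vec (d (Pv i j)) (M (Pv i j, Pv i (j - 1)))"

definition linemap :: "nat \<Rightarrow> (gvert \<times> gvert \<Rightarrow> nat \<Rightarrow> nat \<Rightarrow> 'k::field) \<Rightarrow> nat \<Rightarrow> (nat \<Rightarrow> 'k) \<Rightarrow> (nat \<Rightarrow> 'k)" where
  "linemap r M i x = (\<lambda>a. \<Sum>l\<in>{1..r}. M (Lv l, Pv i 0) a 0 * x l)"

definition nice :: "nat \<Rightarrow> nat \<Rightarrow> (nat \<Rightarrow> nat) \<Rightarrow> (gvert \<Rightarrow> nat) \<Rightarrow> (gvert \<times> gvert \<Rightarrow> nat \<Rightarrow> nat \<Rightarrow> 'k::field) \<Rightarrow> bool" where
  "nice r k s d M \<longleftrightarrow> (\<forall>i\<in>{1..k}. linemap r M i ` supp_on {1..r} = vec (d (Pv i 0)) \<and>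
     (\<forall>j\<in>{1..s i}. inj_on (legmap d M i j) (vec (d (Pv i j)))))"

lemma lin_linemap: "lin (linemap r M i)"
  by (auto simp: lin_def linemap_def fun_eq_iff algebra_simps sum.distrib sum_distrib_left)

lemma lin_legmap: "lin (legmap d M i j)"
  by (simp add: legmap_def lin_mat_vec)

lemma gamma_A_subset: "gamma_A r k s \<subseteq> gamma_V r k s \<times> gamma_V r k s"
  by (auto simp: gamma_A_def gamma_V_def)

text \<open>Stated entrywise over the ground field, so that the identity can be pushed through
  \<open>to_ac\<close>; the same holds for the left inverse of a leg map below.\<close>

lemma nice_linemap_right_inverse:
  assumes "nice r k s d M" "i \<in> {1..k}"
  obtains g where "\<And>a b. a < d (Pv i 0) \<Longrightarrow> b < d (Pv i 0) \<Longrightarrow>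
    (\<Sum>l\<in>{1..r}. M (Lv l, Pv i 0) a 0 * g l b) = (if a = b then 1 else 0)"
proof -
  obtain g where g: "\<And>v. v \<in> linemap r M i ` supp_on {1..r} \<Longrightarrow> linemap r M i (g v) = v"
    using lin_right_inverse[OF lin_linemap subspace_supp_on] by metis
  have im: "linemap r M i ` supp_on {1..r} = vec (d (Pv i 0))" using assms by (simp add: nice_def)
  show thesis
  proof (rule that[of "\<lambda>l b. g (unitv b) l"])
    fix a b assume ab: "a < d (Pv i 0)" "b < d (Pv i 0)"
    have "linemap r M i (g (unitv b)) a = unitv b a" using g[unfolded im, OF unitv_vec[OF ab(2)]] by (rule fun_cong)
    then show "(\<Sum>l\<in>{1..r}. M (Lv l, Pv i 0) a 0 * g (unitv b) l) = (if a = b then 1 else 0)"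
      by (simp add: linemap_def unitv_def)
  qed
qed

lemma nice_legmap_left_inverse:
  assumes "nice r k s d M" "i \<in> {1..k}" "j \<in> {1..s i}" and M: "M \<in> reps (gamma_A r k s) d"
  obtains B where "\<And>a b. a < d (Pv i j) \<Longrightarrow> b < d (Pv i j) \<Longrightarrow>
    (\<Sum>c<d (Pv i (j - 1)). B a c * M (Pv i j, Pv i (j - 1)) c b) = (if a = b then 1 else 0)"
proof -
  have "inj_on (legmap d M i j) (vec (d (Pv i j)))" using assms by (simp add: nice_def)
  then obtain g where g: "lin g" "range g \<subseteq> vec (d (Pv i j))"
      "\<And>v. v \<in> vec (d (Pv i j)) \<Longrightarrow> g (legmap d M i j v) = v"
    using lin_left_inverse[OF lin_legmap subspace_vec] by blast
  let ?B = "mat_of (d (Pv i j)) (d (Pv i (j - 1))) g"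
  have box: "M (Pv i j, Pv i (j - 1)) \<in> mat_box (d (Pv i (j - 1))) (d (Pv i j))"
    using M assms(2,3) by (auto simp: reps_def gamma_A_def)
  show thesis
  proof (rule that[of ?B])
    fix a b assume ab: "a < d (Pv i j)" "b < d (Pv i j)"
    let ?v = "\<lambda>c. M (Pv i j, Pv i (j - 1)) c b"
    have v: "?v = legmap d M i j (unitv b)" unfolding legmap_def mat_vec_unitv[OF ab(2)] ..
    have "mat_vec (d (Pv i (j - 1))) ?B ?v = g ?v"
    proof (rule mat_vec_mat_of_lin[OF g(1)])
      show "?v \<in> vec (d (Pv i (j - 1)))" unfolding v legmap_def by (rule mat_vec_vec[OF box])
    qed (use g(2) in blast)
    also have "g ?v = unitv b" unfolding v by (rule g(3)[OF unitv_vec[OF ab(2)]])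
    finally have "mat_vec (d (Pv i (j - 1))) ?B ?v a = unitv b a" by simp
    then show "(\<Sum>c<d (Pv i (j - 1)). ?B a c * M (Pv i j, Pv i (j - 1)) c b) = (if a = b then 1 else 0)"
      by (simp add: mat_vec_def unitv_def)
  qed
qed

text \<open>An idempotent endomorphism over the closure is determined by its values 0 and 1 on the lines,
  so its entries lie in the ground field.\<close>

lemma nice_idem_descends:
  fixes M :: "gvert \<times> gvert \<Rightarrow> nat \<Rightarrow> nat \<Rightarrow> 'k::field"
  assumes nice: "nice r k s d M" and M: "M \<in> reps (gamma_A r k s) d"
    and d1: "\<And>l. l \<in> {1..r} \<Longrightarrow> d (Lv l) = 1"
    and e: "idem_mat (gamma_V r k s) (gamma_A r k s) d (\<lambda>a i j. to_ac (M a i j)) e"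
  shows "\<exists>e'. idem_mat (gamma_V r k s) (gamma_A r k s) d M e'"
proof -
  let ?R = "range to_ac :: 'k alg_closure set"
  have box: "e x \<in> mat_box (d x) (d x)" "mat_mult (d x) (e x) (e x) = e x" if "x \<in> gamma_V r k s" for x
    using e that by (auto simp: idem_mat_def)
  have comm: "mat_mult (d y) (e y) (\<lambda>i j. to_ac (M (x, y) i j)) a b = mat_mult (d x) (\<lambda>i j. to_ac (M (x, y) i j)) (e x) a b"
    if "(x, y) \<in> gamma_A r k s" for x y a b
    using e that by (auto simp: idem_mat_def)
  have outside: "e x a b \<in> ?R" if "x \<in> gamma_V r k s" "d x \<le> a \<or> d x \<le> b" for x a b
    using box(1)[OF that(1)] that(2) by (auto simp: mat_box_def intro: range_eqI[of _ _ 0])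
  have line: "e (Lv l) a b \<in> ?R" if l: "l \<in> {1..r}" for l a b
  proof (cases "a = 0 \<and> b = 0")
    case True
    have V: "Lv l \<in> gamma_V r k s" using l by (simp add: gamma_V_def)
    have "mat_mult 1 (e (Lv l)) (e (Lv l)) 0 0 = e (Lv l) 0 0" using box(2)[OF V] d1[OF l] by simp
    then have "e (Lv l) 0 0 * e (Lv l) 0 0 = e (Lv l) 0 0" by (simp add: mat_mult_def)
    then have "e (Lv l) 0 0 = 0 \<or> e (Lv l) 0 0 = 1" by simp
    then show ?thesis using True by (auto intro: range_eqI[of _ _ 0] range_eqI[of _ _ 1])
  next
    case False
    have V: "Lv l \<in> gamma_V r k s" using l by (simp add: gamma_V_def)
    show ?thesis by (rule outside[OF V]) (use False d1[OF l] in auto)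
  qed
  have leg: "e (Pv i j) a b \<in> ?R" if i: "i \<in> {1..k}" and j: "j \<le> s i" for i j a b
    using j
  proof (induction j arbitrary: a b)
    case 0
    let ?n = "d (Pv i 0)"
    have V: "Pv i 0 \<in> gamma_V r k s" using i by (simp add: gamma_V_def)
    show ?case
    proof (cases "a < ?n \<and> b < ?n")
      case True
      obtain g where g: "\<And>a b. a < ?n \<Longrightarrow> b < ?n \<Longrightarrow>
        (\<Sum>l\<in>{1..r}. M (Lv l, Pv i 0) a 0 * g l b) = (if a = b then 1 else 0)"
        using nice_linemap_right_inverse[OF nice i] by blast
      have row: "(\<Sum>c<?n. e (Pv i 0) a c * to_ac (M (Lv l, Pv i 0) c 0)) \<in> ?R" if l: "l \<in> {1..r}" for l
      proof -
        have "(Lv l, Pv i 0) \<in> gamma_A r k s" using l i by (auto simp: gamma_A_def)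
        from comm[OF this, of a 0] have "(\<Sum>c<?n. e (Pv i 0) a c * to_ac (M (Lv l, Pv i 0) c 0))
           = to_ac (M (Lv l, Pv i 0) a 0) * e (Lv l) 0 0"
          by (simp add: mat_mult_def d1[OF l])
        then show ?thesis using line[OF l] by (simp add: range_to_ac_mult)
      qed
      \<comment> \<open>The identity matrix is replaced by the line map times its right inverse
        \<open>g\<close>. The product of \<open>e\<close> with the line map has ground field
        entries, because it equals the line map times the values of \<open>e\<close> on the
        lines.\<close>
      have "e (Pv i 0) a b = (\<Sum>c<?n. if c = b then e (Pv i 0) a c else 0)" using True by (simp add: sum.delta)
      also have "\<dots> = (\<Sum>c<?n. e (Pv i 0) a c * to_ac (\<Sum>l\<in>{1..r}. M (Lv l, Pv i 0) c 0 * g l b))"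
        by (rule sum.cong) (use True g in auto)
      also have "\<dots> = (\<Sum>l\<in>{1..r}. (\<Sum>c<?n. e (Pv i 0) a c * to_ac (M (Lv l, Pv i 0) c 0)) * to_ac (g l b))"
        unfolding to_ac_sum to_ac_mult sum_distrib_left sum_distrib_right
        by (subst sum.swap) (simp add: mult.assoc)
      also have "\<dots> \<in> ?R" by (intro range_to_ac_sum range_to_ac_mult row) auto
      finally show ?thesis .
    next
      case False
      then show ?thesis by (intro outside[OF V]) auto
    qed
  next
    case (Suc j)
    let ?n = "d (Pv i (Suc j))" and ?m = "d (Pv i j)"
    have V: "Pv i (Suc j) \<in> gamma_V r k s" using i Suc.prems by (simp add: gamma_V_def)
    show ?case
    proof (cases "a < ?n \<and> b < ?n")
      case True
      have jj: "Suc j \<in> {1..s i}" using Suc.prems by simp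
      obtain B where B: "\<And>a b. a < ?n \<Longrightarrow> b < ?n \<Longrightarrow>
        (\<Sum>c<?m. B a c * M (Pv i (Suc j), Pv i j) c b) = (if a = b then 1 else 0)"
        using nice_legmap_left_inverse[OF nice i jj M] by (metis diff_Suc_1)
      have arr: "(Pv i (Suc j), Pv i j) \<in> gamma_A r k s"
        using i jj unfolding gamma_A_def by (auto intro!: exI[of _ "Suc j"])
      have row: "(\<Sum>c'<?n. to_ac (M (Pv i (Suc j), Pv i j) c c') * e (Pv i (Suc j)) c' b) \<in> ?R" for c
      proof -
        have "(\<Sum>c'<?m. e (Pv i j) c c' * to_ac (M (Pv i (Suc j), Pv i j) c' b)) \<in> ?R"
          by (intro range_to_ac_sum range_to_ac_mult Suc.IH) (use Suc.prems in auto)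
        then show ?thesis using comm[OF arr, of c b] by (simp add: mat_mult_def)
      qed
      \<comment> \<open>Dually the identity is replaced on the left by \<open>B\<close> times the
        leg map, and the leg map times \<open>e\<close> at \<open>j + 1\<close> equals
        \<open>e\<close> at \<open>j\<close> times the leg map, which is known by induction.\<close>
      have "e (Pv i (Suc j)) a b = (\<Sum>c'<?n. if a = c' then e (Pv i (Suc j)) c' b else 0)" using True by (simp add: sum.delta')
      also have "\<dots> = (\<Sum>c'<?n. to_ac (\<Sum>c<?m. B a c * M (Pv i (Suc j), Pv i j) c c') * e (Pv i (Suc j)) c' b)"
        by (rule sum.cong) (use True B in auto)
      also have "\<dots> = (\<Sum>c<?m. to_ac (B a c) * (\<Sum>c'<?n. to_ac (M (Pv i (Suc j), Pv i j) c c') * e (Pv i (Suc j)) c' b))"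
        unfolding to_ac_sum to_ac_mult sum_distrib_left sum_distrib_right
        by (subst sum.swap) (simp add: mult.assoc)
      also have "\<dots> \<in> ?R" by (intro range_to_ac_sum range_to_ac_mult row) auto
      finally show ?thesis .
    next
      case False
      then show ?thesis by (intro outside[OF V]) auto
    qed
  qed
  define e' where "e' x a b = of_ac (e x a b)" for x a b
  have eq: "e x = (\<lambda>a b. to_ac (e' x a b))" if "x \<in> gamma_V r k s" for x
  proof -
    have "e x a b \<in> ?R" for a b using that line leg by (auto simp: gamma_V_def)
    then show ?thesis by (auto simp: e'_def to_ac_of_ac)
  qed
  have "idem_mat (gamma_V r k s) (gamma_A r k s) d (\<lambda>a i j. to_ac (M a i j)) (\<lambda>x a b. to_ac (e' x a b))"
    using e idem_mat_cong[where e = e and e' = "\<lambda>x a b. to_ac (e' x a b)", OF gamma_A_subset[of r k s] eq] by blast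
  then show ?thesis unfolding idem_mat_to_ac by blast
qed

section \<open>Splitting off a chain from a leg\<close>

text \<open>The composite of \<open>T (m + 1)\<close>, ..., \<open>T (m + n)\<close>, leading from
  position \<open>m + n\<close> of a leg down to position \<open>m\<close>.\<close>

primrec cmp :: "(nat \<Rightarrow> 'x \<Rightarrow> 'x) \<Rightarrow> nat \<Rightarrow> nat \<Rightarrow> 'x \<Rightarrow> 'x" where
  "cmp T m 0 = (\<lambda>x. x)"
| "cmp T m (Suc n) = (\<lambda>x. cmp T m n (T (m + Suc n) x))"

lemma cmp_Suc_left: "cmp T m (Suc n) x = T (Suc m) (cmp T (Suc m) n x)"
  by (induction n arbitrary: x) simp_all

lemma cmp_cmp: "cmp T m n (cmp T (m + n) p x) = cmp T m (n + p) x"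
  by (induction p arbitrary: x) (simp_all add: add.assoc)

lemma lin_cmp: "(\<And>j. lin (T j)) \<Longrightarrow> lin (cmp T m n)"
  by (induction n) (simp_all add: lin_id lin_comp)

lemma cmp_range:
  assumes "\<And>j x. m < j \<Longrightarrow> j \<le> m + n \<Longrightarrow> x \<in> W j \<Longrightarrow> T j x \<in> W (j - 1)" "x \<in> W (m + n)"
  shows "cmp T m n x \<in> W m"
  using assms
proof (induction n arbitrary: x)
  case (Suc n)
  have "T (m + Suc n) x \<in> W (m + Suc n - 1)" by (rule Suc.prems(1)) (use Suc.prems(2) in auto)
  then have "cmp T m n (T (m + Suc n) x) \<in> W m" using Suc.prems(1) by (intro Suc.IH) auto
  then show ?case by simp
qed simp

text \<open>With \<open>g\<close> a linear projection onto \<open>S\<close>, a coordinate at which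
  \<open>y - g y\<close> is nonzero, applied to \<open>v - g v\<close> and normalised at
  \<open>y\<close>, does the job.\<close>

lemma separating_functional:
  fixes y :: "nat \<Rightarrow> 'k::field"
  assumes S: "fs.subspace S" and y: "y \<notin> S"
  obtains f :: "(nat \<Rightarrow> 'k) \<Rightarrow> 'k" where "\<And>u v. f (u + v) = f u + f v" "\<And>c v. f (smul c v) = c * f v"
    "\<And>v. v \<in> S \<Longrightarrow> f v = 0" "f y = 1"
proof -
  obtain g where g: "lin g" "range g \<subseteq> S" "\<And>v. v \<in> S \<Longrightarrow> g v = v"
    using lin_left_inverse[OF lin_id S] by (metis inj_on_id2)
  have "y - g y \<noteq> 0" using g(2) y by auto
  then obtain i where i: "(y - g y) i \<noteq> 0" by (metis zero_fun_def ext)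
  let ?f = "\<lambda>v. (v - g v) i / (y - g y) i"
  show thesis
  proof (rule that[of ?f])
    show "?f (u + v) = ?f u + ?f v" for u v by (simp add: lin_add[OF g(1)] add_divide_distrib diff_divide_distrib)
    show "?f (smul c v) = c * ?f v" for c v by (simp add: lin_smul[OF g(1)] algebra_simps diff_divide_distrib)
    show "?f v = 0" if "v \<in> S" for v using g(3)[OF that] by simp
    show "?f y = 1" using i by simp
  qed
qed

text \<open>A vector at position \<open>m\<close> of a leg that lies in \<open>K\<close> but not in \<open>S\<close> is pulled back along the leg
  as far as possible; the chain it generates spans a direct summand, cut out by a functional at position \<open>m\<close>.\<close>

lemma leg_splits:
  fixes M :: "gvert \<times> gvert \<Rightarrow> nat \<Rightarrow> nat \<Rightarrow> 'k::field"
  assumes M: "M \<in> reps (gamma_A r k s) d" and r: "r \<ge> 1" and d1: "\<And>l. l \<in> {1..r} \<Longrightarrow> d (Lv l) = 1"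
    and i: "i \<in> {1..k}" and m: "m \<le> s i"
    and S: "fs.subspace S" and KS: "\<And>y z. y \<in> K \<Longrightarrow> z \<in> S \<Longrightarrow> y - z \<in> K"
    and y0: "y0 \<in> vec (d (Pv i m))" "y0 \<in> K" "y0 \<notin> S"
    and Km: "\<And>y. m \<ge> 1 \<Longrightarrow> y \<in> K \<Longrightarrow> legmap d M i m y = 0"
    and Sm: "\<And>l v. m = 0 \<Longrightarrow> l \<in> {1..r} \<Longrightarrow> v \<in> vec 1 \<Longrightarrow> mat_vec 1 (M (Lv l, Pv i 0)) v \<in> S"
  shows "\<exists>E. idem_rep (gamma_V r k s) (gamma_A r k s) d M E"
proof -
  define T where "T = legmap d M i"
  define W where "W j = (vec (d (Pv i j)) :: (nat \<Rightarrow> 'k) set)" for j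
  have linT: "lin (T j)" for j by (simp add: T_def lin_legmap)
  have linc: "lin (cmp T a b)" for a b by (rule lin_cmp[OF linT])
  have TW: "T j x \<in> W (j - 1)" if "1 \<le> j" "j \<le> s i" for j x
  proof -
    have "M (Pv i j, Pv i (j - 1)) \<in> mat_box (d (Pv i (j - 1))) (d (Pv i j))"
      using M i that by (auto simp: reps_def gamma_A_def)
    then show ?thesis unfolding T_def W_def legmap_def by (rule mat_vec_vec)
  qed
  have cW: "cmp T a b x \<in> W a" if "a + b \<le> s i" "x \<in> W (a + b)" for a b x
    by (rule cmp_range) (use that TW in auto)
  \<comment> \<open>\<open>P n\<close> says that some vector \<open>n\<close> steps further out on
    the leg is mapped into \<open>K\<close> but not into \<open>S\<close>. A maximal
    \<open>n\<close> exists because the leg is finite.\<close>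
  define P where "P n \<longleftrightarrow> m + n \<le> s i \<and> (\<exists>y\<in>W (m + n). cmp T m n y \<in> K \<and> cmp T m n y \<notin> S)" for n
  have P0: "P 0" using m y0 by (auto simp: P_def W_def)
  define N where "N = (GREATEST n. P n)"
  have bd: "n \<le> s i" if "P n" for n using that by (simp add: P_def)
  have PN: "P N" unfolding N_def using P0 bd by (rule GreatestI_nat)
  have Nmax: "n \<le> N" if "P n" for n unfolding N_def using that bd by (rule Greatest_le_nat)
  obtain y where y: "y \<in> W (m + N)" "cmp T m N y \<in> K" "cmp T m N y \<notin> S" and mN: "m + N \<le> s i"
    using PN by (auto simp: P_def)
  \<comment> \<open>What lies one step beyond the top of the chain; at the end of the leg there is
    nothing, hence \<open>{0}\<close>.\<close>
  define I where "I = (if Suc (m + N) \<le> s i then W (Suc (m + N)) else {0})"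
  have Isub: "fs.subspace I" by (simp add: I_def W_def subspace_vec fs.subspace_def)
  \<comment> \<open>The functional has to vanish on \<open>S\<close> and on everything arriving from
    beyond the chain. Maximality of \<open>N\<close>, with the closure of \<open>K\<close> under
    subtracting elements of \<open>S\<close>, keeps the image of \<open>y\<close> out of this
    sum.\<close>
  define R where "R = {a + b | a b. a \<in> S \<and> b \<in> cmp T m (Suc N) ` I}"
  have Rsub: "fs.subspace R"
    unfolding R_def by (rule fs.subspace_sums[OF S lin_image_subspace[OF linc Isub]])
  have "cmp T m N y \<notin> R"
  proof
    assume "cmp T m N y \<in> R"
    then obtain a w where aw: "a \<in> S" "w \<in> I" "cmp T m N y = a + cmp T m (Suc N) w" by (auto simp: R_def)
    have e: "cmp T m (Suc N) w = cmp T m N y - a" using aw(3) by simp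
    have "cmp T m (Suc N) w \<in> K" unfolding e by (rule KS[OF y(2) aw(1)])
    moreover have nS: "cmp T m (Suc N) w \<notin> S"
    proof
      assume "cmp T m (Suc N) w \<in> S"
      then have "a + cmp T m (Suc N) w \<in> S" by (rule fs.subspace_add[OF S aw(1)])
      then show False using y(3) aw(3) by simp
    qed
    moreover have "Suc (m + N) \<le> s i"
    proof (rule ccontr)
      assume "\<not> ?thesis"
      then have "w = 0" using aw(2) by (simp add: I_def)
      then show False using nS fs.subspace_0[OF S] by (simp only: lin_0[OF linc] not_True_eq_False)
    qed
    ultimately have "P (Suc N)" using aw(2) unfolding P_def by (auto simp: I_def)
    then show False using Nmax by force
  qed
  from separating_functional[OF Rsub this] obtain f :: "(nat \<Rightarrow> 'k) \<Rightarrow> 'k"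
    where f: "\<And>u v. f (u + v) = f u + f v" "\<And>c v. f (smul c v) = c * f v"
      "\<And>v. v \<in> R \<Longrightarrow> f v = 0" "f (cmp T m N y) = 1" by blast
  have fS: "f v = 0" if "v \<in> S" for v
  proof (rule f(3))
    have "v + cmp T m (Suc N) 0 \<in> R" unfolding R_def using that fs.subspace_0[OF Isub] by blast
    then show "v \<in> R" by (simp only: lin_0[OF linc] add_0_right)
  qed
  have fI: "f (cmp T m (Suc N) w) = 0" if "w \<in> I" for w
  proof (rule f(3))
    have "0 + cmp T m (Suc N) w \<in> R" unfolding R_def using that fs.subspace_0[OF S] by blast
    then show "cmp T m (Suc N) w \<in> R" by (simp only: add_0_left)
  qed
  \<comment> \<open>\<open>Y j\<close> is the chain vector at position \<open>j\<close> and
    \<open>L j\<close> is the functional \<open>f\<close> pulled back to position \<open>j\<close>.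
    Since \<open>L j (Y j) = 1\<close>, the rank-one maps \<open>smul (L j v) (Y j)\<close> are
    idempotent.\<close>
  define Y where "Y j = cmp T j (m + N - j) y" for j
  define L where "L j v = f (cmp T m (j - m) v)" for j v
  define E where "E x = (case x of Lv _ \<Rightarrow> (\<lambda>v. 0) | Pv i' j \<Rightarrow>
     (if i' = i \<and> m \<le> j \<and> j \<le> m + N then (\<lambda>v. smul (L j v) (Y j)) else (\<lambda>v. 0)))" for x
  have EP: "E (Pv i' j) v = (if i' = i \<and> m \<le> j \<and> j \<le> m + N then smul (L j v) (Y j) else 0)" for i' j v
    by (simp add: E_def)
  have EL: "E (Lv l) v = 0" for l v by (simp add: E_def)
  have YW: "Y j \<in> W j" if "m \<le> j" "j \<le> m + N" for j
    unfolding Y_def by (rule cW) (use that mN y(1) in auto)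
  have LY: "L j (Y j) = 1" if "m \<le> j" "j \<le> m + N" for j
  proof -
    have "cmp T m (j - m) (cmp T (m + (j - m)) (m + N - j) y) = cmp T m (j - m + (m + N - j)) y" by (rule cmp_cmp)
    moreover have "m + (j - m) = j" "j - m + (m + N - j) = N" using that by auto
    ultimately show ?thesis by (simp add: L_def Y_def f(4))
  qed
  have TY: "T j (Y j) = Y (j - 1)" if j: "m < j" "j \<le> m + N" for j
  proof -
    have "Y (j - 1) = cmp T (j - 1) (Suc (m + N - j)) y" unfolding Y_def using j by (simp add: Suc_diff_le)
    also have "\<dots> = T (Suc (j - 1)) (cmp T (Suc (j - 1)) (m + N - j) y)" by (rule cmp_Suc_left)
    finally show ?thesis using j by (simp add: Y_def)
  qed
  have LT: "L (j - 1) (T j v) = L j v" if j: "m < j" for j v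
  proof -
    have "j - m = Suc (j - 1 - m)" "m + Suc (j - 1 - m) = j" using j by auto
    then show ?thesis unfolding L_def by simp
  qed
  have Ll: "L j (u + v) = L j u + L j v" "L j (smul c v) = c * L j v" for j u v c
    unfolding L_def lin_add[OF linc] lin_smul[OF linc] f by simp_all
  have linE: "lin (E x)" for x
    by (cases x) (auto intro!: linI simp: EP EL Ll fun_eq_iff algebra_simps)
  have Ev: "E x v \<in> vec (d x)" for x v
    by (cases x) (auto simp: EP EL YW[unfolded W_def])
  have comm: "E b (mat_vec (d a) (M (a, b)) v) = mat_vec (d a) (M (a, b)) (E a v)"
    if ab: "(a, b) \<in> gamma_A r k s" and v: "v \<in> vec (d a)" for a b v
  proof -
    consider (line) l i' where "a = Lv l" "b = Pv i' 0" "l \<in> {1..r}" "i' \<in> {1..k}"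
      | (leg) i' j where "a = Pv i' j" "b = Pv i' (j - 1)" "i' \<in> {1..k}" "1 \<le> j" "j \<le> s i'"
      using ab by (auto simp: gamma_A_def)
    then show ?thesis
    proof cases
      case line
      have "E (Pv i' 0) (mat_vec 1 (M (Lv l, Pv i' 0)) v) = 0"
      proof (cases "i' = i \<and> m = 0")
        case True
        have "mat_vec 1 (M (Lv l, Pv i 0)) v \<in> S" using Sm[of l v] True line v d1[OF line(3)] by simp
        then show ?thesis using True fS by (simp add: EP L_def)
      qed (auto simp: EP)
      then show ?thesis using line d1[OF line(3)] by (simp add: EL lin_0[OF lin_mat_vec])
    next
      case leg
      show ?thesis
      proof (cases "i' = i")
        case False
        then show ?thesis using leg by (simp add: EP lin_0[OF lin_mat_vec])
      next
        case ii: True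
        have "E (Pv i (j - 1)) (T j v) = T j (E (Pv i j) v)"
        proof -
          consider "j < m" | "j = m" | "m < j" "j \<le> m + N" | "j = Suc (m + N)" | "Suc (m + N) < j" by linarith
          then show ?thesis
          proof cases
            case 1
            then have "\<not> m \<le> j - 1" "\<not> m \<le> j" by auto
            then show ?thesis by (simp add: EP lin_0[OF linT])
          next
            case 2
            have "T m (Y m) = 0"
              using Km[of "Y m"] y(2) leg(4) 2 by (simp add: T_def Y_def)
            moreover have "\<not> m \<le> j - 1" using 2 leg(4) by auto
            ultimately show ?thesis using 2 by (simp add: EP lin_smul[OF linT])
          next
            case 3
            then have "m \<le> j - 1" "j - 1 \<le> m + N" by auto
            then show ?thesis using 3 LT[OF 3(1)] TY[OF 3] by (simp add: EP lin_smul[OF linT])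
          next
            case 4
            have "v \<in> I" using v leg ii 4 by (simp add: I_def W_def)
            then have "L (j - 1) (T j v) = 0" using fI[of v] 4 by (simp add: L_def)
            then show ?thesis using 4 by (simp add: EP lin_0[OF linT])
          next
            case 5
            then have "\<not> j - 1 \<le> m + N" "\<not> j \<le> m + N" by auto
            then show ?thesis by (simp add: EP lin_0[OF linT])
          qed
        qed
        then show ?thesis using leg ii by (simp add: T_def legmap_def)
      qed
    qed
  qed
  have "idem_rep (gamma_V r k s) (gamma_A r k s) d M E"
    unfolding idem_rep_def hom_rep_def
  proof (intro conjI ballI allI impI)
    fix x and v :: "nat \<Rightarrow> 'k"
    show "E x (E x v) = E x v" by (cases x) (auto simp: EP EL Ll LY)
  next
    have "E (Pv i (m + N)) y \<noteq> 0"
    proof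
      have Yy: "Y (m + N) = y" by (simp add: Y_def)
      assume "E (Pv i (m + N)) y = 0"
      then have "y = 0" using LY[of "m + N"] by (simp add: EP Yy)
      then show False using y(3) lin_0[OF linc] fs.subspace_0[OF S] by simp
    qed
    moreover have "Pv i (m + N) \<in> gamma_V r k s" using i mN by (simp add: gamma_V_def)
    ultimately show "\<exists>x\<in>gamma_V r k s. \<exists>v\<in>vec (d x). E x v \<noteq> 0" using y(1) unfolding W_def by blast
  next
    have "E (Lv 1) (unitv 0) \<noteq> unitv 0" by (simp add: EL unitv_def fun_eq_iff)
    moreover have "Lv 1 \<in> gamma_V r k s" using r by (simp add: gamma_V_def)
    moreover have "(unitv 0 :: nat \<Rightarrow> 'k) \<in> vec (d (Lv 1))" using d1[of 1] r by (simp add: unitv_vec)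
    ultimately show "\<exists>x\<in>gamma_V r k s. \<exists>v\<in>vec (d x). E x v \<noteq> v" by blast
  qed (use linE Ev comm in auto)
  then show ?thesis by blast
qed

text \<open>Two instances of \<open>leg_splits\<close>. A vector outside the image of the lines is
  used at \<open>m = 0\<close>, with \<open>S\<close> that image and no restriction
  \<open>K\<close>. A kernel vector of a leg map is used at \<open>m = j\<close>, with
  \<open>S\<close> zero and \<open>K\<close> the kernel.\<close>

lemma not_nice_idem_rep:
  fixes M :: "gvert \<times> gvert \<Rightarrow> nat \<Rightarrow> nat \<Rightarrow> 'k::field"
  assumes M: "M \<in> reps (gamma_A r k s) d" and r: "r \<ge> 1" and d1: "\<And>l. l \<in> {1..r} \<Longrightarrow> d (Lv l) = 1"
    and n: "\<not> nice r k s d M"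
  shows "\<exists>E. idem_rep (gamma_V r k s) (gamma_A r k s) d M E"
proof -
  obtain i where i: "i \<in> {1..k}" and
    "linemap r M i ` supp_on {1..r} \<noteq> vec (d (Pv i 0)) \<or> (\<exists>j\<in>{1..s i}. \<not> inj_on (legmap d M i j) (vec (d (Pv i j))))"
    using n unfolding nice_def by blast
  then consider "linemap r M i ` supp_on {1..r} \<noteq> vec (d (Pv i 0))"
    | j where "j \<in> {1..s i}" "\<not> inj_on (legmap d M i j) (vec (d (Pv i j)))" by blast
  then show ?thesis
  proof cases
    case 1
    let ?S = "linemap r M i ` supp_on {1..r}"
    have line: "mat_vec 1 (M (Lv l, Pv i 0)) v \<in> ?S" if l: "l \<in> {1..r}" for l v
    proof -
      let ?x = "smul (v 0) (unitv l)"
      have "linemap r M i ?x = mat_vec 1 (M (Lv l, Pv i 0)) v"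
        using l by (auto simp: linemap_def mat_vec_def unitv_def fun_eq_iff if_distrib[of "\<lambda>c. _ * c"] sum.delta cong: if_cong)
      moreover have "?x \<in> supp_on {1..r}" using l by (auto simp: supp_on_def unitv_def)
      ultimately show ?thesis by (metis image_eqI)
    qed
    have sub: "?S \<subseteq> vec (d (Pv i 0))"
    proof -
      have "M (Lv l, Pv i 0) a 0 = 0" if "l \<in> {1..r}" "a \<ge> d (Pv i 0)" for l a
      proof -
        have "M (Lv l, Pv i 0) \<in> mat_box (d (Pv i 0)) (d (Lv l))" using M i that by (auto simp: reps_def gamma_A_def)
        then show ?thesis using that(2) by (simp add: mat_box_def)
      qed
      then show ?thesis by (auto simp: vec_def linemap_def)
    qed
    then obtain y0 where y0: "y0 \<in> vec (d (Pv i 0))" "y0 \<notin> ?S" using 1 by blast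
    have Ssub: "fs.subspace ?S" by (rule lin_image_subspace[OF lin_linemap subspace_supp_on])
    show ?thesis
      by (rule leg_splits[OF M r d1 i, of 0 ?S UNIV y0]) (use y0 Ssub line in auto)
  next
    case 2
    have "\<exists>y0\<in>vec (d (Pv i j)). legmap d M i j y0 = 0 \<and> y0 \<noteq> 0"
    proof (rule ccontr)
      assume "\<not> ?thesis"
      then have "inj_on (legmap d M i j) (vec (d (Pv i j)))"
        by (intro lin_inj_on[OF lin_legmap subspace_vec]) blast
      then show False using 2(2) by simp
    qed
    then obtain y0 where y0: "y0 \<in> vec (d (Pv i j))" "legmap d M i j y0 = 0" "y0 \<noteq> 0" by blast
    show ?thesis
      by (rule leg_splits[OF M r d1 i, of j "{0}" "{y. legmap d M i j y = 0}" y0])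
        (use y0 2(1) in \<open>auto simp: fs.subspace_def\<close>)
  qed
qed

section \<open>Representations and flags\<close>

lemma lin_sum: "lin f \<Longrightarrow> f (\<Sum>b\<in>B. g b) = (\<Sum>b\<in>B. f (g b))"
  by (induction B rule: infinite_finite_induct) (simp_all add: lin_0[of f] lin_add[of f])

lemma vec_1_unitv: "v \<in> vec 1 \<Longrightarrow> v = smul (v 0) (unitv 0)"
  by (auto simp: vec_def unitv_def fun_eq_iff)

lemma vec_zero: "vec 0 = {0}"
  by (auto simp: vec_def fun_eq_iff)

text \<open>The position \<open>s i + 1\<close> is not a vertex. Giving it dimension 0, as the
  formula for the dimension vector does, lets the kernel of the line map be treated as one more step
  of the flag.\<close>

locale supernova =
  fixes r k :: nat and s :: "nat \<Rightarrow> nat" and d :: "gvert \<Rightarrow> nat"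
  assumes d1: "\<And>l. l \<in> {1..r} \<Longrightarrow> d (Lv l) = 1"
    and dz: "\<And>i. i \<in> {1..k} \<Longrightarrow> d (Pv i (Suc (s i))) = 0"
begin

abbreviation "VV \<equiv> gamma_V r k s"
abbreviation "AA \<equiv> gamma_A r k s"
abbreviation "Reps \<equiv> reps AA d"
abbreviation "homo \<equiv> hom_rep VV AA d"

definition phi :: "(gvert \<times> gvert \<Rightarrow> nat \<Rightarrow> nat \<Rightarrow> 'k::field) \<Rightarrow> nat \<Rightarrow> nat \<Rightarrow> (nat \<Rightarrow> 'k) \<Rightarrow> (nat \<Rightarrow> 'k)" where
  "phi M i j = cmp (legmap d M i) 0 j"

text \<open>At \<open>j = s i + 1\<close> the image of the leg is zero and the step is the kernel of
  the line map. Beyond that the step is set to zero, in accordance with \<open>fdim\<close>.\<close>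

definition flagof :: "(gvert \<times> gvert \<Rightarrow> nat \<Rightarrow> nat \<Rightarrow> 'k::field) \<Rightarrow> nat \<Rightarrow> nat \<Rightarrow> (nat \<Rightarrow> 'k) set" where
  "flagof M i j = {x \<in> supp_on {1..r}. if j \<le> Suc (s i) then linemap r M i x \<in> phi M i j ` vec (d (Pv i j)) else x = 0}"

lemma phi_0: "phi M i 0 v = v"
  by (simp add: phi_def)

lemma phi_Suc: "phi M i (Suc j) v = phi M i j (legmap d M i (Suc j) v)"
  by (simp add: phi_def)

lemma lin_phi: "lin (phi M i j)"
  unfolding phi_def by (rule lin_cmp[OF lin_legmap])

lemma legmap_vec:
  assumes M: "M \<in> Reps" and i: "i \<in> {1..k}" and j: "j \<le> s i" and v: "v \<in> vec (d (Pv i (Suc j)))"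
  shows "legmap d M i (Suc j) v \<in> vec (d (Pv i j))"
proof (cases "j = s i")
  case True
  then have "v = 0" using v dz[OF i] by (simp add: vec_zero)
  then show ?thesis by (simp add: lin_0[OF lin_legmap])
next
  case False
  then have "(Pv i (Suc j), Pv i j) \<in> AA" using i j unfolding gamma_A_def by (auto intro!: exI[of _ "Suc j"])
  then show ?thesis using M unfolding legmap_def by (auto simp: reps_def intro: mat_vec_vec)
qed

lemma phi_vec:
  assumes M: "M \<in> Reps" and i: "i \<in> {1..k}"
  shows "j \<le> Suc (s i) \<Longrightarrow> v \<in> vec (d (Pv i j)) \<Longrightarrow> phi M i j v \<in> vec (d (Pv i 0))"
proof (induction j arbitrary: v)
  case (Suc j)
  then show ?case using legmap_vec[OF M i] by (simp add: phi_Suc)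
qed (simp add: phi_0)

lemma linemap_vec:
  assumes M: "M \<in> Reps" and i: "i \<in> {1..k}"
  shows "linemap r M i x \<in> vec (d (Pv i 0))"
proof -
  have "M (Lv l, Pv i 0) a 0 = 0" if "l \<in> {1..r}" "a \<ge> d (Pv i 0)" for l a
  proof -
    have "M (Lv l, Pv i 0) \<in> mat_box (d (Pv i 0)) (d (Lv l))" using M i that by (auto simp: reps_def gamma_A_def)
    then show ?thesis using that(2) by (simp add: mat_box_def)
  qed
  then show ?thesis by (auto simp: vec_def linemap_def)
qed

lemma phi_inj:
  assumes n: "nice r k s d M" and M: "M \<in> Reps" and i: "i \<in> {1..k}" and j: "j \<le> Suc (s i)"
  shows "inj_on (phi M i j) (vec (d (Pv i j)))"
proof (rule lin_inj_on[OF lin_phi subspace_vec])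
  show "v = 0" if "v \<in> vec (d (Pv i j))" "phi M i j v = 0" for v
    using j that
  proof (induction j arbitrary: v)
    case (Suc j)
    have "legmap d M i (Suc j) v = 0"
    proof (rule Suc.IH)
      show "j \<le> Suc (s i)" using Suc.prems by simp
      show "legmap d M i (Suc j) v \<in> vec (d (Pv i j))" by (rule legmap_vec[OF M i]) (use Suc.prems in auto)
      show "phi M i j (legmap d M i (Suc j) v) = 0" using Suc.prems(3) unfolding phi_Suc .
    qed
    show ?case
    proof (cases "j = s i")
      case True
      then show ?thesis using Suc.prems(2) dz[OF i] by (simp add: vec_zero)
    next
      case False
      then have "inj_on (legmap d M i (Suc j)) (vec (d (Pv i (Suc j))))"
        using n i Suc.prems(1) unfolding nice_def by auto
      moreover have "legmap d M i (Suc j) v = legmap d M i (Suc j) 0"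
        using \<open>legmap d M i (Suc j) v = 0\<close> by (simp add: lin_0[OF lin_legmap])
      ultimately show ?thesis using Suc.prems(2) vec_0 by (rule inj_onD)
    qed
  qed (simp add: phi_0)
qed

lemma linemap_surj:
  assumes "nice r k s d M" "i \<in> {1..k}"
  shows "linemap r M i ` supp_on {1..r} = vec (d (Pv i 0))"
  using assms by (simp add: nice_def)

lemma flagof_subset: "flagof M i j \<subseteq> supp_on {1..r}"
  by (auto simp: flagof_def)

lemma flagof_subspace: "fs.subspace (flagof M i j)"
proof (cases "j \<le> Suc (s i)")
  case True
  have im: "fs.subspace (phi M i j ` vec (d (Pv i j)))" by (rule lin_image_subspace[OF lin_phi subspace_vec])
  have "flagof M i j = supp_on {1..r} \<inter> {x. linemap r M i x \<in> phi M i j ` vec (d (Pv i j))}"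
    using True by (auto simp: flagof_def)
  moreover have "fs.subspace {x. linemap r M i x \<in> phi M i j ` vec (d (Pv i j))}"
    by (rule fs.subspaceI; unfold mem_Collect_eq lin_0[OF lin_linemap] lin_add[OF lin_linemap] lin_smul[OF lin_linemap])
      (use im in \<open>auto intro: fs.subspace_0 fs.subspace_add fs.subspace_scale\<close>)
  ultimately show ?thesis using fs.subspace_inter[OF subspace_supp_on] by (simp only:)
next
  case False
  then have "flagof M i j = {0}" by (auto simp: flagof_def supp_on_def)
  then show ?thesis by (simp add: fs.subspace_def)
qed

definition lines :: "(gvert \<Rightarrow> (nat \<Rightarrow> 'k::field) \<Rightarrow> (nat \<Rightarrow> 'k)) \<Rightarrow> nat \<Rightarrow> 'k" where
  "lines E l = E (Lv l) (unitv 0) 0"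

lemma homD:
  assumes "homo M N E"
  shows "x \<in> VV \<Longrightarrow> lin (E x)" "x \<in> VV \<Longrightarrow> v \<in> vec (d x) \<Longrightarrow> E x v \<in> vec (d x)"
    "(x, y) \<in> AA \<Longrightarrow> v \<in> vec (d x) \<Longrightarrow> E y (mat_vec (d x) (M (x, y)) v) = mat_vec (d x) (N (x, y)) (E x v)"
  using assms unfolding hom_rep_def by blast+

lemma Lv_VV: "l \<in> {1..r} \<Longrightarrow> Lv l \<in> VV" and Pv_VV: "i \<in> {1..k} \<Longrightarrow> j \<le> s i \<Longrightarrow> Pv i j \<in> VV"
  by (auto simp: gamma_V_def)

lemma hom_Lv:
  assumes E: "homo M N E" and l: "l \<in> {1..r}" and v: "v \<in> vec 1"
  shows "E (Lv l) v = smul (lines E l) v"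
proof -
  have L: "lin (E (Lv l))" "E (Lv l) (unitv 0) \<in> vec 1"
    using homD(1,2)[OF E Lv_VV[OF l]] d1[OF l] by (auto simp: unitv_vec)
  have "E (Lv l) v = smul (v 0) (E (Lv l) (unitv 0))"
    using vec_1_unitv[OF v] lin_smul[OF L(1), of "v 0" "unitv 0"] by simp
  also have "E (Lv l) (unitv 0) = smul (lines E l) (unitv 0)" unfolding lines_def by (rule vec_1_unitv[OF L(2)])
  finally show ?thesis using vec_1_unitv[OF v] by (metis fs.scale_scale mult.commute)
qed

lemma linemap_sum: "linemap r M i x = (\<Sum>l\<in>{1..r}. mat_vec 1 (M (Lv l, Pv i 0)) (smul (x l) (unitv 0)))"
  by (rule ext) (simp add: linemap_def sum_apply mat_vec_def unitv_def)

lemma hom_linemap: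
  assumes E: "homo M N E" and i: "i \<in> {1..k}"
  shows "E (Pv i 0) (linemap r M i x) = linemap r N i (lines E * x)"
proof -
  have L: "lin (E (Pv i 0))" using homD(1)[OF E] Pv_VV[OF i] by simp
  have "E (Pv i 0) (mat_vec 1 (M (Lv l, Pv i 0)) (smul (x l) (unitv 0)))
     = mat_vec 1 (N (Lv l, Pv i 0)) (smul ((lines E * x) l) (unitv 0))" if l: "l \<in> {1..r}" for l
  proof -
    have a: "(Lv l, Pv i 0) \<in> AA" using l i by (auto simp: gamma_A_def)
    have v: "smul (x l) (unitv 0) \<in> vec 1" by (simp add: unitv_vec)
    have "E (Pv i 0) (mat_vec 1 (M (Lv l, Pv i 0)) (smul (x l) (unitv 0)))
        = mat_vec 1 (N (Lv l, Pv i 0)) (E (Lv l) (smul (x l) (unitv 0)))"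
      using homD(3)[OF E a, of "smul (x l) (unitv 0)"] v d1[OF l] by simp
    also have "E (Lv l) (smul (x l) (unitv 0)) = smul ((lines E * x) l) (unitv 0)"
      unfolding hom_Lv[OF E l v] by simp
    finally show ?thesis .
  qed
  then show ?thesis unfolding linemap_sum lin_sum[OF L] by (intro sum.cong refl)
qed

lemma hom_phi:
  assumes E: "homo M N E" and i: "i \<in> {1..k}" and M: "M \<in> Reps"
  shows "j \<le> s i \<Longrightarrow> v \<in> vec (d (Pv i j)) \<Longrightarrow> E (Pv i 0) (phi M i j v) = phi N i j (E (Pv i j) v)"
proof (induction j arbitrary: v)
  case (Suc j)
  have a: "(Pv i (Suc j), Pv i j) \<in> AA"
    using i Suc.prems unfolding gamma_A_def by (auto intro!: exI[of _ "Suc j"])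
  have "E (Pv i j) (legmap d M i (Suc j) v) = legmap d N i (Suc j) (E (Pv i (Suc j)) v)"
    using homD(3)[OF E a Suc.prems(2)] by (simp add: legmap_def)
  then show ?case using Suc legmap_vec[OF M i] by (simp add: phi_Suc)
qed (simp add: phi_0)

text \<open>A morphism intertwines the line maps through the diagonal matrix of its scalars on the
  lines, and maps images of leg positions to images of leg positions.\<close>

lemma hom_flagof:
  assumes E: "homo M N E" and i: "i \<in> {1..k}" and M: "M \<in> Reps" and x: "x \<in> flagof M i j"
  shows "lines E * x \<in> flagof N i j"
proof -
  have xs: "x \<in> supp_on {1..r}" using x flagof_subset by blast
  then have s: "lines E * x \<in> supp_on {1..r}" by (auto simp: supp_on_def)
  show ?thesis
  proof (cases "j \<le> Suc (s i)")
    case True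
    then obtain v where v: "v \<in> vec (d (Pv i j))" "linemap r M i x = phi M i j v" using x by (auto simp: flagof_def)
    have "linemap r N i (lines E * x) = E (Pv i 0) (phi M i j v)" using hom_linemap[OF E i] v(2) by metis
    also have "\<dots> \<in> phi N i j ` vec (d (Pv i j))"
    proof (cases "j = Suc (s i)")
      case True
      then have "v = 0" "vec (d (Pv i j)) = {0 :: nat \<Rightarrow> 'a}" using v(1) dz[OF i] by (simp_all add: vec_zero)
      moreover have "lin (E (Pv i 0))" using homD(1)[OF E Pv_VV[OF i]] by simp
      ultimately show ?thesis by (simp add: lin_0[OF lin_phi] lin_0[of "E (Pv i 0)"])
    next
      case False
      then have j: "j \<le> s i" using \<open>j \<le> Suc (s i)\<close> by simp
      show ?thesis unfolding hom_phi[OF E i M j v(1)] using homD(2)[OF E Pv_VV[OF i j] v(1)] by blast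
    qed
    finally show ?thesis using True s by (simp add: flagof_def)
  next
    case False
    then show ?thesis using x s by (auto simp: flagof_def)
  qed
qed

text \<open>The scalars on the lines fix a morphism at \<open>(i;0)\<close> because the line map of
  \<open>M\<close> is surjective, and further out because the composed leg maps of \<open>N\<close>
  are injective.\<close>

lemma hom_unique:
  assumes n: "nice r k s d M" "nice r k s d N" and MN: "M \<in> Reps" "N \<in> Reps"
    and E: "homo M N E" "homo M N E'" and eq: "\<And>l. l \<in> {1..r} \<Longrightarrow> lines E l = lines E' l"
    and x: "x \<in> VV" and v: "v \<in> vec (d x)"
  shows "E x v = E' x v"
proof -
  have 0: "E (Pv i 0) v = E' (Pv i 0) v" if i: "i \<in> {1..k}" and v: "v \<in> vec (d (Pv i 0))" for i v
  proof -
    obtain y where y: "y \<in> supp_on {1..r}" "v = linemap r M i y" using linemap_surj[OF n(1) i] v by blast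
    have "lines E * y = lines E' * y"
    proof
      fix l
      show "(lines E * y) l = (lines E' * y) l"
        using eq[of l] supp_onD[OF y(1), of l] by (cases "l \<in> {1..r}") simp_all
    qed
    then show ?thesis using hom_linemap[OF E(1) i] hom_linemap[OF E(2) i] y(2) by metis
  qed
  consider (line) l where "x = Lv l" "l \<in> {1..r}" | (leg) i j where "x = Pv i j" "i \<in> {1..k}" "j \<le> s i"
    using x by (auto simp: gamma_V_def)
  then show ?thesis
  proof cases
    case line
    then have "v \<in> vec 1" using v d1 by simp
    then show ?thesis using hom_Lv[OF E(1) line(2)] hom_Lv[OF E(2) line(2)] eq[OF line(2)] line(1) by simp
  next
    case leg
    have v': "v \<in> vec (d (Pv i j))" using v leg by simp
    have j: "j \<le> Suc (s i)" using leg by simp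
    have "phi N i j (E (Pv i j) v) = phi N i j (E' (Pv i j) v)"
      using 0[OF leg(2) phi_vec[OF MN(1) leg(2) j v']]
        hom_phi[OF E(1) leg(2) MN(1) leg(3) v'] hom_phi[OF E(2) leg(2) MN(1) leg(3) v'] by simp
    then show ?thesis using inj_onD[OF phi_inj[OF n(2) MN(2) leg(2) j]]
        homD(2)[OF E(1) x v] homD(2)[OF E(2) x v] leg(1) by blast
  qed
qed

text \<open>The entries of \<open>t\<close> may be zero, so that both idempotents and isomorphisms
  are obtained from here. The map at \<open>(i;0)\<close> is induced by \<open>t\<close> through the
  line maps and restricts to the leg positions because \<open>t\<close> respects the flags.\<close>

lemma hom_exists:
  fixes t :: "nat \<Rightarrow> 'k::field"
  assumes n: "nice r k s d M" "nice r k s d N" and MN: "M \<in> Reps" "N \<in> Reps"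
    and t: "\<And>i j x. i \<in> {1..k} \<Longrightarrow> x \<in> flagof M i j \<Longrightarrow> t * x \<in> flagof N i j"
  shows "\<exists>E. homo M N E \<and> lines E = t"
proof -
  have "\<forall>i\<in>{1..k}. \<exists>g. lin g \<and> range g \<subseteq> supp_on {1..r} \<and> (\<forall>v\<in>vec (d (Pv i 0)). linemap r M i (g v) = v)"
  proof
    fix i assume i: "i \<in> {1..k}"
    obtain g where "lin g" "range g \<subseteq> supp_on {1..r}" "\<And>v. v \<in> linemap r M i ` supp_on {1..r} \<Longrightarrow> linemap r M i (g v) = v"
      using lin_right_inverse[OF lin_linemap subspace_supp_on] by blast
    then show "\<exists>g. lin g \<and> range g \<subseteq> supp_on {1..r} \<and> (\<forall>v\<in>vec (d (Pv i 0)). linemap r M i (g v) = v)"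
      unfolding linemap_surj[OF n(1) i] by blast
  qed
  from bchoice[OF this] obtain g where gg: "\<forall>i\<in>{1..k}. lin (g i) \<and> range (g i) \<subseteq> supp_on {1..r} \<and>
      (\<forall>v\<in>vec (d (Pv i 0)). linemap r M i (g i v) = v)" by blast
  have g: "\<And>i. i \<in> {1..k} \<Longrightarrow> lin (g i)" "\<And>i v. i \<in> {1..k} \<Longrightarrow> g i v \<in> supp_on {1..r}"
     "\<And>i v. i \<in> {1..k} \<Longrightarrow> v \<in> vec (d (Pv i 0)) \<Longrightarrow> linemap r M i (g i v) = v"
    using gg by blast+
  define PP where "PP i j p \<longleftrightarrow> lin p \<and> range p \<subseteq> vec (d (Pv i j)) \<and> (\<forall>v\<in>vec (d (Pv i j)). p (phi N i j v) = v)" for i j p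
  have PPex: "\<exists>p. PP i j p" if i: "i \<in> {1..k}" and j: "j \<le> s i" for i j
  proof -
    have "inj_on (phi N i j) (vec (d (Pv i j)))" by (rule phi_inj[OF n(2) MN(2) i]) (use j in simp)
    from fsp.linear_exists_left_inverse_on[OF lin_phi[unfolded lin_iff_linear] subspace_vec this]
    have "\<exists>p. PP i j p" unfolding PP_def lin_iff_linear by (elim exE, intro exI) auto
    then show ?thesis by blast
  qed
  define p where "p i j = (SOME p. PP i j p)" for i j
  have PPp: "PP i j (p i j)" if "i \<in> {1..k}" "j \<le> s i" for i j
    unfolding p_def by (rule someI_ex[OF PPex[OF that]])
  have p: "lin (p i j)" "p i j v \<in> vec (d (Pv i j))" "v \<in> vec (d (Pv i j)) \<Longrightarrow> p i j (phi N i j v) = v"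
    if ij: "i \<in> {1..k}" "j \<le> s i" for i j v
    using PPp[OF ij] unfolding PP_def by blast+
  define E0 where "E0 i v = linemap r N i (t * g i v)" for i v
  have E0l: "lin (E0 i)" if "i \<in> {1..k}" for i
    unfolding E0_def by (rule lin_comp[OF lin_linemap lin_comp[OF lin_times g(1)[OF that]]])
  have E0v: "E0 i v \<in> vec (d (Pv i 0))" if "i \<in> {1..k}" for i v
    unfolding E0_def by (rule linemap_vec[OF MN(2) that])
  \<comment> \<open>Independence of the section \<open>g\<close>: two preimages differ by an element
    of the kernel of the line map, which is flag step \<open>s i + 1\<close>, and \<open>t\<close>
    carries it into the kernel for \<open>N\<close>.\<close>
  have E0: "E0 i (linemap r M i x) = linemap r N i (t * x)" if i: "i \<in> {1..k}" and x: "x \<in> supp_on {1..r}" for i x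
  proof -
    let ?y = "g i (linemap r M i x) - x"
    have "linemap r M i ?y = 0" using g(3)[OF i linemap_vec[OF MN(1) i]] by (simp add: lin_diff[OF lin_linemap])
    moreover have "?y \<in> supp_on {1..r}" by (rule fs.subspace_diff[OF subspace_supp_on g(2)[OF i] x])
    moreover have "0 \<in> phi M i (Suc (s i)) ` vec (d (Pv i (Suc (s i))))"
      by (rule image_eqI[of _ _ 0]) (simp_all add: lin_0[OF lin_phi])
    ultimately have "?y \<in> flagof M i (Suc (s i))" by (simp add: flagof_def)
    then have "t * ?y \<in> flagof N i (Suc (s i))" by (rule t[OF i])
    then have "linemap r N i (t * ?y) = 0" using dz[OF i] by (simp add: flagof_def vec_zero lin_0[OF lin_phi])
    then show ?thesis by (simp add: E0_def lin_diff[OF lin_linemap] lin_diff[OF lin_times])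
  qed
  define E where "E x = (case x of Lv l \<Rightarrow> smul (t l) | Pv i j \<Rightarrow> (\<lambda>v. p i j (E0 i (phi M i j v))))" for x
  have EL: "E (Lv l) = smul (t l)" and EP: "E (Pv i j) = (\<lambda>v. p i j (E0 i (phi M i j v)))" for l i j
    by (simp_all add: E_def)
  \<comment> \<open>A preimage of \<open>phi M i j v\<close> lies in flag step \<open>j\<close>,
    hence so does its multiple by \<open>t\<close> for \<open>N\<close>. So the value of
    \<open>E0\<close> is in the range of \<open>phi N i j\<close>, where the left inverse
    \<open>p i j\<close> loses nothing.\<close>
  have phiE: "phi N i j (E (Pv i j) v) = E0 i (phi M i j v)"
    if i: "i \<in> {1..k}" and j: "j \<le> s i" and v: "v \<in> vec (d (Pv i j))" for i j v
  proof -
    have j': "j \<le> Suc (s i)" using j by simp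
    obtain x where x: "x \<in> supp_on {1..r}" "phi M i j v = linemap r M i x"
      using phi_vec[OF MN(1) i j' v] linemap_surj[OF n(1) i] by blast
    have "linemap r M i x \<in> phi M i j ` vec (d (Pv i j))" using x(2) v by (rule image_eqI[OF sym])
    then have "x \<in> flagof M i j" using x(1) j' by (simp add: flagof_def)
    then have "t * x \<in> flagof N i j" by (rule t[OF i])
    then obtain w where w: "w \<in> vec (d (Pv i j))" "linemap r N i (t * x) = phi N i j w" using j' by (auto simp: flagof_def)
    have "E0 i (phi M i j v) = phi N i j w" using E0[OF i x(1)] x(2) w(2) by simp
    then show ?thesis unfolding EP using p(3)[OF i j w(1)] by simp
  qed
  have linE: "lin (E x)" if "x \<in> VV" for x
    using that by (auto simp: gamma_V_def EL EP lin_scale intro!: lin_comp[OF p(1)] lin_comp[OF E0l] lin_phi)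
  have Ev: "E x v \<in> vec (d x)" if "x \<in> VV" "v \<in> vec (d x)" for x v
    using that by (auto simp: gamma_V_def EL EP p(2))
  have comm: "E b (mat_vec (d a) (M (a, b)) v) = mat_vec (d a) (N (a, b)) (E a v)"
    if ab: "(a, b) \<in> AA" and v: "v \<in> vec (d a)" for a b v
  proof -
    consider (line) l i where "a = Lv l" "b = Pv i 0" "l \<in> {1..r}" "i \<in> {1..k}"
      | (leg) i j where "a = Pv i (Suc j)" "b = Pv i j" "i \<in> {1..k}" "Suc j \<le> s i"
    proof -
      assume a1: "\<And>l i. a = Lv l \<Longrightarrow> b = Pv i 0 \<Longrightarrow> l \<in> {1..r} \<Longrightarrow> i \<in> {1..k} \<Longrightarrow> thesis"
        and a2: "\<And>i j. a = Pv i (Suc j) \<Longrightarrow> b = Pv i j \<Longrightarrow> i \<in> {1..k} \<Longrightarrow> Suc j \<le> s i \<Longrightarrow> thesis"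
      show thesis
      proof (cases "\<exists>l i. a = Lv l \<and> b = Pv i 0 \<and> l \<in> {1..r} \<and> i \<in> {1..k}")
        case True
        then show thesis using a1 by blast
      next
        case False
        then obtain i j where "a = Pv i j" "b = Pv i (j - 1)" "i \<in> {1..k}" "1 \<le> j" "j \<le> s i"
          using ab by (auto simp: gamma_A_def)
        then show thesis using a2[of i "j - 1"] by simp
      qed
    qed
    then show ?thesis
    proof cases
      case line
      let ?x = "smul (v 0) (unitv l)"
      have lm: "mat_vec 1 (K (Lv l, Pv i 0)) (smul c v) = linemap r K i (smul c ?x)" for K c
        using line(3) by (auto simp: linemap_def mat_vec_def unitv_def fun_eq_iff if_distrib[of "\<lambda>c. _ * c"] sum.delta cong: if_cong)
      have xs: "?x \<in> supp_on {1..r}" using line by (auto simp: supp_on_def unitv_def)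
      have tx: "t * ?x = smul (t l) ?x" by (auto simp: fun_eq_iff unitv_def)
      have "E (Pv i 0) (mat_vec 1 (M (Lv l, Pv i 0)) v) = E0 i (linemap r M i ?x)"
      proof -
        have "phi N i 0 (E (Pv i 0) (mat_vec 1 (M (Lv l, Pv i 0)) v)) = E0 i (phi M i 0 (mat_vec 1 (M (Lv l, Pv i 0)) v))"
          by (rule phiE[OF line(4)]) (use linemap_vec[OF MN(1) line(4), of ?x] lm[of M 1] in simp_all)
        then show ?thesis using lm[of M 1] by (simp add: phi_0)
      qed
      also have "\<dots> = mat_vec 1 (N (Lv l, Pv i 0)) (smul (t l) v)" unfolding E0[OF line(4) xs] tx lm ..
      finally show ?thesis using line d1[OF line(3)] by (simp add: EL)
    next
      case leg
      have v': "v \<in> vec (d (Pv i (Suc j)))" and j: "j \<le> s i" using v leg by simp_all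
      have lv: "legmap d M i (Suc j) v \<in> vec (d (Pv i j))" by (rule legmap_vec[OF MN(1) leg(3) j v'])
      have "phi N i j (E (Pv i j) (legmap d M i (Suc j) v)) = E0 i (phi M i (Suc j) v)"
        using phiE[OF leg(3) j lv] by (simp add: phi_Suc)
      also have "\<dots> = phi N i (Suc j) (E (Pv i (Suc j)) v)" by (rule phiE[OF leg(3,4) v', symmetric])
      also have "\<dots> = phi N i j (legmap d N i (Suc j) (E (Pv i (Suc j)) v))" by (rule phi_Suc)
      finally have "E (Pv i j) (legmap d M i (Suc j) v) = legmap d N i (Suc j) (E (Pv i (Suc j)) v)"
      proof (rule inj_onD[OF phi_inj[OF n(2) MN(2) leg(3)], rotated])
        show "j \<le> Suc (s i)" using j by simp
        show "E (Pv i j) (legmap d M i (Suc j) v) \<in> vec (d (Pv i j))" by (rule Ev[OF Pv_VV[OF leg(3) j] lv])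
        show "legmap d N i (Suc j) (E (Pv i (Suc j)) v) \<in> vec (d (Pv i j))"
          by (rule legmap_vec[OF MN(2) leg(3) j Ev[OF Pv_VV[OF leg(3,4)] v']])
      qed
      then show ?thesis using leg by (simp add: legmap_def)
    qed
  qed
  have "homo M N E" unfolding hom_rep_def using linE Ev comm by blast
  moreover have "lines E = t" by (auto simp: lines_def EL unitv_def)
  ultimately show ?thesis by blast
qed

end

section \<open>Indecomposability and isomorphism in terms of flags\<close>

context supernova
begin

lemma hom_comp:
  assumes E: "homo M N E" and E': "homo N P E'"
  shows "homo M P (\<lambda>x v. E' x (E x v))" "\<And>l. l \<in> {1..r} \<Longrightarrow> lines (\<lambda>x v. E' x (E x v)) l = lines E' l * lines E l"
proof -
  show "homo M P (\<lambda>x v. E' x (E x v))"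
    unfolding hom_rep_def
  proof (intro conjI ballI allI impI)
    fix x assume x: "x \<in> VV"
    show "lin (\<lambda>v. E' x (E x v))" by (rule lin_comp[OF homD(1)[OF E' x] homD(1)[OF E x]])
    fix v :: "nat \<Rightarrow> 'a" assume v: "v \<in> vec (d x)"
    show "E' x (E x v) \<in> vec (d x)" by (rule homD(2)[OF E' x homD(2)[OF E x v]])
  next
    fix x y and v :: "nat \<Rightarrow> 'a" assume a: "(x, y) \<in> AA" and v: "v \<in> vec (d x)"
    have x: "x \<in> VV" using a gamma_A_subset by blast
    show "E' y (E y (mat_vec (d x) (M (x, y)) v)) = mat_vec (d x) (P (x, y)) (E' x (E x v))"
      unfolding homD(3)[OF E a v] by (rule homD(3)[OF E' a homD(2)[OF E x v]])
  qed
  fix l assume l: "l \<in> {1..r}"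
  have u: "unitv 0 \<in> vec 1" by (simp add: unitv_vec)
  have "E' (Lv l) (E (Lv l) (unitv 0)) = smul (lines E' l) (smul (lines E l) (unitv 0))"
    unfolding hom_Lv[OF E l u] by (rule hom_Lv[OF E' l vec_smul[OF u]])
  then show "lines (\<lambda>x v. E' x (E x v)) l = lines E' l * lines E l"
    unfolding lines_def[of "\<lambda>x v. E' x (E x v)"] by (simp add: unitv_def)
qed

lemma hom_id: "homo M M (\<lambda>x v. v)" "lines (\<lambda>x v. v) l = 1"
  by (simp_all add: hom_rep_def lin_id lines_def unitv_def)

lemma hom_zero: "homo M M (\<lambda>x v. 0)" "lines (\<lambda>x v. 0) l = 0"
  by (simp_all add: hom_rep_def lin_zero lines_def lin_0[OF lin_mat_vec])

lemma trivial_in_tstab: "{} \<in> tstab r k (flagof M)" "{1..r} \<in> tstab r k (flagof M)"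
proof -
  have "proj {} x \<in> flagof M i j" for x i j
  proof -
    have "proj {} x = 0" by (auto simp: proj_def fun_eq_iff)
    then show ?thesis using fs.subspace_0[OF flagof_subspace] by simp
  qed
  then show "{} \<in> tstab r k (flagof M)" by (simp add: tstab_def stab_def)
  have "proj {1..r} x = x" if "x \<in> flagof M i j" for x i j
    using subsetD[OF flagof_subset that] by (auto simp: proj_def supp_on_def fun_eq_iff)
  then show "{1..r} \<in> tstab r k (flagof M)" by (simp add: tstab_def stab_def)
qed

text \<open>An idempotent acts on each line by 0 or 1, so its diagonal matrix is a coordinate
  projection preserving the flags; \<open>hom_exists\<close> goes back. The two trivial subsets
  correspond to the zero and the identity morphism by \<open>hom_unique\<close>.\<close>

lemma idem_rep_iff_tstab:
  fixes M :: "gvert \<times> gvert \<Rightarrow> nat \<Rightarrow> nat \<Rightarrow> 'k::field"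
  assumes n: "nice r k s d M" and M: "M \<in> Reps"
  shows "(\<exists>E. idem_rep VV AA d M E) \<longleftrightarrow> tstab r k (flagof M) \<noteq> {{}, {1..r}}"
proof
  assume "\<exists>E. idem_rep VV AA d M E"
  then obtain E where E: "idem_rep VV AA d M E" by blast
  have h: "homo M M E" using E by (simp add: idem_rep_def)
  have u: "(unitv 0 :: nat \<Rightarrow> 'k) \<in> vec 1" by (simp add: unitv_vec)
  have t01: "lines E l = 0 \<or> lines E l = 1" if l: "l \<in> {1..r}" for l
  proof -
    have "(unitv 0 :: nat \<Rightarrow> 'k) \<in> vec (d (Lv l))" using u d1[OF l] by simp
    then have "E (Lv l) (E (Lv l) (unitv 0)) = E (Lv l) (unitv 0)" using E Lv_VV[OF l] unfolding idem_rep_def by blast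
    then have "lines (\<lambda>x v. E x (E x v)) l = lines E l" by (simp add: lines_def)
    then have "lines E l * lines E l = lines E l" using hom_comp(2)[OF h h l] by simp
    then show ?thesis by simp
  qed
  define I where "I = {l \<in> {1..r}. lines E l = 1}"
  have "proj I x \<in> flagof M i j" if i: "i \<in> {1..k}" and x: "x \<in> flagof M i j" for i j x
  proof -
    have "proj I x = lines E * x"
    proof
      fix l
      show "proj I x l = (lines E * x) l"
        using t01[of l] supp_onD[OF subsetD[OF flagof_subset x], of l]
        by (cases "l \<in> {1..r}") (auto simp: proj_def I_def)
    qed
    then show ?thesis using hom_flagof[OF h i M x] by simp
  qed
  then have I: "I \<in> tstab r k (flagof M)" by (auto simp: tstab_def stab_def I_def)
  show "tstab r k (flagof M) \<noteq> {{}, {1..r}}"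
  proof
    assume "tstab r k (flagof M) = {{}, {1..r}}"
    then consider "I = {}" | "I = {1..r}" using I by blast
    then show False
    proof cases
      case 1
      then have "lines E l = lines (\<lambda>x v. 0) l" if "l \<in> {1..r}" for l
        using t01[OF that] that unfolding hom_zero(2) I_def by blast
      then have "E x v = 0" if "x \<in> VV" "v \<in> vec (d x)" for x v
        using hom_unique[OF n n M M h hom_zero(1) _ that] by blast
      then show False using E unfolding idem_rep_def by blast
    next
      case 2
      then have "lines E l = lines (\<lambda>x v. v) l" if "l \<in> {1..r}" for l
        using that unfolding hom_id(2) I_def by blast
      then have "E x v = v" if "x \<in> VV" "v \<in> vec (d x)" for x v
        using hom_unique[OF n n M M h hom_id(1) _ that] by blast
      then show False using E unfolding idem_rep_def by blast
    qed
  qed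
next
  assume "tstab r k (flagof M) \<noteq> {{}, {1..r}}"
  then obtain I where I: "I \<in> tstab r k (flagof M)" "I \<noteq> {}" "I \<noteq> {1..r}"
    using trivial_in_tstab[of M] by blast
  have Isub: "I \<subseteq> {1..r}" using I(1) by (simp add: tstab_def)
  define t where "t = (\<lambda>l. if l \<in> I then 1 else 0 :: 'k)"
  have "t * x \<in> flagof M i j" if i: "i \<in> {1..k}" and x: "x \<in> flagof M i j" for i j x
  proof -
    have "t * x = proj I x" by (auto simp: t_def proj_def fun_eq_iff)
    moreover have "proj I x \<in> flagof M i j" using I(1) i x unfolding tstab_def stab_def by blast
    ultimately show ?thesis by simp
  qed
  then obtain E where E: "homo M M E" "lines E = t" using hom_exists[OF n n M M] by blast
  have u: "(unitv 0 :: nat \<Rightarrow> 'k) \<in> vec 1" by (simp add: unitv_vec)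
  have u': "(unitv 0 :: nat \<Rightarrow> 'k) \<in> vec (d (Lv l))" if "l \<in> {1..r}" for l using u d1[OF that] by simp
  have "E x (E x v) = E x v" if "x \<in> VV" "v \<in> vec (d x)" for x v
  proof (rule hom_unique[OF n n M M hom_comp(1)[OF E(1) E(1)] E(1) _ that])
    fix l assume "l \<in> {1..r}"
    then show "lines (\<lambda>x v. E x (E x v)) l = lines E l"
      using hom_comp(2)[OF E(1) E(1)] by (simp add: E(2) t_def)
  qed
  moreover have "\<exists>x\<in>VV. \<exists>v\<in>vec (d x). E x v \<noteq> 0"
  proof -
    obtain l where l: "l \<in> I" using I(2) by blast
    then have l': "l \<in> {1..r}" using Isub by blast
    have "E (Lv l) (unitv 0) 0 = 1" using hom_Lv[OF E(1) l' u] l by (simp add: E(2) t_def unitv_def)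
    then have "E (Lv l) (unitv 0) \<noteq> 0" by auto
    then show ?thesis using Lv_VV[OF l'] u'[OF l'] by blast
  qed
  moreover have "\<exists>x\<in>VV. \<exists>v\<in>vec (d x). E x v \<noteq> v"
  proof -
    obtain l where l: "l \<in> {1..r}" "l \<notin> I" using I(3) Isub by blast
    have "E (Lv l) (unitv 0) 0 = 0" using hom_Lv[OF E(1) l(1) u] l by (simp add: E(2) t_def)
    moreover have "(unitv 0 :: nat \<Rightarrow> 'k) 0 = 1" by (simp add: unitv_def)
    ultimately have "E (Lv l) (unitv 0) \<noteq> unitv 0" by (metis zero_neq_one)
    then show ?thesis using Lv_VV[OF l(1)] u'[OF l(1)] by blast
  qed
  ultimately have "idem_rep VV AA d M E" using E(1) unfolding idem_rep_def by blast
  then show "\<exists>E. idem_rep VV AA d M E" by blast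
qed

text \<open>An isomorphism together with its inverse, which makes symmetry and transitivity
  immediate.\<close>

definition hom_pair :: "(gvert \<times> gvert \<Rightarrow> nat \<Rightarrow> nat \<Rightarrow> 'k::field) \<Rightarrow> (gvert \<times> gvert \<Rightarrow> nat \<Rightarrow> nat \<Rightarrow> 'k) \<Rightarrow>
    (gvert \<Rightarrow> (nat \<Rightarrow> 'k) \<Rightarrow> (nat \<Rightarrow> 'k)) \<Rightarrow> (gvert \<Rightarrow> (nat \<Rightarrow> 'k) \<Rightarrow> (nat \<Rightarrow> 'k)) \<Rightarrow> bool" where
  "hom_pair M N E E' \<longleftrightarrow> homo M N E \<and> homo N M E' \<and>
     (\<forall>x\<in>VV. \<forall>v\<in>vec (d x). E' x (E x v) = v \<and> E x (E' x v) = v)"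

lemma iso_rep_iff_hom_pair:
  fixes M N :: "gvert \<times> gvert \<Rightarrow> nat \<Rightarrow> nat \<Rightarrow> 'k::field"
  assumes M: "M \<in> Reps" and N: "N \<in> Reps"
  shows "iso_rep VV AA d M N \<longleftrightarrow> (\<exists>E E'. hom_pair M N E E')"
proof
  assume "iso_rep VV AA d M N"
  then obtain g where g: "\<forall>x\<in>VV. g x \<in> GL (d x)"
    and c: "\<forall>x y. (x, y) \<in> AA \<longrightarrow> mat_mult (d y) (g y) (M (x, y)) = mat_mult (d x) (N (x, y)) (g x)"
    unfolding iso_rep_def by blast
  have "\<forall>x\<in>VV. \<exists>h. h \<in> mat_box (d x) (d x) \<and> mat_mult (d x) (g x) h = id_mat (d x) \<and> mat_mult (d x) h (g x) = id_mat (d x)"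
    using g unfolding GL_def by blast
  from bchoice[OF this] obtain h where h: "\<forall>x\<in>VV. h x \<in> mat_box (d x) (d x) \<and>
     mat_mult (d x) (g x) (h x) = id_mat (d x) \<and> mat_mult (d x) (h x) (g x) = id_mat (d x)" by blast
  have gb: "g x \<in> mat_box (d x) (d x)" if "x \<in> VV" for x using g that by (simp add: GL_def)
  have hb: "h x \<in> mat_box (d x) (d x)" if "x \<in> VV" for x using h that by simp
  let ?E = "\<lambda>x. mat_vec (d x) (g x)" and ?E' = "\<lambda>x. mat_vec (d x) (h x)"
  have inv: "?E' x (?E x v) = v" "?E x (?E' x v) = v" if "x \<in> VV" "v \<in> vec (d x)" for x v
    using h that by (simp_all add: mat_vec_id flip: mat_vec_mult)
  have E: "homo M N ?E" using hom_rep_mat[OF gamma_A_subset M N gb] c by blast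
  have "?E' y (mat_vec (d x) (N (x, y)) v) = mat_vec (d x) (M (x, y)) (?E' x v)"
    if a: "(x, y) \<in> AA" and v: "v \<in> vec (d x)" for x y v
  proof -
    have xy: "x \<in> VV" "y \<in> VV" using a gamma_A_subset by blast+
    have w: "?E' x v \<in> vec (d x)" by (rule mat_vec_vec[OF hb[OF xy(1)]])
    have "?E y (mat_vec (d x) (M (x, y)) (?E' x v)) = mat_vec (d x) (N (x, y)) v"
      using homD(3)[OF E a w] inv(2)[OF xy(1) v] by simp
    moreover have "mat_vec (d x) (M (x, y)) (?E' x v) \<in> vec (d y)"
      using M a by (auto simp: reps_def intro: mat_vec_vec)
    ultimately show ?thesis using inv(1)[OF xy(2)] by metis
  qed
  then have "homo N M ?E'" unfolding hom_rep_def using lin_mat_vec mat_vec_vec[OF hb] by blast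
  then have "hom_pair M N ?E ?E'" using E inv unfolding hom_pair_def by blast
  then show "\<exists>E E'. hom_pair M N E E'" by blast
next
  assume "\<exists>E E'. hom_pair M N E E'"
  then obtain E E' where E: "homo M N E" "homo N M E'"
    and inv: "\<And>x v. x \<in> VV \<Longrightarrow> v \<in> vec (d x) \<Longrightarrow> E' x (E x v) = v" "\<And>x v. x \<in> VV \<Longrightarrow> v \<in> vec (d x) \<Longrightarrow> E x (E' x v) = v"
    unfolding hom_pair_def by blast
  define g where "g x = mat_of (d x) (d x) (E x)" for x
  define h where "h x = mat_of (d x) (d x) (E' x)" for x
  have gb: "g x \<in> mat_box (d x) (d x)" and hb: "h x \<in> mat_box (d x) (d x)" for x
    by (simp_all add: g_def h_def mat_of_box)
  have ge: "mat_vec (d x) (g x) v = E x v" and he: "mat_vec (d x) (h x) v = E' x v" if "x \<in> VV" "v \<in> vec (d x)" for x v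
    unfolding g_def h_def using hom_rep_mat_of(2)[OF gamma_A_subset M E(1) that] hom_rep_mat_of(2)[OF gamma_A_subset N E(2) that] by simp_all
  have "g x \<in> GL (d x)" if x: "x \<in> VV" for x
  proof -
    have "mat_mult (d x) (g x) (h x) = id_mat (d x)"
      by (rule mat_eqI[OF mat_mult_box[OF gb hb] id_mat_box])
        (simp add: mat_vec_mult mat_vec_id ge[OF x] he[OF x] inv[OF x] homD(2)[OF E(2) x])
    moreover have "mat_mult (d x) (h x) (g x) = id_mat (d x)"
      by (rule mat_eqI[OF mat_mult_box[OF hb gb] id_mat_box])
        (simp add: mat_vec_mult mat_vec_id ge[OF x] he[OF x] inv[OF x] homD(2)[OF E(1) x])
    ultimately show ?thesis unfolding GL_def using gb hb by blast
  qed
  moreover have "homo M N (\<lambda>x. mat_vec (d x) (g x))"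
    unfolding g_def by (rule hom_rep_mat_of(1)[OF gamma_A_subset M E(1)])
  then have "\<forall>x y. (x, y) \<in> AA \<longrightarrow> mat_mult (d y) (g y) (M (x, y)) = mat_mult (d x) (N (x, y)) (g x)"
    using hom_rep_mat[OF gamma_A_subset M N gb] by blast
  ultimately show "iso_rep VV AA d M N" unfolding iso_rep_def by blast
qed

lemma hom_pair_refl: "hom_pair M M (\<lambda>x v. v) (\<lambda>x v. v)"
  by (simp add: hom_pair_def hom_id)

lemma hom_pair_sym: "hom_pair M N E E' \<Longrightarrow> hom_pair N M E' E"
  by (auto simp: hom_pair_def)

lemma hom_pair_trans:
  assumes "hom_pair M N E E'" "hom_pair N P G G'"
  shows "hom_pair M P (\<lambda>x v. G x (E x v)) (\<lambda>x v. E' x (G' x v))"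
proof -
  have h: "homo M N E" "homo N M E'" "homo N P G" "homo P N G'" using assms by (auto simp: hom_pair_def)
  show ?thesis
    using assms homD(2)[OF h(1)] homD(2)[OF h(4)] hom_comp(1)[OF h(1,3)] hom_comp(1)[OF h(4,2)]
    by (auto simp: hom_pair_def)
qed

lemma equiv_iso_rep: "equiv (Reps :: (gvert \<times> gvert \<Rightarrow> nat \<Rightarrow> nat \<Rightarrow> 'k::field) set) {(M, N). M \<in> Reps \<and> N \<in> Reps \<and> iso_rep VV AA d M N}"
proof (rule equivI)
  show "{(M :: gvert \<times> gvert \<Rightarrow> nat \<Rightarrow> nat \<Rightarrow> 'k, N). M \<in> Reps \<and> N \<in> Reps \<and> iso_rep VV AA d M N} \<subseteq> Reps \<times> Reps" by auto
  have "iso_rep VV AA d M M" if "M \<in> Reps" for M :: "gvert \<times> gvert \<Rightarrow> nat \<Rightarrow> nat \<Rightarrow> 'k"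
    using iso_rep_iff_hom_pair[OF that that] hom_pair_refl[of M] by blast
  then show "refl_on Reps {(M :: gvert \<times> gvert \<Rightarrow> nat \<Rightarrow> nat \<Rightarrow> 'k, N). M \<in> Reps \<and> N \<in> Reps \<and> iso_rep VV AA d M N}"
    by (auto simp: refl_on_def)
  have "iso_rep VV AA d N M" if MN: "M \<in> Reps" "N \<in> Reps" and i: "iso_rep VV AA d M N" for M N :: "gvert \<times> gvert \<Rightarrow> nat \<Rightarrow> nat \<Rightarrow> 'k"
  proof -
    obtain E E' where "hom_pair M N E E'" using i iso_rep_iff_hom_pair[OF MN] by blast
    then have "hom_pair N M E' E" by (rule hom_pair_sym)
    then show ?thesis using iso_rep_iff_hom_pair[OF MN(2,1)] by blast
  qed
  then show "sym {(M :: gvert \<times> gvert \<Rightarrow> nat \<Rightarrow> nat \<Rightarrow> 'k, N). M \<in> Reps \<and> N \<in> Reps \<and> iso_rep VV AA d M N}"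
    by (auto intro!: symI)
  have "iso_rep VV AA d M P" if M: "M \<in> Reps" and N: "N \<in> Reps" and P: "P \<in> Reps"
    and i: "iso_rep VV AA d M N" "iso_rep VV AA d N P" for M N P :: "gvert \<times> gvert \<Rightarrow> nat \<Rightarrow> nat \<Rightarrow> 'k"
  proof -
    obtain E E' where E: "hom_pair M N E E'" using i(1) iso_rep_iff_hom_pair[OF M N] by blast
    obtain G G' where G: "hom_pair N P G G'" using i(2) iso_rep_iff_hom_pair[OF N P] by blast
    show ?thesis using hom_pair_trans[OF E G] iso_rep_iff_hom_pair[OF M P] by blast
  qed
  then show "trans {(M :: gvert \<times> gvert \<Rightarrow> nat \<Rightarrow> nat \<Rightarrow> 'k, N). M \<in> Reps \<and> N \<in> Reps \<and> iso_rep VV AA d M N}"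
    by (intro transI) blast
qed

text \<open>Mutually inverse morphisms have mutually inverse scalars on the lines, and flags are
  carried onto flags. Conversely \<open>t\<close> and its inverse both extend to morphisms, and the
  composites are identities by \<open>hom_unique\<close>.\<close>

lemma iso_rep_iff_torus:
  fixes M N :: "gvert \<times> gvert \<Rightarrow> nat \<Rightarrow> nat \<Rightarrow> 'k::field"
  assumes n: "nice r k s d M" "nice r k s d N" and MN: "M \<in> Reps" "N \<in> Reps"
  shows "iso_rep VV AA d M N \<longleftrightarrow> (\<exists>t\<in>torus r. \<forall>i\<in>{1..k}. \<forall>j. (*) t ` flagof M i j = flagof N i j)"
proof
  assume "iso_rep VV AA d M N"
  then obtain E E' where P: "hom_pair M N E E'" using iso_rep_iff_hom_pair[OF MN] by blast
  then have h: "homo M N E" "homo N M E'" by (auto simp: hom_pair_def)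
  have one: "lines E' l * lines E l = 1" if l: "l \<in> {1..r}" for l
  proof -
    have "(unitv 0 :: nat \<Rightarrow> 'k) \<in> vec (d (Lv l))" using d1[OF l] by (simp add: unitv_vec)
    then have "E' (Lv l) (E (Lv l) (unitv 0)) = unitv 0" using P Lv_VV[OF l] unfolding hom_pair_def by blast
    then have "lines (\<lambda>x v. E' x (E x v)) l = 1" by (simp add: lines_def unitv_def)
    then show ?thesis using hom_comp(2)[OF h l] by simp
  qed
  \<comment> \<open>The scalars of \<open>E\<close> mean nothing outside \<open>{1..r}\<close>; the
    value 1 there puts \<open>t\<close> into the torus, and flag vectors vanish there
    anyway.\<close>
  define t where "t = (\<lambda>l. if l \<in> {1..r} then lines E l else 1)"
  have t: "t \<in> torus r" using one by (force simp: t_def torus_def)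
  have "(*) t ` flagof M i j = flagof N i j" if i: "i \<in> {1..k}" for i j
  proof (intro equalityI subsetI)
    fix y assume "y \<in> (*) t ` flagof M i j"
    then obtain x where x: "x \<in> flagof M i j" "y = t * x" by blast
    have "t * x = lines E * x"
    proof
      fix l
      show "(t * x) l = (lines E * x) l"
        using supp_onD[OF subsetD[OF flagof_subset x(1)], of l] by (cases "l \<in> {1..r}") (auto simp: t_def)
    qed
    then show "y \<in> flagof N i j" using hom_flagof[OF h(1) i MN(1) x(1)] x(2) by simp
  next
    fix y assume y: "y \<in> flagof N i j"
    have "y = t * (lines E' * y)"
    proof
      fix l
      show "y l = (t * (lines E' * y)) l"
      proof (cases "l \<in> {1..r}")
        case True
        have "lines E l * (lines E' l * y l) = (lines E' l * lines E l) * y l" by (simp only: mult_ac)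
        then show ?thesis using one[OF True] True by (simp add: t_def)
      next
        case False
        then show ?thesis using supp_onD[OF subsetD[OF flagof_subset y]] by simp
      qed
    qed
    then show "y \<in> (*) t ` flagof M i j" using hom_flagof[OF h(2) i MN(2) y] by blast
  qed
  then show "\<exists>t\<in>torus r. \<forall>i\<in>{1..k}. \<forall>j. (*) t ` flagof M i j = flagof N i j" using t by blast
next
  assume "\<exists>t\<in>torus r. \<forall>i\<in>{1..k}. \<forall>j. (*) t ` flagof M i j = flagof N i j"
  then obtain t where t: "t \<in> torus r" "\<And>i j. i \<in> {1..k} \<Longrightarrow> (*) t ` flagof M i j = flagof N i j" by blast
  define t' where "t' = (\<lambda>l. inverse (t l))"
  have t't: "t' * t = 1" unfolding t'_def by (rule torus_inverse_mult[OF t(1)])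
  have 1: "t * x \<in> flagof N i j" if "i \<in> {1..k}" "x \<in> flagof M i j" for i j x using t(2)[OF that(1)] that(2) by blast
  have 2: "t' * y \<in> flagof M i j" if i: "i \<in> {1..k}" and y: "y \<in> flagof N i j" for i j y
  proof -
    obtain x where x: "y = t * x" "x \<in> flagof M i j" using t(2)[OF i] y by blast
    have "t' * y = x" unfolding x(1) by (simp add: t't flip: mult.assoc)
    then show ?thesis using x(2) by simp
  qed
  obtain E where E: "homo M N E" "lines E = t" using hom_exists[OF n MN 1] by blast
  obtain E' where E': "homo N M E'" "lines E' = t'" using hom_exists[OF n(2,1) MN(2,1) 2] by blast
  have l1: "t' l * t l = 1" for l using fun_cong[OF t't, of l] by simp
  have "E' x (E x v) = v" if "x \<in> VV" "v \<in> vec (d x)" for x v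
    by (rule hom_unique[OF n(1,1) MN(1,1) hom_comp(1)[OF E(1) E'(1)] hom_id(1) _ that])
      (simp add: hom_comp(2)[OF E(1) E'(1)] hom_id E(2) E'(2) l1)
  moreover have "E x (E' x v) = v" if "x \<in> VV" "v \<in> vec (d x)" for x v
    by (rule hom_unique[OF n(2,2) MN(2,2) hom_comp(1)[OF E'(1) E(1)] hom_id(1) _ that])
      (simp add: hom_comp(2)[OF E'(1) E(1)] hom_id E(2) E'(2) l1 mult.commute)
  ultimately have "hom_pair M N E E'" using E(1) E'(1) unfolding hom_pair_def by blast
  then show "iso_rep VV AA d M N" using iso_rep_iff_hom_pair[OF MN] by blast
qed

end

section \<open>Realizing flags by representations\<close>

text \<open>Every fibre over \<open>Y\<close> is a translate of the kernel.\<close>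

lemma card_lin_preimage:
  assumes f: "lin f" and S: "fs.subspace S" "finite S" and Y: "Y \<subseteq> f ` S"
  shows "card {x \<in> S. f x \<in> Y} = card {x \<in> S. f x = 0} * card Y"
proof -
  have finY: "finite Y" using Y S(2) finite_surj by blast
  have fib: "card {x \<in> S. f x = y} = card {x \<in> S. f x = 0}" if y: "y \<in> Y" for y
  proof -
    obtain x0 where x0: "x0 \<in> S" "f x0 = y" using y Y by blast
    have "bij_betw (\<lambda>x. x + x0) {x \<in> S. f x = 0} {x \<in> S. f x = y}"
      by (rule bij_betwI[where g = "\<lambda>x. x - x0"])
        (use x0 S(1) in \<open>auto simp: lin_add[OF f] lin_diff[OF f] intro: fs.subspace_add fs.subspace_diff\<close>)
    then show ?thesis by (rule bij_betw_same_card[symmetric])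
  qed
  have eq: "{x \<in> S. f x \<in> Y} = (\<Union>y\<in>Y. {x \<in> S. f x = y})" by auto
  have "card {x \<in> S. f x \<in> Y} = (\<Sum>y\<in>Y. card {x \<in> S. f x = y})"
    unfolding eq by (rule card_UN_disjoint) (use finY S(2) in auto)
  also have "\<dots> = card {x \<in> S. f x = 0} * card Y" by (simp add: fib)
  finally show ?thesis .
qed

text \<open>Reading off the pivot coordinates, enumerated by \<open>{..<m}\<close>, is an
  isomorphism from \<open>U\<close> to \<open>vec m\<close>; \<open>R\<close> and \<open>P\<close>
  are it and its inverse, as linear maps on the whole function space.\<close>

lemma subspace_coordinates:
  fixes U :: "(nat \<Rightarrow> 'k::{field,finite}) set"
  assumes U: "fs.subspace U" "U \<subseteq> supp_on {1..r}" and m: "card U = card (UNIV :: 'k set) ^ m"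
  shows "\<exists>R P. lin R \<and> lin P \<and> (\<forall>u\<in>U. R u \<in> vec m \<and> P (R u) = u) \<and> (\<forall>v\<in>vec m. P v \<in> U \<and> R (P v) = v)"
proof -
  have "card (piv U) = m"
    using card_subspace_piv[OF U] m card_UNIV_field_gt1[where 'k = 'k] by simp
  moreover have "finite (piv U)" using piv_subset[OF U(2)] finite_subset by blast
  ultimately obtain b where b: "bij_betw b {..<m} (piv U)"
    using ex_bij_betw_nat_finite[of "piv U"] by (auto simp: lessThan_atLeast0)
  define R :: "(nat \<Rightarrow> 'k) \<Rightarrow> nat \<Rightarrow> 'k" where "R x = (\<lambda>a. if a < m then x (b a) else 0)" for x
  have linR: "lin R" by (auto simp: lin_def R_def fun_eq_iff)
  have Rv: "R x \<in> vec m" for x by (simp add: R_def vec_def)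
  have inj: "inj_on R U"
  proof (rule lin_inj_on[OF linR U(1)])
    fix x assume x: "x \<in> U" "R x = 0"
    show "x = 0"
    proof (rule piv_unique[OF U x(1)])
      fix i assume "i \<in> piv U"
      then obtain a where a: "a < m" "i = b a" using b by (auto simp: bij_betw_def)
      then show "x i = 0" using fun_cong[OF x(2), of a] by (simp add: R_def)
    qed
  qed
  have surj: "\<exists>u\<in>U. R u = v" if v: "v \<in> vec m" for v
  proof -
    define w where "w i = v (inv_into {..<m} b i)" for i
    obtain u where u: "u \<in> U" "\<forall>i\<in>piv U. u i = w i" using piv_reduce[OF U] by blast
    have "R u a = v a" for a
    proof (cases "a < m")
      case True
      then have "b a \<in> piv U" using b by (auto simp: bij_betw_def)
      moreover have "inv_into {..<m} b (b a) = a" using True b by (auto simp: bij_betw_def)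
      ultimately show ?thesis using u(2) True by (simp add: R_def w_def)
    next
      case False
      then show ?thesis using v by (simp add: R_def vec_def)
    qed
    then show ?thesis using u(1) by blast
  qed
  obtain P where P: "lin P" "range P \<subseteq> U" "\<And>u. u \<in> U \<Longrightarrow> P (R u) = u"
    using lin_left_inverse[OF linR U(1) inj] by blast
  have RP: "R (P v) = v" if v: "v \<in> vec m" for v
  proof -
    obtain u where "u \<in> U" "R u = v" using surj[OF v] by blast
    then show ?thesis using P(3) by metis
  qed
  have PU: "P v \<in> U" for v using P(2) by blast
  show ?thesis by (intro exI[of _ R] exI[of _ P] conjI ballI linR P(1,3) Rv RP PU)
qed

locale supernova_dim =
  fixes r k :: nat and s :: "nat \<Rightarrow> nat" and mu :: "nat \<Rightarrow> nat \<Rightarrow> nat"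
  assumes rpos: "r \<ge> 1" and size: "\<And>i. i \<in> {1..k} \<Longrightarrow> psize s mu i \<le> r"
begin

sublocale supernova r k s "dimvec s mu"
  by unfold_locales (auto simp: dimvec_def psize_def)

abbreviation "dm i j \<equiv> dimvec s mu (Pv i j)"

lemma fdim_eq: "i \<in> {1..k} \<Longrightarrow> j \<le> Suc (s i) \<Longrightarrow> fdim r s mu i j = (r - psize s mu i) + dm i j"
proof -
  assume i: "i \<in> {1..k}" and j: "j \<le> Suc (s i)"
  have "(\<Sum>f = 1..j. mu i f) \<le> psize s mu i"
    unfolding psize_def by (rule sum_mono2) (use j in auto)
  then show ?thesis using size[OF i] j by (simp add: fdim_def dimvec_def)
qed

lemma dm_0: "dm i 0 = psize s mu i"
  by (simp add: dimvec_def)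

text \<open>Each step is a preimage under the surjective line map, so its dimension is that of the
  kernel, \<open>r - n_i\<close>, plus that of the leg position, whose image has the same dimension
  by injectivity.\<close>

lemma flagof_flags:
  fixes M :: "gvert \<times> gvert \<Rightarrow> nat \<Rightarrow> nat \<Rightarrow> 'k::{field,finite}"
  assumes n: "nice r k s (dimvec s mu) M" and M: "M \<in> Reps" and i: "i \<in> {1..k}"
  shows "flagof M i \<in> flags r (fdim r s mu i)"
proof -
  let ?q = "card (UNIV :: 'k set)" and ?X = "supp_on {1..r} :: (nat \<Rightarrow> 'k) set"
  let ?f = "linemap r M i"
  let ?ker = "card {x \<in> ?X. ?f x = 0}"
  have XX: "fs.subspace ?X" "finite ?X" by (simp_all add: subspace_supp_on finite_supp_on)
  have cv: "card (vec m :: (nat \<Rightarrow> 'k) set) = ?q ^ m" for m by (simp add: vec_eq card_supp_on)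
  have q0: "?q \<noteq> 0" using card_UNIV_field_gt1[where 'k = 'k] by simp
  have "card {x \<in> ?X. ?f x \<in> vec (dm i 0)} = ?ker * card (vec (dm i 0) :: (nat \<Rightarrow> 'k) set)"
    by (rule card_lin_preimage[OF lin_linemap XX]) (unfold linemap_surj[OF n i], rule order_refl)
  moreover have "{x \<in> ?X. ?f x \<in> vec (dm i 0)} = ?X" using linemap_vec[OF M i] by blast
  ultimately have "?q ^ r = ?ker * ?q ^ psize s mu i" by (simp add: cv card_supp_on dm_0)
  moreover have "?q ^ r = ?q ^ (r - psize s mu i) * ?q ^ psize s mu i"
    using size[OF i] by (simp flip: power_add)
  ultimately have ker: "?ker = ?q ^ (r - psize s mu i)" using q0 by simp
  have crd: "card (flagof M i j) = ?q ^ fdim r s mu i j" for j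
  proof (cases "j \<le> Suc (s i)")
    case True
    let ?Y = "phi M i j ` vec (dm i j)"
    have "flagof M i j = {x \<in> ?X. ?f x \<in> ?Y}" using True by (simp add: flagof_def)
    moreover have "card {x \<in> ?X. ?f x \<in> ?Y} = ?ker * card ?Y"
      by (rule card_lin_preimage[OF lin_linemap XX]) (unfold linemap_surj[OF n i], use phi_vec[OF M i True] in blast)
    moreover have "card ?Y = ?q ^ dm i j" using card_image[OF phi_inj[OF n M i True]] by (simp add: cv)
    ultimately show ?thesis by (simp only: ker fdim_eq[OF i True] power_add)
  next
    case False
    then have "flagof M i j = {0}" by (auto simp: flagof_def supp_on_def)
    then show ?thesis using False by (simp add: fdim_def)
  qed
  have "flagof M i (Suc j) \<subseteq> flagof M i j" for j
  proof
    fix x assume x: "x \<in> flagof M i (Suc j)"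
    have xs: "x \<in> ?X" using x flagof_subset by blast
    show "x \<in> flagof M i j"
    proof (cases "j \<le> s i")
      case True
      then obtain v where v: "v \<in> vec (dm i (Suc j))" "?f x = phi M i (Suc j) v" using x by (auto simp: flagof_def)
      then have "?f x \<in> phi M i j ` vec (dm i j)" using legmap_vec[OF M i True v(1)] by (auto simp: phi_Suc)
      then show ?thesis using True xs by (simp add: flagof_def)
    next
      case False
      then have "x = 0" using x by (simp add: flagof_def)
      then show ?thesis using fs.subspace_0[OF flagof_subspace] by simp
    qed
  qed
  then have "antimono (flagof M i)" by (simp add: antimono_iff_le_Suc)
  then show ?thesis unfolding flags_def by (intro CollectI conjI allI crd flagof_subspace flagof_subset)
qed

text \<open>One leg as abstract linear data, before matrices are formed: \<open>f\<close> is the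
  line map, \<open>A j\<close> the leg map out of position \<open>j\<close>. It includes the map out
  of the zero space at position \<open>s i + 1\<close>.\<close>

definition realizes :: "nat \<Rightarrow> (nat \<Rightarrow> (nat \<Rightarrow> 'k::field) set) \<Rightarrow> ((nat \<Rightarrow> 'k) \<Rightarrow> (nat \<Rightarrow> 'k)) \<times> (nat \<Rightarrow> (nat \<Rightarrow> 'k) \<Rightarrow> (nat \<Rightarrow> 'k)) \<Rightarrow> bool" where
  "realizes i G = (\<lambda>(f, A). lin f \<and> f ` supp_on {1..r} = vec (dm i 0) \<and>
     (\<forall>j\<le>s i. lin (A (Suc j)) \<and> (\<forall>v\<in>vec (dm i (Suc j)). A (Suc j) v \<in> vec (dm i j)) \<and> inj_on (A (Suc j)) (vec (dm i (Suc j)))) \<and>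
     (\<forall>j\<le>Suc (s i). \<forall>x\<in>supp_on {1..r}. x \<in> G j \<longleftrightarrow> f x \<in> cmp A 0 j ` vec (dm i j)))"

text \<open>The leg positions are the flag steps modulo the last one, \<open>K\<close>, and the leg
  maps are the inclusions between these quotients, all written in coordinates; the line map is the
  quotient map.\<close>

lemma realizes_exists:
  fixes G :: "nat \<Rightarrow> (nat \<Rightarrow> 'k::{field,finite}) set"
  assumes G: "G \<in> flags r (fdim r s mu i)" and i: "i \<in> {1..k}"
  shows "\<exists>fA. realizes i G fA"
proof -
  let ?q = "card (UNIV :: 'k set)" and ?X = "supp_on {1..r} :: (nat \<Rightarrow> 'k) set"
  have Gs: "fs.subspace (G j)" and GX: "G j \<subseteq> ?X" and Gc: "card (G j) = ?q ^ fdim r s mu i j" and anti: "antimono G" for j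
    using G by (auto simp: flags_def)
  have fin: "finite (G j)" for j using GX finite_supp_on[of "{1..r}"] finite_subset by blast
  have q0: "?q \<noteq> 0" using card_UNIV_field_gt1[where 'k = 'k] by simp
  define K where "K = G (Suc (s i))"
  have KG: "K \<subseteq> G j" if "j \<le> Suc (s i)" for j unfolding K_def using anti that by (rule antimonoD)
  have Ks: "fs.subspace K" by (simp add: K_def Gs)
  obtain g where g: "lin g" "range g \<subseteq> K" "\<And>v. v \<in> K \<Longrightarrow> g v = v"
    using lin_left_inverse[OF lin_id Ks] by (metis inj_on_id2)
  \<comment> \<open>Subtracting a linear projection onto \<open>K\<close> gives a map with kernel
    \<open>K\<close>, whose image serves as the quotient by \<open>K\<close> inside the same
    function space.\<close>
  define h where "h x = x - g x" for x
  have linh: "lin h" by (auto simp: lin_def h_def lin_add[OF g(1)] lin_smul[OF g(1)] fs.scale_right_diff_distrib)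
  have h0: "h x = 0 \<longleftrightarrow> x \<in> K" for x
  proof
    assume "h x = 0"
    then have "x = g x" by (simp add: h_def)
    then show "x \<in> K" using g(2) by (metis rangeI subsetD)
  qed (simp add: h_def g(3))
  define C where "C j = h ` G j" for j
  have Cs: "fs.subspace (C j)" for j unfolding C_def by (rule lin_image_subspace[OF linh Gs])
  have CX: "C j \<subseteq> ?X" for j
  proof -
    have "h x \<in> ?X" if x: "x \<in> G j" for x
    proof -
      have "g x \<in> ?X" using g(2) GX[of "Suc (s i)"] unfolding K_def by blast
      then show ?thesis unfolding h_def using x GX by (intro fs.subspace_diff[OF subspace_supp_on]) blast
    qed
    then show ?thesis by (auto simp: C_def)
  qed
  have Cc: "card (C j) = ?q ^ dm i j" if j: "j \<le> Suc (s i)" for j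
  proof -
    have "card {x \<in> G j. h x \<in> C j} = card {x \<in> G j. h x = 0} * card (C j)"
      by (rule card_lin_preimage[OF linh Gs fin]) (simp add: C_def)
    moreover have "{x \<in> G j. h x \<in> C j} = G j" by (auto simp: C_def)
    moreover have "{x \<in> G j. h x = 0} = K" using KG[OF j] h0 by blast
    moreover have "card K = ?q ^ (r - psize s mu i)"
      unfolding K_def Gc using fdim_eq[OF i, of "Suc (s i)"] dz[OF i] by simp
    ultimately have "?q ^ (r - psize s mu i) * ?q ^ dm i j = ?q ^ (r - psize s mu i) * card (C j)"
      using Gc[of j] by (simp add: fdim_eq[OF i j] power_add)
    then show ?thesis using q0 by simp
  qed
  have Canti: "C (Suc j) \<subseteq> C j" for j unfolding C_def using antimonoD[OF anti, of j "Suc j"] by (intro image_mono) simp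
  have C0: "C j \<subseteq> C 0" for j unfolding C_def using antimonoD[OF anti, of 0 j] by (intro image_mono) simp
  have G0: "G 0 = ?X"
  proof (rule card_subset_eq[OF _ GX])
    show "finite ?X" by (simp add: finite_supp_on)
    show "card (G 0) = card ?X" by (simp add: Gc fdim_def card_supp_on)
  qed
  have "\<forall>j\<in>{..Suc (s i)}. \<exists>RP. lin (fst RP) \<and> lin (snd RP) \<and> (\<forall>u\<in>C j. fst RP u \<in> vec (dm i j) \<and> snd RP (fst RP u) = u)
       \<and> (\<forall>v\<in>vec (dm i j). snd RP v \<in> C j \<and> fst RP (snd RP v) = v)"
  proof
    fix j assume "j \<in> {..Suc (s i)}"
    then have "card (C j) = ?q ^ dm i j" using Cc by simp
    from subspace_coordinates[OF Cs CX this]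
    show "\<exists>RP. lin (fst RP) \<and> lin (snd RP) \<and> (\<forall>u\<in>C j. fst RP u \<in> vec (dm i j) \<and> snd RP (fst RP u) = u)
       \<and> (\<forall>v\<in>vec (dm i j). snd RP v \<in> C j \<and> fst RP (snd RP v) = v)" by auto
  qed
  from bchoice[OF this] obtain RP where RP: "\<forall>j\<in>{..Suc (s i)}. lin (fst (RP j)) \<and> lin (snd (RP j)) \<and>
      (\<forall>u\<in>C j. fst (RP j) u \<in> vec (dm i j) \<and> snd (RP j) (fst (RP j) u) = u)
       \<and> (\<forall>v\<in>vec (dm i j). snd (RP j) v \<in> C j \<and> fst (RP j) (snd (RP j) v) = v)" by blast
  define R where "R j = fst (RP j)" for j
  define P where "P j = snd (RP j)" for j
  have linR: "lin (R j)" and linP: "lin (P j)" if "j \<le> Suc (s i)" for j using RP that by (auto simp: R_def P_def)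
  have Ru: "R j u \<in> vec (dm i j)" "P j (R j u) = u" if "j \<le> Suc (s i)" "u \<in> C j" for j u
    using RP that by (auto simp: R_def P_def)
  have Pv: "P j v \<in> C j" "R j (P j v) = v" if "j \<le> Suc (s i)" "v \<in> vec (dm i j)" for j v
    using RP that by (auto simp: R_def P_def)
  define f where "f x = R 0 (h x)" for x
  \<comment> \<open>The inclusion of \<open>C j\<close> into \<open>C (j - 1)\<close>: the
    parametrisation of the smaller space followed by coordinates on the larger one.\<close>
  define A where "A j v = R (j - 1) (P j v)" for j v
  have ASuc: "A (Suc j) v = R j (P (Suc j) v)" for j v by (simp add: A_def)
  have linf: "lin f" unfolding f_def by (rule lin_comp[OF linR linh]) simp
  have fim: "f ` ?X = vec (dm i 0)"
  proof (intro equalityI subsetI)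
    fix y assume "y \<in> f ` ?X"
    then show "y \<in> vec (dm i 0)" using Ru(1)[of 0] by (auto simp: f_def C_def G0)
  next
    fix y :: "nat \<Rightarrow> 'k" assume y: "y \<in> vec (dm i 0)"
    obtain x where x: "x \<in> ?X" "P 0 y = h x" using Pv(1)[of 0 y] y by (auto simp: C_def G0)
    have "y = f x" using Pv(2)[of 0 y] y x(2) by (simp add: f_def)
    then show "y \<in> f ` ?X" using x(1) by blast
  qed
  have Av: "A (Suc j) v \<in> vec (dm i j)" "P j (A (Suc j) v) = P (Suc j) v"
    if j: "j \<le> s i" and v: "v \<in> vec (dm i (Suc j))" for j v
  proof -
    have "P (Suc j) v \<in> C j" using Pv(1)[of "Suc j" v] j v Canti by auto
    then show "A (Suc j) v \<in> vec (dm i j)" "P j (A (Suc j) v) = P (Suc j) v"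
      using Ru[of j "P (Suc j) v"] j by (simp_all add: ASuc)
  qed
  have Ainj: "inj_on (A (Suc j)) (vec (dm i (Suc j)))" if j: "j \<le> s i" for j
  proof (rule inj_on_inverseI[where g = "\<lambda>w. R (Suc j) (P j w)"])
    fix v :: "nat \<Rightarrow> 'k" assume v: "v \<in> vec (dm i (Suc j))"
    show "R (Suc j) (P j (A (Suc j) v)) = v" unfolding Av(2)[OF j v] using Pv(2)[of "Suc j" v] j v by simp
  qed
  have cA: "cmp A 0 j v = R 0 (P j v)" if "j \<le> Suc (s i)" "v \<in> vec (dm i j)" for j v
    using that
  proof (induction j arbitrary: v)
    case 0
    then show ?case using Pv(2)[of 0 v] by simp
  next
    case (Suc j)
    have j: "j \<le> s i" using Suc.prems by simp
    have "cmp A 0 (Suc j) v = cmp A 0 j (A (Suc j) v)" by simp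
    also have "\<dots> = R 0 (P j (A (Suc j) v))" using Suc.IH Av(1)[OF j Suc.prems(2)] j by simp
    also have "\<dots> = R 0 (P (Suc j) v)" unfolding Av(2)[OF j Suc.prems(2)] ..
    finally show ?case .
  qed
  have mem: "x \<in> G j \<longleftrightarrow> f x \<in> cmp A 0 j ` vec (dm i j)" if j: "j \<le> Suc (s i)" and x: "x \<in> ?X" for j x
  proof
    assume "x \<in> G j"
    then have hx: "h x \<in> C j" by (simp add: C_def)
    have "f x = cmp A 0 j (R j (h x))" unfolding cA[OF j Ru(1)[OF j hx]] Ru(2)[OF j hx] f_def ..
    then show "f x \<in> cmp A 0 j ` vec (dm i j)" using Ru(1)[OF j hx] by blast
  next
    assume "f x \<in> cmp A 0 j ` vec (dm i j)"
    then obtain v where v: "v \<in> vec (dm i j)" "f x = R 0 (P j v)" using cA[OF j] by auto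
    have "h x \<in> C 0" using x by (simp add: C_def G0)
    moreover have "P j v \<in> C 0" using Pv(1)[OF j v(1)] C0 by blast
    ultimately have "h x = P j v" using Ru(2)[of 0] v(2) unfolding f_def by (metis zero_le)
    then have "h x \<in> C j" using Pv(1)[OF j v(1)] by simp
    then obtain y where y: "y \<in> G j" "h x = h y" by (auto simp: C_def)
    then have "h (x - y) = 0" by (simp add: lin_diff[OF linh])
    then have "x - y \<in> G j" using h0 KG[OF j] by blast
    then have "x - y + y \<in> G j" using y(1) by (rule fs.subspace_add[OF Gs])
    then show "x \<in> G j" by simp
  qed
  have linA: "lin (A (Suc j))" if "j \<le> s i" for j
    unfolding ASuc by (rule lin_comp[OF linR linP]) (use that in simp_all)
  have "realizes i G (f, A)"
    unfolding realizes_def using linf fim Av(1) Ainj mem linA by auto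
  then show ?thesis by blast
qed

end

section \<open>The counting formula\<close>

text \<open>Both images are in bijection with \<open>A\<close> modulo the common fibre relation.
  This compares isomorphism classes and torus orbits without constructing a map between
  them.\<close>

lemma card_image_same_kernel:
  assumes "\<And>x y. x \<in> A \<Longrightarrow> y \<in> A \<Longrightarrow> f x = f y \<longleftrightarrow> g x = g y"
  shows "card (f ` A) = card (g ` A)"
proof (rule bij_betw_same_card[of "\<lambda>z. g (inv_into A f z)"], rule bij_betw_imageI)
  have inv: "inv_into A f (f x) \<in> A" "f (inv_into A f (f x)) = f x" if "x \<in> A" for x
    using that by (simp_all add: inv_into_into f_inv_into_f)
  have g: "g (inv_into A f (f x)) = g x" if "x \<in> A" for x
    using assms[OF inv(1)[OF that] that] inv(2)[OF that] by blast
  show "inj_on (\<lambda>z. g (inv_into A f z)) (f ` A)"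
  proof (rule inj_onI)
    fix z w assume zw: "z \<in> f ` A" "w \<in> f ` A" "g (inv_into A f z) = g (inv_into A f w)"
    obtain x y where xy: "x \<in> A" "y \<in> A" "z = f x" "w = f y" using zw by blast
    have "g x = g y" using zw(3) unfolding xy g[OF xy(1)] g[OF xy(2)] .
    then show "z = w" using assms[OF xy(1,2)] xy(3,4) by simp
  qed
  show "(\<lambda>z. g (inv_into A f z)) ` f ` A = g ` A"
    unfolding image_image using g by (rule image_cong[OF refl])
qed

context supernova_dim
begin

abbreviation "ftuple M \<equiv> restrict (flagof M) {1..k}"

lemma tstab_ftuple: "tstab r k (ftuple M) = tstab r k (flagof M)"
  by (simp add: tstab_def)

lemma flag_tuple_realized:
  fixes F :: "nat \<Rightarrow> nat \<Rightarrow> (nat \<Rightarrow> 'k::{field,finite}) set"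
  assumes F: "F \<in> flag_tuples r k (fdim r s mu)"
  shows "\<exists>M\<in>Reps. nice r k s (dimvec s mu) M \<and> ftuple M = F"
proof -
  have "\<forall>i\<in>{1..k}. \<exists>fA. realizes i (F i) fA"
  proof
    fix i assume i: "i \<in> {1..k}"
    have "F i \<in> flags r (fdim r s mu i)" using F i unfolding flag_tuples_def by (rule PiE_mem)
    then show "\<exists>fA. realizes i (F i) fA" using i by (rule realizes_exists)
  qed
  from bchoice[OF this] obtain fA where fA: "\<forall>i\<in>{1..k}. realizes i (F i) (fA i)" by blast
  define f where "f i = fst (fA i)" for i
  define A where "A i = snd (fA i)" for i
  have R: "realizes i (F i) (f i, A i)" if "i \<in> {1..k}" for i using fA that by (simp add: f_def A_def)
  have linf: "lin (f i)" and fim: "f i ` supp_on {1..r} = vec (dm i 0)" if "i \<in> {1..k}" for i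
    using R[OF that] unfolding realizes_def by auto
  have linA: "lin (A i (Suc j))" and Av: "v \<in> vec (dm i (Suc j)) \<Longrightarrow> A i (Suc j) v \<in> vec (dm i j)"
    and Ainj: "inj_on (A i (Suc j)) (vec (dm i (Suc j)))" if "i \<in> {1..k}" "j \<le> s i" for i j v
    using R[OF that(1)] that(2) unfolding realizes_def by auto
  have mem: "x \<in> F i j \<longleftrightarrow> f i x \<in> cmp (A i) 0 j ` vec (dm i j)"
    if "i \<in> {1..k}" "j \<le> Suc (s i)" "x \<in> supp_on {1..r}" for i j x
    using R[OF that(1)] that(2,3) unfolding realizes_def by blast
  define M :: "gvert \<times> gvert \<Rightarrow> nat \<Rightarrow> nat \<Rightarrow> 'k" where
    "M a = (if a \<in> AA then (case a of (Lv l, Pv i j) \<Rightarrow> mat_of (dm i j) 1 (\<lambda>v. f i (smul (v 0) (unitv l)))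
       | (Pv i j, y) \<Rightarrow> mat_of (dimvec s mu y) (dm i j) (A i j) | _ \<Rightarrow> (\<lambda>_ _. 0)) else (\<lambda>_ _. 0))" for a
  have Mline: "M (Lv l, Pv i 0) = mat_of (dm i 0) 1 (\<lambda>v. f i (smul (v 0) (unitv l)))" if "l \<in> {1..r}" "i \<in> {1..k}" for l i
    using that by (auto simp: M_def gamma_A_def)
  have Mleg: "M (Pv i (Suc j), Pv i j) = mat_of (dm i j) (dm i (Suc j)) (A i (Suc j))" if "i \<in> {1..k}" "Suc j \<le> s i" for i j
  proof -
    have "(Pv i (Suc j), Pv i j) \<in> AA" using that unfolding gamma_A_def by (auto intro!: exI[of _ "Suc j"])
    then show ?thesis by (simp add: M_def)
  qed
  have MR: "M \<in> Reps"
  proof -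
    have "M (x, y) \<in> mat_box (dimvec s mu y) (dimvec s mu x)" if a: "(x, y) \<in> AA" for x y
      using a mat_of_box by (auto simp: M_def gamma_A_def dimvec_def)
    then show ?thesis by (auto simp: reps_def M_def)
  qed
  have lm: "linemap r M i x = f i x" if i: "i \<in> {1..k}" and x: "x \<in> supp_on {1..r}" for i x
  proof
    fix a
    have xe: "x = (\<Sum>l\<in>{1..r}. smul (x l) (unitv l))"
    proof
      fix m
      have "(\<Sum>l\<in>{1..r}. smul (x l) (unitv l)) m = (\<Sum>l\<in>{1..r}. if m = l then x l else 0)"
        unfolding sum_apply by (rule sum.cong) (auto simp: unitv_def)
      also have "\<dots> = (if m \<in> {1..r} then x m else 0)" by (rule sum.delta') simp
      also have "\<dots> = x m" using supp_onD[OF x, of m] by auto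
      finally show "x m = (\<Sum>l\<in>{1..r}. smul (x l) (unitv l)) m" by simp
    qed
    have fx: "f i x = (\<Sum>l\<in>{1..r}. smul (x l) (f i (unitv l)))"
      by (subst xe) (simp only: lin_sum[OF linf[OF i]] lin_smul[OF linf[OF i]])
    show "linemap r M i x a = f i x a"
    proof (cases "a < dm i 0")
      case True
      have "M (Lv l, Pv i 0) a 0 = f i (unitv l) a" if l: "l \<in> {1..r}" for l
      proof -
        have "smul (unitv 0 0) (unitv l) = (unitv l :: nat \<Rightarrow> 'k)" by (auto simp: unitv_def fun_eq_iff)
        then show ?thesis unfolding Mline[OF l i] mat_of_def using True by simp
      qed
      then have "linemap r M i x a = (\<Sum>l\<in>{1..r}. f i (unitv l) a * x l)"
        unfolding linemap_def by (intro sum.cong refl) simp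
      then show ?thesis unfolding fx sum_apply by (simp add: mult.commute)
    next
      case False
      have "f i x \<in> vec (dm i 0)" using fim[OF i] x by blast
      then show ?thesis using False linemap_vec[OF MR i, of x] by (simp add: vec_def)
    qed
  qed
  have leg: "legmap (dimvec s mu) M i (Suc j) v = A i (Suc j) v"
    if i: "i \<in> {1..k}" and j: "j \<le> s i" and v: "v \<in> vec (dm i (Suc j))" for i j v
  proof (cases "j = s i")
    case True
    then have "v = 0" using v dz[OF i] by (simp add: vec_zero)
    then show ?thesis using lin_0[OF lin_legmap] lin_0[OF linA[OF i j]] by simp
  next
    case False
    then have j': "Suc j \<le> s i" using j by simp
    show ?thesis unfolding legmap_def diff_Suc_1 Mleg[OF i j']
      by (rule mat_vec_mat_of_lin[OF linA[OF i j] Av[OF i j] v])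
  qed
  have phiA: "phi M i j v = cmp (A i) 0 j v" if i: "i \<in> {1..k}" and j: "j \<le> Suc (s i)" and v: "v \<in> vec (dm i j)" for i j v
    using j v
  proof (induction j arbitrary: v)
    case (Suc j)
    have j: "j \<le> s i" using Suc.prems by simp
    have "phi M i (Suc j) v = phi M i j (A i (Suc j) v)" unfolding phi_Suc leg[OF i j Suc.prems(2)] ..
    also have "\<dots> = cmp (A i) 0 j (A i (Suc j) v)" using Suc.IH Av[OF i j Suc.prems(2)] j by simp
    finally show ?case by simp
  qed (simp add: phi_0)
  have nice: "nice r k s (dimvec s mu) M"
    unfolding nice_def
  proof (intro ballI conjI)
    fix i assume i: "i \<in> {1..k}"
    show "linemap r M i ` supp_on {1..r} = vec (dm i 0)"
      unfolding fim[OF i, symmetric] by (rule image_cong[OF refl lm[OF i]])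
    fix j assume "j \<in> {1..s i}"
    then obtain j' where j': "j = Suc j'" "j' \<le> s i" by (cases j) auto
    show "inj_on (legmap (dimvec s mu) M i j) (vec (dm i j))"
      unfolding j'(1) using Ainj[OF i j'(2)] by (subst inj_on_cong[OF leg[OF i j'(2)]])
  qed
  have "flagof M i j = F i j" if i: "i \<in> {1..k}" for i j
  proof (cases "j \<le> Suc (s i)")
    case True
    have "flagof M i j = {x \<in> supp_on {1..r}. linemap r M i x \<in> phi M i j ` vec (dm i j)}" using True by (simp add: flagof_def)
    also have "phi M i j ` vec (dm i j) = cmp (A i) 0 j ` vec (dm i j)"
      by (rule image_cong[OF refl]) (rule phiA[OF i True])
    also have "{x \<in> supp_on {1..r}. linemap r M i x \<in> cmp (A i) 0 j ` vec (dm i j)}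
        = {x \<in> supp_on {1..r}. f i x \<in> cmp (A i) 0 j ` vec (dm i j)}"
      using lm[OF i] by (intro Collect_cong conj_cong refl) simp
    also have "\<dots> = F i j" using mem[OF i True] flag_tuplesD(2)[OF F i, of j] by blast
    finally show ?thesis .
  next
    case False
    \<comment> \<open>Beyond step \<open>s i + 1\<close> the prescribed dimension 0 forces the step
      to be zero, the default value in \<open>flagof\<close>.\<close>
    then have "card (F i j) = 1" using flag_tuplesD(3)[OF F i, of j] by (simp add: fdim_def)
    then have "F i j = {0}" using fs.subspace_0[OF flag_tuplesD(1)[OF F i, of j]] by (auto simp: card_1_singleton_iff)
    moreover have "flagof M i j = {0}" using False by (auto simp: flagof_def supp_on_def)
    ultimately show ?thesis by simp
  qed
  then have FM: "flagof M i = F i" if "i \<in> {1..k}" for i using that by blast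
  have "ftuple M = F"
  proof
    fix i
    show "ftuple M i = F i"
    proof (cases "i \<in> {1..k}")
      case True
      then show ?thesis using FM[OF True] by simp
    next
      case False
      have "F \<in> extensional {1..k}" using F by (simp add: flag_tuples_def PiE_def)
      then have "F i = undefined" using False by (rule extensional_arb)
      then show ?thesis using False by (simp add: restrict_def del: atLeastAtMost_iff)
    qed
  qed
  then show ?thesis using MR nice by blast
qed

text \<open>An idempotent over the ground field persists over the closure, which excludes the
  representations that are not \<open>nice\<close>. For \<open>nice\<close> ones idempotents
  descend, so decomposability may be tested over the ground field, where \<open>tstab\<close>
  decides it.\<close>

lemma abs_indecomposable_iff:
  fixes M :: "gvert \<times> gvert \<Rightarrow> nat \<Rightarrow> nat \<Rightarrow> 'k::field"
  assumes M: "M \<in> Reps"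
  shows "abs_indecomposable VV AA (dimvec s mu) M \<longleftrightarrow>
    nice r k s (dimvec s mu) M \<and> tstab r k (flagof M) = {{}, {1..r}}"
proof -
  let ?d = "dimvec s mu" and ?M = "\<lambda>a i j. to_ac (M a i j)"
  have M': "?M \<in> Reps" using M by (auto simp: reps_def mat_box_def)
  have "Lv 1 \<in> VV" "?d (Lv 1) \<noteq> 0" using rpos by (auto simp: gamma_V_def dimvec_def)
  then have ai: "abs_indecomposable VV AA ?d M \<longleftrightarrow> \<not> (\<exists>e. idem_mat VV AA ?d ?M e)"
    unfolding abs_indecomposable_def indecomposable_def decomposable_iff_idem_mat[OF gamma_A_subset M'] by blast
  have up: "\<exists>e. idem_mat VV AA ?d ?M e" if E: "idem_rep VV AA ?d M E" for E
    using idem_mat_of_idem_rep[OF gamma_A_subset M E] idem_mat_to_ac by blast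
  show ?thesis
  proof (cases "nice r k s ?d M")
    case False
    then show ?thesis using not_nice_idem_rep[OF M rpos d1] up ai by blast
  next
    case True
    have "(\<exists>e. idem_mat VV AA ?d ?M e) \<longleftrightarrow> (\<exists>E. idem_rep VV AA ?d M E)"
    proof
      assume "\<exists>e. idem_mat VV AA ?d ?M e"
      then obtain e where "idem_mat VV AA ?d M e" using nice_idem_descends[OF True M d1] by blast
      moreover have "e x \<in> mat_box (?d x) (?d x)" if "x \<in> VV" for x using calculation that by (simp add: idem_mat_def)
      ultimately show "\<exists>E. idem_rep VV AA ?d M E" using idem_rep_mat[OF gamma_A_subset M, of e] by blast
    qed (use up in blast)
    then show ?thesis unfolding ai idem_rep_iff_tstab[OF True M] using True by simp
  qed
qed

lemma iso_rep_iff_orb: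
  fixes M N :: "gvert \<times> gvert \<Rightarrow> nat \<Rightarrow> nat \<Rightarrow> 'k::{field,finite}"
  assumes n: "nice r k s (dimvec s mu) M" "nice r k s (dimvec s mu) N" and MN: "M \<in> Reps" "N \<in> Reps"
  shows "iso_rep VV AA (dimvec s mu) M N \<longleftrightarrow> orb r k (ftuple M) = orb r k (ftuple N)"
proof -
  have mem: "ftuple K \<in> flag_tuples r k (fdim r s mu)" if "nice r k s (dimvec s mu) K" "K \<in> Reps"
    for K :: "gvert \<times> gvert \<Rightarrow> nat \<Rightarrow> nat \<Rightarrow> 'k"
    using flagof_flags[OF that] unfolding flag_tuples_def by auto
  have "iso_rep VV AA (dimvec s mu) M N \<longleftrightarrow> (\<exists>t\<in>torus r. act k t (ftuple M) = ftuple N)"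
  proof -
    have "act k t (ftuple M) = ftuple N \<longleftrightarrow> (\<forall>i\<in>{1..k}. \<forall>j. (*) t ` flagof M i j = flagof N i j)" for t
    proof
      assume eq: "act k t (ftuple M) = ftuple N"
      have "(*) t ` flagof M i j = flagof N i j" if i: "i \<in> {1..k}" for i j
        using fun_cong[OF fun_cong[OF eq, of i], of j] i by (simp add: act_def)
      then show "\<forall>i\<in>{1..k}. \<forall>j. (*) t ` flagof M i j = flagof N i j" by blast
    next
      assume eq: "\<forall>i\<in>{1..k}. \<forall>j. (*) t ` flagof M i j = flagof N i j"
      have "act k t (ftuple M) = restrict (\<lambda>i j. (*) t ` flagof M i j) {1..k}"
        unfolding act_def by (rule restrict_ext) simp
      also have "\<dots> = ftuple N" by (rule restrict_ext, rule ext) (use eq in blast)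
      finally show "act k t (ftuple M) = ftuple N" .
    qed
    then show ?thesis unfolding iso_rep_iff_torus[OF n MN] by (intro bex_cong refl) (rule sym)
  qed
  also have "\<dots> \<longleftrightarrow> ftuple N \<in> orb r k (ftuple M)"
    unfolding orb_def image_iff by (intro bex_cong refl) (rule eq_commute)
  also have "\<dots> \<longleftrightarrow> orb r k (ftuple M) = orb r k (ftuple N)"
  proof
    assume "ftuple N \<in> orb r k (ftuple M)"
    from orb_eq[OF mem[OF n(1) MN(1)] this] show "orb r k (ftuple M) = orb r k (ftuple N)" by simp
  qed (use orb_self[OF mem[OF n(2) MN(2)]] in simp)
  finally show ?thesis .
qed

text \<open>Isomorphism classes and orbits of flag tuples are two images of the same set of
  representations with the same fibres; by realizability the orbits are those of all connected
  tuples, each of size \<open>(q - 1) ^ (r - 1)\<close>.\<close>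

lemma kac_count_eq:
  "(card (UNIV :: 'k::{field,finite} set) - 1) ^ (r - 1) * kac_count VV AA (dimvec s mu) (F :: 'k itself) =
   card {F \<in> flag_tuples r k (fdim r s mu) :: (nat \<Rightarrow> nat \<Rightarrow> (nat \<Rightarrow> 'k) set) set. tstab r k F = {{}, {1..r}}}"
proof -
  let ?d = "dimvec s mu"
  let ?C = "{F \<in> flag_tuples r k (fdim r s mu) :: (nat \<Rightarrow> nat \<Rightarrow> (nat \<Rightarrow> 'k) set) set. tstab r k F = {{}, {1..r}}}"
  define I where "I = {M :: gvert \<times> gvert \<Rightarrow> nat \<Rightarrow> nat \<Rightarrow> 'k. M \<in> Reps \<and> abs_indecomposable VV AA ?d M}"
  define E where "E = {(M :: gvert \<times> gvert \<Rightarrow> nat \<Rightarrow> nat \<Rightarrow> 'k, N). M \<in> Reps \<and> N \<in> Reps \<and> iso_rep VV AA ?d M N}"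
  have eqE: "equiv Reps E" unfolding E_def by (rule equiv_iso_rep)
  have I: "M \<in> Reps" "nice r k s ?d M" "tstab r k (flagof M) = {{}, {1..r}}" if "M \<in> I" for M
    using that abs_indecomposable_iff[of M] by (auto simp: I_def)
  have im: "ftuple ` I = ?C"
  proof (intro equalityI subsetI)
    fix F assume "F \<in> ftuple ` I"
    then obtain M where M: "M \<in> I" "F = ftuple M" by blast
    have "ftuple M \<in> flag_tuples r k (fdim r s mu)"
      using flagof_flags[OF I(2,1)[OF M(1)]] unfolding flag_tuples_def by auto
    then show "F \<in> ?C" using I(3)[OF M(1)] M(2) tstab_ftuple[of M] by simp
  next
    fix F assume F: "F \<in> ?C"
    then have "F \<in> flag_tuples r k (fdim r s mu)" by simp
    from flag_tuple_realized[OF this] obtain M where M: "M \<in> Reps" "nice r k s ?d M" "ftuple M = F" by (elim bexE conjE)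
    have "tstab r k (flagof M) = {{}, {1..r}}" using F M(3) tstab_ftuple[of M] by simp
    then have "M \<in> I" using M abs_indecomposable_iff[OF M(1)] by (simp add: I_def)
    then show "F \<in> ftuple ` I" using M(3) by blast
  qed
  have "kac_count VV AA ?d (F :: 'k itself) = card (I // E)" by (simp add: kac_count_def I_def E_def)
  also have "I // E = (\<lambda>M. E `` {M}) ` I" by (auto simp: quotient_def)
  also have "card ((\<lambda>M. E `` {M}) ` I) = card ((\<lambda>M. orb r k (ftuple M)) ` I)"
  proof (rule card_image_same_kernel)
    fix M N assume MN: "M \<in> I" "N \<in> I"
    have "E `` {M} = E `` {N} \<longleftrightarrow> (M, N) \<in> E" using eq_equiv_class_iff[OF eqE I(1)[OF MN(1)] I(1)[OF MN(2)]] .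
    also have "\<dots> \<longleftrightarrow> iso_rep VV AA ?d M N" using I(1)[OF MN(1)] I(1)[OF MN(2)] by (simp add: E_def)
    also have "\<dots> \<longleftrightarrow> orb r k (ftuple M) = orb r k (ftuple N)"
      by (rule iso_rep_iff_orb[OF I(2)[OF MN(1)] I(2)[OF MN(2)] I(1)[OF MN(1)] I(1)[OF MN(2)]])
    finally show "E `` {M} = E `` {N} \<longleftrightarrow> orb r k (ftuple M) = orb r k (ftuple N)" .
  qed
  also have "(\<lambda>M. orb r k (ftuple M)) ` I = orb r k ` ?C" unfolding im[symmetric] image_image ..
  finally have kc: "kac_count VV AA ?d (F :: 'k itself) = card (orb r k ` ?C)" .
  have "card ?C = (card (UNIV :: 'k set) - 1) ^ (r - 1) * card (orb r k ` ?C)"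
    by (rule card_orbits[OF rpos card_connected_flag_tuples(1)[OF rpos size]])
  then show ?thesis unfolding kc by (rule sym)
qed

end

theorem theorem3p14:
  fixes r k :: nat and s :: "nat \<Rightarrow> nat" and mu :: "nat \<Rightarrow> nat \<Rightarrow> nat"
    and F :: "'a :: {field, finite} itself"
  assumes "r \<ge> 1" and "k \<ge> 1"
    and "\<forall>i\<in>{1..k}. \<forall>f\<in>{1..s i}. mu i (Suc f) \<le> mu i f"
    and "\<forall>i\<in>{1..k}. psize s mu i > 0"
    and "\<forall>i\<in>{1..k}. r \<ge> psize s mu i + mu i 1"
  shows "int (kac_count (gamma_V r k s) (gamma_A r k s) (dimvec s mu) F) =
         (\<Sum>w \<in> (\<Pi>\<^sub>E i\<in>{1..k}. S_perm r (mu_tilde r s mu i)). R_poly r k w (int (card (UNIV :: 'a set))))"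
proof -
  let ?q = "card (UNIV :: 'a set)"
  have size: "psize s mu i \<le> r" if "i \<in> {1..k}" for i using assms(5) that by fastforce
  interpret supernova_dim r k s mu by unfold_locales (use assms(1) size in auto)
  have q: "?q > 1" by (rule card_UNIV_field_gt1)
  have "(int ?q - 1) ^ (r - 1) * int (kac_count VV AA (dimvec s mu) F)
      = int ((?q - 1) ^ (r - 1) * kac_count VV AA (dimvec s mu) F)"
    using q by (simp add: of_nat_diff)
  also have "\<dots> = (int ?q - 1) ^ (r - 1) *
      (\<Sum>w \<in> (\<Pi>\<^sub>E i\<in>{1..k}. S_perm r (mu_tilde r s mu i)). R_poly r k w (int ?q))"
    unfolding kac_count_eq by (rule card_connected_flag_tuples(2)[OF assms(1) size])
  \<comment> \<open>Since \<open>q > 1\<close>, the common factor \<open>(q - 1) ^ (r - 1)\<close>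
    is nonzero and cancels.\<close>
  finally show ?thesis using q by simp
qed

end
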